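(* Let $K$ be a field of characteristic $p>0$ and let $G$ be a group such that the group algebra $KG$ is Lie nilpotent. Then $t_{L}(KG)=|G'|+1$ if and only if one of the following conditions holds: (1) the commutator subgroup $G'$ is cyclic; (2) $p=2$, $G'$ is the noncyclic group of order $4$, and $\gamma_3(G)\neq 1$.
   Context: Let $R$ be an associative algebra with identity. Put $[x,y]=xy-yx$ and $[x_1,\ldots,x_{n}]=[[x_1,\ldots,x_{n-1}],x_{n}]$ for elements of $R$. The $n$-th lower Lie power $R^{[n]}$ is the associative (two-sided) ideal of $R$ generated by all Lie commutators $[x_1,\ldots,x_n]$ with $x_1,\ldots,x_n\in R$, where $R^{[1]}=R$. The algebra $R$ is called Lie nilpotent if $R^{[m]}=0$ for some $m$; the minimal such $m$ is the Lie nilpotency index $t_L(R)$. For a group $G$, $\gamma_i(G)$ is the $i$-th term of the lower central series: $\gamma_1(G)=G$, $\gamma_{i+1}(G)=(\gamma_i(G),G)$, with group commutators $(g,h)=g^{-1}h^{-1}gh$; $G'=\gamma_2(G)$. Known fact: for $KG$ noncommutative with $K$ of characteristic $p>0$, $KG$ is Lie nilpotent if and only if $G$ is nilpotent and $G'$ is a finite $p$-group; in particular $|G'|$ is finite in the statement. *)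

theory Defs
  imports "HOL-Algebra.Elementary_Groups" "HOL-Algebra.Ideal" "HOL-Algebra.Module"
begin

text \<open>The characteristic of a ring is \<open>0\<close> if no positive multiple of \<open>\<one>\<close> vanishes.\<close>

definition ring_char :: "('a, 'm) ring_scheme \<Rightarrow> nat" where
  "ring_char R =
     (if \<exists>n::nat. 0 < n \<and> [n] \<cdot>\<^bsub>R\<^esub> \<one>\<^bsub>R\<^esub> = \<zero>\<^bsub>R\<^esub>
      then LEAST n::nat. 0 < n \<and> [n] \<cdot>\<^bsub>R\<^esub> \<one>\<^bsub>R\<^esub> = \<zero>\<^bsub>R\<^esub>
      else 0)"

text \<open>
  An element \<open>\<Sum>\<^sub>g a(g) g\<close> of the group algebra is represented by its coefficient function, which
  has finite support and is \<open>\<zero>\<close> outside \<open>carrier G\<close>. In a product, the coefficient of \<open>x\<close> is the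
  sum of all \<open>a(y) b(z)\<close> with \<open>y z = x\<close>, that is, \<open>z = y\<^sup>-\<^sup>1 x\<close>; only the finitely many
  \<open>y\<close> in the support of \<open>a\<close> contribute.
\<close>

definition group_algebra ::
    "('k, 'm) ring_scheme \<Rightarrow> ('g, 'n) monoid_scheme \<Rightarrow> ('k, 'g \<Rightarrow> 'k) module" where
  "group_algebra K G =
     \<lparr>carrier = {a. range a \<subseteq> carrier K \<and> {x. a x \<noteq> \<zero>\<^bsub>K\<^esub>} \<subseteq> carrier G \<and> finite {x. a x \<noteq> \<zero>\<^bsub>K\<^esub>}},
      mult = (\<lambda>a b x. if x \<in> carrier G
                then \<Oplus>\<^bsub>K\<^esub>y\<in>{y. a y \<noteq> \<zero>\<^bsub>K\<^esub>}. a y \<otimes>\<^bsub>K\<^esub> b (inv\<^bsub>G\<^esub> y \<otimes>\<^bsub>G\<^esub> x)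
                else \<zero>\<^bsub>K\<^esub>),
      one = (\<lambda>x. if x = \<one>\<^bsub>G\<^esub> then \<one>\<^bsub>K\<^esub> else \<zero>\<^bsub>K\<^esub>),
      zero = (\<lambda>x. \<zero>\<^bsub>K\<^esub>),
      add = (\<lambda>a b x. a x \<oplus>\<^bsub>K\<^esub> b x),
      smult = (\<lambda>c a x. c \<otimes>\<^bsub>K\<^esub> a x)\<rparr>"

definition lie_bracket :: "('a, 'm) ring_scheme \<Rightarrow> 'a \<Rightarrow> 'a \<Rightarrow> 'a" where
  "lie_bracket R x y = x \<otimes>\<^bsub>R\<^esub> y \<ominus>\<^bsub>R\<^esub> y \<otimes>\<^bsub>R\<^esub> x"

text \<open>
  The left-normed commutator \<open>[x\<^sub>1, \<dots>, x\<^sub>n]\<close> is \<open>foldl (lie_bracket R) x\<^sub>1 [x\<^sub>2, \<dots>, x\<^sub>n]\<close>.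
  The indices \<open>n\<close> of interest are the positive ones.
\<close>

definition lower_lie_power :: "('a, 'm) ring_scheme \<Rightarrow> nat \<Rightarrow> 'a set" where
  "lower_lie_power R n =
     Idl\<^bsub>R\<^esub> {foldl (lie_bracket R) x xs | x xs.
             x \<in> carrier R \<and> set xs \<subseteq> carrier R \<and> Suc (length xs) = n}"

definition lie_nilpotent :: "('a, 'm) ring_scheme \<Rightarrow> bool" where
  "lie_nilpotent R \<longleftrightarrow> (\<exists>m\<ge>1. lower_lie_power R m = {\<zero>\<^bsub>R\<^esub>})"

definition lie_nilpotency_index :: "('a, 'm) ring_scheme \<Rightarrow> nat" where
  "lie_nilpotency_index R = (LEAST m. 1 \<le> m \<and> lower_lie_power R m = {\<zero>\<^bsub>R\<^esub>})"

definition group_commutator :: "('g, 'n) monoid_scheme \<Rightarrow> 'g \<Rightarrow> 'g \<Rightarrow> 'g" where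
  "group_commutator G g h = inv\<^bsub>G\<^esub> g \<otimes>\<^bsub>G\<^esub> inv\<^bsub>G\<^esub> h \<otimes>\<^bsub>G\<^esub> g \<otimes>\<^bsub>G\<^esub> h"

text \<open>
  The series starts at index \<open>1\<close>; the value at \<open>0\<close> is a dummy.
\<close>

fun lower_central :: "('g, 'n) monoid_scheme \<Rightarrow> nat \<Rightarrow> 'g set" where
  "lower_central G 0 = carrier G"
| "lower_central G (Suc 0) = carrier G"
| "lower_central G (Suc (Suc i)) =
     generate G {group_commutator G g h | g h. g \<in> lower_central G (Suc i) \<and> h \<in> carrier G}"

text \<open>
  The library's \<open>derived\<close> uses the commutators \<open>g h g\<^sup>-\<^sup>1 h\<^sup>-\<^sup>1\<close>; this makes no difference
  for the subgroup they generate.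
\<close>

lemma (in group) lower_central_2: "lower_central G 2 = derived G (carrier G)"
proof -
  have "{group_commutator G g h | g h. g \<in> carrier G \<and> h \<in> carrier G} = derived_set G (carrier G)"
    (is "?A = ?B")
  proof
    show "?A \<subseteq> ?B"
    proof
      fix c assume "c \<in> ?A"
      then obtain g h where gh: "g \<in> carrier G" "h \<in> carrier G" "c = group_commutator G g h"
        by blast
      then have "c = inv g \<otimes> inv h \<otimes> inv (inv g) \<otimes> inv (inv h)"
        by (simp add: group_commutator_def)
      with gh show "c \<in> ?B" by blast
    qed
    show "?B \<subseteq> ?A"
    proof
      fix c assume "c \<in> ?B"
      then obtain g h where gh: "g \<in> carrier G" "h \<in> carrier G"
          "c = g \<otimes> h \<otimes> inv g \<otimes> inv h"
        by blast
      then have "c = group_commutator G (inv g) (inv h)"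
        by (simp add: group_commutator_def)
      with gh show "c \<in> ?A" by blast
    qed
  qed
  then show ?thesis
    by (simp add: numeral_2_eq_2 derived_def)
qed

end

theory Submission
  imports Defs "HOL-Computational_Algebra.Primes" "HOL-Algebra.Multiplicative_Group"
begin

text \<open>
  Put \<open>R = K G\<close> and \<open>N = G'\<close>, and for a normal subgroup \<open>M\<close> let \<open>aug M\<close> be the ideal of \<open>R\<close> generated by all
  \<open>h - 1\<close> with \<open>h \<in> M\<close>, the kernel of \<open>K G \<rightarrow> K (G / M)\<close>. For finite \<open>N\<close> the index never exceeds \<open>|N| + 1\<close>, so the
  question is when \<open>R\<^sup>[\<^sup>n\<^sup>]\<close> with \<open>n = |N|\<close> vanishes.

  \<^bold>\<open>Structure of the group.\<close> An exchange rule for the products \<open>[a, x] [y, z]\<close> gives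
  \<open>R\<^sup>[\<^sup>n\<^sup>] R\<^sup>[\<^sup>3\<^sup>] \<subseteq> R\<^sup>[\<^sup>n\<^sup>+\<^sup>1\<^sup>]\<close> for \<open>n \<ge> 2\<close> (\<open>T_mult_T3\<close>). The elements \<open>g\<close> with \<open>g - 1 \<in> R\<^sup>[\<^sup>n\<^sup>]\<close> form normal subgroups
  \<open>D\<^sub>n\<close> with \<open>(N, G) \<subseteq> D\<^sub>3\<close>, with \<open>p\<close>-th powers of elements of \<open>N\<close> in \<open>D\<^sub>3\<close>, and with
  \<open>(D\<^sub>n, G, G) \<subseteq> D\<^sub>n\<^sub>+\<^sub>1\<close> for \<open>n \<ge> 3\<close>. As \<open>R\<^sup>[\<^sup>m\<^sup>] = 0\<close> for some \<open>m\<close>, the group \<open>N\<close> is \<open>p\<close>-torsion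
  (\<open>derived_torsion\<close>), and every nontrivial section of \<open>N\<close> that is normal in \<open>G\<close> has an element of order \<open>p\<close> that is
  central in the quotient of \<open>G\<close> (\<open>central_element_exists\<close>). These two facts carry the rest of the
  proof. A cyclic \<open>N\<close> is then finite, and for infinite \<open>N\<close>, where \<open>card N = 0\<close>, the index is not \<open>1\<close> because \<open>R \<noteq> 0\<close>.

  \<^bold>\<open>Upper bound.\<close> Replace \<open>R\<^sup>[\<^sup>j\<^sup>+\<^sup>1\<^sup>]\<close> by the larger upper Lie power \<open>V j\<close>, where \<open>V 0 = R\<close> and \<open>V (j + 1)\<close>
  is the ideal generated by \<open>[V j, R]\<close>; here \<open>V 1 = aug N\<close>. Suppose that \<open>M = \<langle>z\<rangle> M'\<close> with \<open>z\<close> central modulo \<open>M'\<close> and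
  \<open>z\<^sup>p \<in> M'\<close>. Then \<open>z - 1\<close> is central modulo \<open>aug M'\<close> with \<open>p\<close>-th power in \<open>aug M'\<close>, so \<open>V s \<subseteq> aug M\<close> implies
  \<open>V (p s) \<subseteq> aug M'\<close> (\<open>V_power_step\<close>). Descending along a chief series from \<open>N\<close> to the trivial group gives \<open>V |N| = 0\<close>
  (\<open>V_card_N\<close>). If \<open>N\<close> is noncyclic, it has an elementary abelian quotient of rank \<open>2\<close> (\<open>elementary_section\<close>), and the two
  generators together take fewer steps than the product of their orders (\<open>gain\<close>), which makes \<open>R\<^sup>[\<^sup>n\<^sup>]\<close> vanish. If \<open>p = 2\<close>
  and \<open>G\<close> acts nontrivially on this quotient, the gain needs one more chief factor, which exists unless \<open>|N| = 4\<close>; this is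
  how condition (2) arises.

  \<^bold>\<open>Lower bound.\<close> In \<open>[a, b, \<dots>, b]\<close> with \<open>n - 1\<close> entries \<open>b\<close> the coefficient of \<open>a b\<^sup>n\<^sup>-\<^sup>1\<close> is \<open>1\<close> as soon as \<open>a\<close>
  commutes with none of \<open>b\<^sup>i\<close> for \<open>0 < i < n\<close> (\<open>T_nonzero\<close>). For cyclic \<open>N\<close> one finds \<open>a, b\<close> such that \<open>(a, b)\<close>
  generates \<open>N\<close> and \<open>b\<close> acts on \<open>N\<close> by an exponent \<open>j\<close> that is \<open>1\<close> modulo \<open>p\<close>, and modulo \<open>4\<close> if \<open>p = 2\<close>. Then \<open>a\<close> commutes
  with \<open>b\<^sup>i\<close> if and only if \<open>|N|\<close> divides \<open>1 + j + \<dots> + j\<^sup>i\<^sup>-\<^sup>1\<close>, which forces \<open>|N|\<close> to divide \<open>i\<close>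
  (\<open>cyclic_lower_bound\<close>). In the exceptional case, where \<open>n = 4\<close>, two elements \<open>x, y\<close> such that \<open>(y, x)\<close> does not commute
  with \<open>x\<close> serve the same purpose (\<open>klein_lower_bound\<close>).
\<close>

section \<open>Lie commutators in a ring\<close>

context ring
begin

abbreviation bracket :: "'a \<Rightarrow> 'a \<Rightarrow> 'a" ("\<langle>_, _\<rangle>")
  where "\<langle>x, y\<rangle> \<equiv> lie_bracket R x y"

lemma bracket_closed [simp, intro]:
  "x \<in> carrier R \<Longrightarrow> y \<in> carrier R \<Longrightarrow> \<langle>x, y\<rangle> \<in> carrier R"
  by (simp add: lie_bracket_def)

lemma bracket_mult_left:
  assumes "x \<in> carrier R" "y \<in> carrier R" "z \<in> carrier R"
  shows "\<langle>x \<otimes> y, z\<rangle> = x \<otimes> \<langle>y, z\<rangle> \<oplus> \<langle>x, z\<rangle> \<otimes> y"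
  using assms unfolding lie_bracket_def by algebra

lemma bracket_mult_right:
  assumes "x \<in> carrier R" "y \<in> carrier R" "z \<in> carrier R"
  shows "\<langle>x, y \<otimes> z\<rangle> = \<langle>x, y\<rangle> \<otimes> z \<oplus> y \<otimes> \<langle>x, z\<rangle>"
  using assms unfolding lie_bracket_def by algebra

lemma bracket_add_left:
  assumes "x \<in> carrier R" "y \<in> carrier R" "z \<in> carrier R"
  shows "\<langle>x \<oplus> y, z\<rangle> = \<langle>x, z\<rangle> \<oplus> \<langle>y, z\<rangle>"
  using assms unfolding lie_bracket_def by algebra

lemma bracket_add_right:
  assumes "x \<in> carrier R" "y \<in> carrier R" "z \<in> carrier R"
  shows "\<langle>x, y \<oplus> z\<rangle> = \<langle>x, y\<rangle> \<oplus> \<langle>x, z\<rangle>"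
  using assms unfolding lie_bracket_def by algebra

lemma bracket_diff_left:
  assumes "x \<in> carrier R" "y \<in> carrier R" "z \<in> carrier R"
  shows "\<langle>x \<ominus> y, z\<rangle> = \<langle>x, z\<rangle> \<ominus> \<langle>y, z\<rangle>"
  using assms unfolding lie_bracket_def by algebra

lemma bracket_zero [simp]:
  "x \<in> carrier R \<Longrightarrow> \<langle>x, \<zero>\<rangle> = \<zero>" "x \<in> carrier R \<Longrightarrow> \<langle>\<zero>, x\<rangle> = \<zero>"
  "x \<in> carrier R \<Longrightarrow> \<langle>x, x\<rangle> = \<zero>"
  unfolding lie_bracket_def by (simp_all add: minus_eq r_neg)

lemma bracket_one [simp]:
  "x \<in> carrier R \<Longrightarrow> \<langle>x, \<one>\<rangle> = \<zero>" "x \<in> carrier R \<Longrightarrow> \<langle>\<one>, x\<rangle> = \<zero>"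
  unfolding lie_bracket_def by (simp_all add: minus_eq r_neg)

lemma bracket_swap:
  assumes "x \<in> carrier R" "y \<in> carrier R"
  shows "\<langle>y, x\<rangle> = \<ominus> \<langle>x, y\<rangle>"
  using assms unfolding lie_bracket_def by algebra

lemma mult_eq_swap_plus_bracket:
  assumes "x \<in> carrier R" "y \<in> carrier R"
  shows "x \<otimes> y = y \<otimes> x \<oplus> \<langle>x, y\<rangle>"
  using assms unfolding lie_bracket_def by algebra

lemma mult_move:
  assumes "a \<in> carrier R" "r \<in> carrier R" "c \<in> carrier R"
  shows "a \<otimes> (r \<otimes> c) = r \<otimes> (a \<otimes> c) \<oplus> \<langle>a, r\<rangle> \<otimes> c"
  using assms unfolding lie_bracket_def by algebra

lemma bracket_eq_zero_iff:
  assumes "x \<in> carrier R" "y \<in> carrier R"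
  shows "\<langle>x, y\<rangle> = \<zero> \<longleftrightarrow> x \<otimes> y = y \<otimes> x"
proof
  assume "\<langle>x, y\<rangle> = \<zero>"
  then have "x \<otimes> y = y \<otimes> x \<oplus> \<zero>" using mult_eq_swap_plus_bracket[OF assms] by metis
  then show "x \<otimes> y = y \<otimes> x" using assms by simp
qed (use assms in \<open>simp add: lie_bracket_def minus_eq r_neg\<close>)

lemma jacobi:
  assumes "x \<in> carrier R" "y \<in> carrier R" "z \<in> carrier R"
  shows "\<langle>x, \<langle>y, z\<rangle>\<rangle> = \<langle>\<langle>x, y\<rangle>, z\<rangle> \<ominus> \<langle>\<langle>x, z\<rangle>, y\<rangle>"
  using assms unfolding lie_bracket_def by algebra

lemma bracket_minus_one:
  assumes "x \<in> carrier R" "z \<in> carrier R"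
  shows "\<langle>x \<ominus> \<one>, z\<rangle> = \<langle>x, z\<rangle>"
  using bracket_diff_left[OF assms(1) one_closed assms(2)] assms by (simp add: minus_eq)

lemma eq_one_if_minus_one_eq_zero:
  assumes "x \<in> carrier R" "x \<ominus> \<one> = \<zero>" shows "x = \<one>"
proof -
  have "x = (x \<ominus> \<one>) \<oplus> \<one>" using assms(1) by (simp add: minus_eq a_assoc l_neg)
  then show ?thesis using assms(2) by simp
qed

lemma ideal_carr: "ideal I R \<Longrightarrow> x \<in> I \<Longrightarrow> x \<in> carrier R"
  by (rule ideal.Icarr)

lemma ideal_add: "ideal I R \<Longrightarrow> x \<in> I \<Longrightarrow> y \<in> I \<Longrightarrow> x \<oplus> y \<in> I"
  by (simp add: additive_subgroup.a_closed ideal.axioms(1))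

lemma ideal_uminus: "ideal I R \<Longrightarrow> x \<in> I \<Longrightarrow> \<ominus> x \<in> I"
  by (simp add: additive_subgroup.a_inv_closed ideal.axioms(1))

lemma ideal_diff: "ideal I R \<Longrightarrow> x \<in> I \<Longrightarrow> y \<in> I \<Longrightarrow> x \<ominus> y \<in> I"
  by (simp add: minus_eq ideal_add ideal_uminus)

lemma ideal_zero: "ideal I R \<Longrightarrow> \<zero> \<in> I"
  by (simp add: additive_subgroup.zero_closed ideal.axioms(1))

lemma ideal_l: "ideal I R \<Longrightarrow> x \<in> I \<Longrightarrow> r \<in> carrier R \<Longrightarrow> r \<otimes> x \<in> I"
  by (rule ideal.I_l_closed)

lemma ideal_r: "ideal I R \<Longrightarrow> x \<in> I \<Longrightarrow> r \<in> carrier R \<Longrightarrow> x \<otimes> r \<in> I"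
  by (rule ideal.I_r_closed)

lemma ideal_bracket: "ideal I R \<Longrightarrow> x \<in> I \<Longrightarrow> r \<in> carrier R \<Longrightarrow> \<langle>x, r\<rangle> \<in> I"
  by (simp add: lie_bracket_def ideal_diff ideal_l ideal_r)

lemma ideal_bracket': "ideal I R \<Longrightarrow> x \<in> I \<Longrightarrow> r \<in> carrier R \<Longrightarrow> \<langle>r, x\<rangle> \<in> I"
  by (simp add: lie_bracket_def ideal_diff ideal_l ideal_r)

lemmas ideal_closed = ideal_add ideal_uminus ideal_diff ideal_zero ideal_l ideal_r
  ideal_bracket ideal_bracket'

lemma ideal_add_cancel_right:
  assumes "ideal I R" "x \<oplus> y \<in> I" "y \<in> I" "x \<in> carrier R"
  shows "x \<in> I"
proof -
  have "x = (x \<oplus> y) \<ominus> y"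
    using assms ideal_carr by (simp add: minus_eq a_assoc r_neg)
  then show ?thesis using assms ideal_diff by metis
qed

lemma ideal_add_cancel_left:
  assumes "ideal I R" "x \<oplus> y \<in> I" "x \<in> I" "y \<in> carrier R"
  shows "y \<in> I"
  using assms ideal_add_cancel_right[of I y x] ideal_carr by (metis a_comm)

text \<open>Negatives come for free from \<open>- x = (- 1) x\<close>, which leaves only these closure conditions.\<close>

lemma idealI_explicit:
  assumes "I \<subseteq> carrier R" "\<zero> \<in> I" "\<And>x y. x \<in> I \<Longrightarrow> y \<in> I \<Longrightarrow> x \<oplus> y \<in> I"
    and "\<And>x r. x \<in> I \<Longrightarrow> r \<in> carrier R \<Longrightarrow> r \<otimes> x \<in> I"
    and "\<And>x r. x \<in> I \<Longrightarrow> r \<in> carrier R \<Longrightarrow> x \<otimes> r \<in> I"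
  shows "ideal I R"
proof (rule idealI)
  show "subgroup I (add_monoid R)"
  proof
    fix x assume x: "x \<in> I"
    then have "x \<in> carrier R" using assms(1) by auto
    then have "inv\<^bsub>add_monoid R\<^esub> x = (\<ominus> \<one>) \<otimes> x"
      by (simp add: l_minus a_inv_def[symmetric])
    then show "inv\<^bsub>add_monoid R\<^esub> x \<in> I" using assms(4)[OF x] by simp
  qed (use assms in auto)
qed (use assms in \<open>auto simp: ring_axioms\<close>)

end

section \<open>Lower Lie powers\<close>

context ring
begin

definition commutators :: "nat \<Rightarrow> 'a set" where
  "commutators n = {foldl (lie_bracket R) x xs | x xs.
     x \<in> carrier R \<and> set xs \<subseteq> carrier R \<and> Suc (length xs) = n}"

abbreviation T :: "nat \<Rightarrow> 'a set" where
  "T \<equiv> lower_lie_power R"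

lemma T_eq: "T n = Idl (commutators n)"
  by (simp add: lower_lie_power_def commutators_def)

lemma foldl_bracket_closed:
  "x \<in> carrier R \<Longrightarrow> set xs \<subseteq> carrier R \<Longrightarrow> foldl (lie_bracket R) x xs \<in> carrier R"
  by (induction xs arbitrary: x) auto

lemma commutators_carrier: "commutators n \<subseteq> carrier R"
  using foldl_bracket_closed by (auto simp: commutators_def)

lemma T_ideal: "ideal (T n) R"
  unfolding T_eq by (rule genideal_ideal[OF commutators_carrier])

lemma commutators_T: "c \<in> commutators n \<Longrightarrow> c \<in> T n"
  unfolding T_eq using genideal_self[OF commutators_carrier] by auto

lemma T_subsetI: "ideal J R \<Longrightarrow> commutators n \<subseteq> J \<Longrightarrow> T n \<subseteq> J"
  unfolding T_eq by (rule genideal_minimal)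

lemma commutators_1: "commutators (Suc 0) = carrier R"
  by (auto simp: commutators_def)

lemma commutators_SucI:
  assumes "c \<in> commutators n" "r \<in> carrier R"
  shows "\<langle>c, r\<rangle> \<in> commutators (Suc n)"
proof -
  obtain x xs where "c = foldl (lie_bracket R) x xs" "x \<in> carrier R" "set xs \<subseteq> carrier R"
      "Suc (length xs) = n"
    using assms(1) by (auto simp: commutators_def)
  then have "\<langle>c, r\<rangle> = foldl (lie_bracket R) x (xs @ [r]) \<and> x \<in> carrier R
      \<and> set (xs @ [r]) \<subseteq> carrier R \<and> Suc (length (xs @ [r])) = Suc n"
    using assms(2) by auto
  then show ?thesis unfolding commutators_def by blast
qed

lemma commutators_SucE:
  assumes "c \<in> commutators (Suc n)" "n \<ge> 1"
  obtains a r where "a \<in> commutators n" "r \<in> carrier R" "c = \<langle>a, r\<rangle>"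
proof -
  obtain x xs where *: "c = foldl (lie_bracket R) x xs" "x \<in> carrier R" "set xs \<subseteq> carrier R"
      "length xs = n"
    using assms(1) by (auto simp: commutators_def)
  then obtain ys r where xs: "xs = ys @ [r]"
    using assms(2) by (cases xs rule: rev_cases) auto
  show ?thesis
  proof (rule that)
    show "foldl (lie_bracket R) x ys \<in> commutators n"
      unfolding commutators_def using * xs by (intro CollectI exI[of _ x] exI[of _ ys]) auto
  qed (use * xs in auto)
qed

lemma commutators_2I: "x \<in> carrier R \<Longrightarrow> y \<in> carrier R \<Longrightarrow> \<langle>x, y\<rangle> \<in> commutators 2"
  using commutators_SucI[of x 1 y] commutators_1 by (simp add: numeral_2_eq_2)

lemma commutators_3I:
  "x \<in> carrier R \<Longrightarrow> y \<in> carrier R \<Longrightarrow> z \<in> carrier R \<Longrightarrow> \<langle>\<langle>x, y\<rangle>, z\<rangle> \<in> commutators 3"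
  using commutators_SucI[OF commutators_2I, of x y z] by (simp add: numeral_3_eq_3)

lemma commutators_3E:
  assumes "c \<in> commutators 3"
  obtains x y z where "x \<in> carrier R" "y \<in> carrier R" "z \<in> carrier R" "c = \<langle>\<langle>x, y\<rangle>, z\<rangle>"
proof -
  obtain a z where a: "a \<in> commutators 2" "z \<in> carrier R" "c = \<langle>a, z\<rangle>"
    using assms commutators_SucE[of c 2] by (auto simp: numeral_3_eq_3 numeral_2_eq_2)
  obtain x y where "x \<in> commutators 1" "y \<in> carrier R" "a = \<langle>x, y\<rangle>"
    using a(1) commutators_SucE[of a 1] by (auto simp: numeral_2_eq_2)
  with a that commutators_carrier show thesis by blast
qed

lemma T_Suc_subset:
  assumes "n \<ge> 1" shows "T (Suc n) \<subseteq> T n"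
proof (rule T_subsetI[OF T_ideal], rule subsetI)
  fix c assume "c \<in> commutators (Suc n)"
  then obtain a r where "a \<in> commutators n" "r \<in> carrier R" "c = \<langle>a, r\<rangle>"
    using assms commutators_SucE by blast
  then show "c \<in> T n" using commutators_T T_ideal ideal_bracket by blast
qed

lemma T_antimono:
  assumes "1 \<le> m"
  shows "m \<le> n \<Longrightarrow> T n \<subseteq> T m"
proof (induction n)
  case (Suc n)
  then show ?case using assms T_Suc_subset[of n] by (cases "m = Suc n") auto
qed simp

lemma commutators_central:
  "c \<in> commutators n \<Longrightarrow> r \<in> carrier R \<Longrightarrow> \<langle>c, r\<rangle> \<in> T (Suc n)"
  by (simp add: commutators_SucI commutators_T)

text \<open>
  Modulo the power that kills all brackets \<open>[[a, w], z]\<close> the commutator \<open>[a, w]\<close> is central for every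
  \<open>w\<close>. Taking \<open>w = x y\<close> and expanding \<open>[[a, x y], z]\<close> shows that \<open>[a, x] [y, z]\<close> changes sign under the
  exchange of \<open>x\<close> and \<open>y\<close>.
\<close>

lemma commutator_exchange:
  assumes a: "a \<in> commutators m" and x: "x \<in> carrier R" and y: "y \<in> carrier R" and z: "z \<in> carrier R"
  shows "\<langle>a, x\<rangle> \<otimes> \<langle>y, z\<rangle> \<oplus> \<langle>x, z\<rangle> \<otimes> \<langle>a, y\<rangle> \<in> T (Suc (Suc m))"
proof -
  note [simp] = x y z
  have a' [simp]: "a \<in> carrier R" using a commutators_carrier by auto
  have *: "\<langle>\<langle>a, w\<rangle>, z\<rangle> \<in> T (Suc (Suc m))" if "w \<in> carrier R" for w
    using commutators_central[OF commutators_SucI[OF a that] z] .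
  have "\<langle>\<langle>a, x \<otimes> y\<rangle>, z\<rangle> = (\<langle>\<langle>a, x\<rangle>, z\<rangle> \<otimes> y \<oplus> x \<otimes> \<langle>\<langle>a, y\<rangle>, z\<rangle>)
      \<oplus> (\<langle>a, x\<rangle> \<otimes> \<langle>y, z\<rangle> \<oplus> \<langle>x, z\<rangle> \<otimes> \<langle>a, y\<rangle>)"
    by (simp add: bracket_mult_left bracket_mult_right bracket_add_left a_ac)
  moreover have "\<langle>\<langle>a, x\<rangle>, z\<rangle> \<otimes> y \<oplus> x \<otimes> \<langle>\<langle>a, y\<rangle>, z\<rangle> \<in> T (Suc (Suc m))"
    using * by (simp add: ideal_closed[OF T_ideal])
  ultimately have "(\<langle>\<langle>a, x\<rangle>, z\<rangle> \<otimes> y \<oplus> x \<otimes> \<langle>\<langle>a, y\<rangle>, z\<rangle>)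
      \<oplus> (\<langle>a, x\<rangle> \<otimes> \<langle>y, z\<rangle> \<oplus> \<langle>x, z\<rangle> \<otimes> \<langle>a, y\<rangle>) \<in> T (Suc (Suc m))"
      "\<langle>\<langle>a, x\<rangle>, z\<rangle> \<otimes> y \<oplus> x \<otimes> \<langle>\<langle>a, y\<rangle>, z\<rangle> \<in> T (Suc (Suc m))"
    using *[of "x \<otimes> y"] by simp_all
  then show ?thesis by (rule ideal_add_cancel_left[OF T_ideal]) simp
qed

text \<open>
  In the exchange rule replace \<open>y\<close> by a commutator \<open>[y, z]\<close>: the exchanged product contains
  \<open>[a, [y, z]] = [a, y, z] - [a, z, y]\<close>, which already lies in the next power.
\<close>

lemma T_mult_commutators_3:
  assumes u: "u \<in> commutators m" "m \<ge> 2" and c: "c \<in> commutators 3"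
  shows "u \<otimes> c \<in> T (Suc m)"
proof -
  obtain k where k: "m = Suc k" "k \<ge> 1" using u(2) by (cases m) auto
  obtain a x where a: "a \<in> commutators k" "x \<in> carrier R" "u = \<langle>a, x\<rangle>"
    using u k commutators_SucE by blast
  obtain y z w where c: "y \<in> carrier R" "z \<in> carrier R" "w \<in> carrier R" "c = \<langle>\<langle>y, z\<rangle>, w\<rangle>"
    using c by (rule commutators_3E)
  have a' [simp]: "a \<in> carrier R" using a commutators_carrier by auto
  note [simp] = a(2) c(1-3)
  have "\<langle>a, \<langle>y, z\<rangle>\<rangle> \<in> T (Suc m)"
    unfolding jacobi[OF a' c(1,2)] k
    by (intro ideal_diff[OF T_ideal] commutators_central commutators_SucI a c)
  moreover have "\<langle>a, x\<rangle> \<otimes> \<langle>\<langle>y, z\<rangle>, w\<rangle> \<oplus> \<langle>x, w\<rangle> \<otimes> \<langle>a, \<langle>y, z\<rangle>\<rangle> \<in> T (Suc m)"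
    unfolding k by (rule commutator_exchange[OF a(1)]) auto
  ultimately show ?thesis
    unfolding a(3) c(4) by (elim ideal_add_cancel_right[OF T_ideal]) (auto intro: ideal_closed[OF T_ideal])
qed

text \<open>
  The special case \<open>n = 3\<close> of the Gupta-Levin inclusion
  \<open>R\<^sup>[\<^sup>m\<^sup>] R\<^sup>[\<^sup>n\<^sup>] \<subseteq> R\<^sup>[\<^sup>m\<^sup>+\<^sup>n\<^sup>-\<^sup>2\<^sup>]\<close>. It makes \<open>R\<^sup>[\<^sup>3\<^sup>]\<close> nilpotent in a Lie nilpotent ring.
  The passage from generators to ideals uses that generators are central modulo the target.
\<close>

lemma T_mult_T3:
  assumes m: "m \<ge> 2" and t: "t \<in> T m" and s: "s \<in> T 3"
  shows "t \<otimes> s \<in> T (Suc m)"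
proof -
  let ?J = "{t \<in> carrier R. \<forall>c\<in>commutators 3. \<forall>r\<in>carrier R. t \<otimes> (r \<otimes> c) \<in> T (Suc m)}"
  have c3: "c \<in> commutators 3 \<Longrightarrow> c \<in> carrier R" for c using commutators_carrier by auto
  have "ideal ?J R"
  proof (rule idealI_explicit)
    fix x r assume x: "x \<in> ?J" and r: "r \<in> carrier R"
    show "r \<otimes> x \<in> ?J" using x r c3 by (auto simp: m_assoc ideal_closed[OF T_ideal])
    show "x \<otimes> r \<in> ?J"
    proof (intro CollectI conjI ballI)
      fix c s assume c: "c \<in> commutators 3" "s \<in> carrier R"
      then have "x \<otimes> ((r \<otimes> s) \<otimes> c) \<in> T (Suc m)" using x r by blast
      then show "x \<otimes> r \<otimes> (s \<otimes> c) \<in> T (Suc m)" using c c3 x r by (simp add: m_assoc)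
    qed (use x r in auto)
  qed (use c3 in \<open>auto simp: l_distr ideal_closed[OF T_ideal]\<close>)
  moreover have "commutators m \<subseteq> ?J"
  proof (intro subsetI CollectI conjI ballI)
    fix u c r assume u: "u \<in> commutators m" and c: "c \<in> commutators 3" and r: "r \<in> carrier R"
    have [simp]: "u \<in> carrier R" "c \<in> carrier R" "r \<in> carrier R" using u c r commutators_carrier by auto
    have "u \<otimes> (r \<otimes> c) = r \<otimes> (u \<otimes> c) \<oplus> \<langle>u, r\<rangle> \<otimes> c"
      by (rule mult_move) auto
    then show "u \<otimes> (r \<otimes> c) \<in> T (Suc m)"
      using T_mult_commutators_3[OF u m c] commutators_central[OF u r] by (simp add: ideal_closed[OF T_ideal])
  qed (use commutators_carrier in auto)
  ultimately have tJ: "t \<in> ?J" using T_subsetI t by blast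
  let ?L = "{s \<in> carrier R. \<forall>t\<in>T m. t \<otimes> s \<in> T (Suc m)}"
  have Tm: "\<And>x. x \<in> T m \<Longrightarrow> x \<in> carrier R" using ideal_carr[OF T_ideal] .
  have "ideal ?L R"
  proof (rule idealI_explicit)
    fix x r assume x: "x \<in> ?L" and r: "r \<in> carrier R"
    show "x \<otimes> r \<in> ?L" using x r Tm by (auto simp: m_assoc[symmetric] ideal_closed[OF T_ideal])
    show "r \<otimes> x \<in> ?L" using x r Tm by (auto simp: m_assoc[symmetric] ideal_closed[OF T_ideal])
  qed (use Tm in \<open>auto simp: r_distr ideal_closed[OF T_ideal]\<close>)
  moreover have "commutators 3 \<subseteq> ?L"
  proof (intro subsetI CollectI conjI ballI)
    fix c t assume c: "c \<in> commutators 3" and "t \<in> T m"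
    then have t: "t \<in> ?J" using T_subsetI[OF \<open>ideal ?J R\<close> \<open>commutators m \<subseteq> ?J\<close>] by blast
    then have "t \<otimes> (\<one> \<otimes> c) \<in> T (Suc m)" using c by blast
    then show "t \<otimes> c \<in> T (Suc m)" using c c3 by simp
  qed (use c3 in auto)
  ultimately have "s \<in> ?L" using T_subsetI s by blast
  then show ?thesis using t by blast
qed

lemma T3_pow:
  assumes "s \<in> T 3" shows "s [^] (Suc k) \<in> T (k + 3)"
proof (induction k)
  case 0 then show ?case using assms ideal_carr[OF T_ideal] by simp
next
  case (Suc k)
  then show ?case using T_mult_T3[OF _ Suc assms] by (simp add: numeral_3_eq_3)
qed

lemma T3_mult_commutators:
  assumes m: "m \<ge> 2" and u: "u \<in> commutators m" and s: "s \<in> T 3"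
  shows "s \<otimes> u \<in> T (Suc m)"
proof -
  have [simp]: "u \<in> carrier R" "s \<in> carrier R" using commutators_carrier u s ideal_carr[OF T_ideal] by auto
  have "u \<otimes> s \<in> T (Suc m)" using T_mult_T3[OF m commutators_T[OF u] s] .
  moreover have "\<langle>s, u\<rangle> \<in> T (Suc m)"
    using commutators_central[OF u, of s] bracket_swap[of u s] by (simp add: ideal_closed[OF T_ideal])
  ultimately show ?thesis
    using mult_eq_swap_plus_bracket[of s u] by (simp add: ideal_closed[OF T_ideal])
qed

text \<open>
  Commutators of length \<open>n\<close> are central modulo \<open>T (Suc n)\<close>, so modulo that ideal the one-sided multiples
  \<open>r z\<close> already span \<open>T n\<close> additively.
\<close>

lemma T_induct [consumes 1, case_names zero add gen next_power]:
  assumes t: "t \<in> T n"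
    and P0: "P \<zero>"
    and Padd: "\<And>x y. x \<in> T n \<Longrightarrow> y \<in> T n \<Longrightarrow> P x \<Longrightarrow> P y \<Longrightarrow> P (x \<oplus> y)"
    and Pgen: "\<And>r z. r \<in> carrier R \<Longrightarrow> z \<in> commutators n \<Longrightarrow> P (r \<otimes> z)"
    and Psub: "\<And>x. x \<in> T (Suc n) \<Longrightarrow> x \<in> T n \<Longrightarrow> P x"
  shows "P t"
proof -
  \<comment> \<open>the largest ideal inside the additive set given by \<open>P\<close>\<close>
  let ?Q = "{t \<in> T n. \<forall>r\<in>carrier R. \<forall>s\<in>carrier R. P (r \<otimes> t \<otimes> s)}"
  have Tc [simp]: "\<And>x. x \<in> T n \<Longrightarrow> x \<in> carrier R" using ideal_carr[OF T_ideal] .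
  note Tn = ideal_closed[OF T_ideal[of n]]
  have "ideal ?Q R"
  proof (rule idealI_explicit)
    show "\<zero> \<in> ?Q" using P0 Tn by simp
    fix x assume x: "x \<in> ?Q"
    { fix y assume y: "y \<in> ?Q"
      show "x \<oplus> y \<in> ?Q"
        using x y by (auto simp: r_distr l_distr Tn intro!: Padd) }
    fix q assume q: "q \<in> carrier R"
    show "q \<otimes> x \<in> ?Q"
    proof (intro CollectI conjI ballI)
      fix r s assume "r \<in> carrier R" "s \<in> carrier R"
      moreover from this have "P ((r \<otimes> q) \<otimes> x \<otimes> s)" using q x by blast
      ultimately show "P (r \<otimes> (q \<otimes> x) \<otimes> s)" using q x by (simp add: m_assoc)
    qed (use x q Tn in auto)
    show "x \<otimes> q \<in> ?Q"
    proof (intro CollectI conjI ballI)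
      fix r s assume "r \<in> carrier R" "s \<in> carrier R"
      moreover from this have "P (r \<otimes> x \<otimes> (q \<otimes> s))" using q x by blast
      ultimately show "P (r \<otimes> (x \<otimes> q) \<otimes> s)" using q x by (simp add: m_assoc)
    qed (use x q Tn in auto)
  qed (use Tc in auto)
  moreover have "commutators n \<subseteq> ?Q"
  proof (intro subsetI CollectI conjI ballI)
    fix z r s assume z: "z \<in> commutators n" and r: "r \<in> carrier R" and s: "s \<in> carrier R"
    have zc [simp]: "z \<in> carrier R" using commutators_carrier z by auto
    have zT [simp]: "z \<in> T n" using commutators_T[OF z] .
    have "r \<otimes> z \<otimes> s = (r \<otimes> s) \<otimes> z \<oplus> r \<otimes> \<langle>z, s\<rangle>"
      using r s by (simp add: m_assoc mult_eq_swap_plus_bracket[of z s] r_distr)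
    moreover have "P (r \<otimes> \<langle>z, s\<rangle>)"
      using r s zT commutators_central[OF z s] Tn
      by (intro Psub) (simp_all add: ideal_l[OF T_ideal])
    moreover have "P ((r \<otimes> s) \<otimes> z)" using r s by (intro Pgen z) auto
    ultimately show "P (r \<otimes> z \<otimes> s)" using r s Padd by (simp add: Tn)
  qed (use commutators_T in auto)
  ultimately have "t \<in> ?Q" using T_subsetI t by blast
  then have "P (\<one> \<otimes> t \<otimes> \<one>)" by blast
  then show ?thesis using t by simp
qed

text \<open>
  By the exchange rule the products \<open>[x, a] [y, b]\<close> alternate modulo \<open>R\<^sup>[\<^sup>3\<^sup>]\<close>; hence they vanish there when the
  same element \<open>x\<close>, or \<open>x\<close> and its inverse, occurs in both brackets.
\<close>

lemma bracket_mult_bracket_T3: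
  assumes "x \<in> carrier R" "a \<in> carrier R" "b \<in> carrier R" "r \<in> carrier R"
  shows "\<langle>x, a\<rangle> \<otimes> r \<otimes> \<langle>x, b\<rangle> \<in> T 3"
proof -
  note [simp] = assms
  have "\<langle>x, a\<rangle> \<otimes> \<langle>x, b\<rangle> \<in> T 3"
    using commutator_exchange[of x "Suc 0" a x b] by (simp add: commutators_1 numeral_3_eq_3)
  moreover have "\<langle>x, a\<rangle> \<otimes> r \<otimes> \<langle>x, b\<rangle> = r \<otimes> (\<langle>x, a\<rangle> \<otimes> \<langle>x, b\<rangle>) \<oplus> \<langle>\<langle>x, a\<rangle>, r\<rangle> \<otimes> \<langle>x, b\<rangle>"
    by (simp add: m_assoc mult_move[of "\<langle>x, a\<rangle>" r])
  moreover have "\<langle>\<langle>x, a\<rangle>, r\<rangle> \<in> T 3" by (simp add: commutators_3I commutators_T)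
  ultimately show ?thesis by (simp add: ideal_closed[OF T_ideal])
qed

lemma bracket_inverse:
  assumes "x \<in> carrier R" "x' \<in> carrier R" "a \<in> carrier R" "x' \<otimes> x = \<one>" "x \<otimes> x' = \<one>"
  shows "\<langle>x', a\<rangle> = \<ominus> (x' \<otimes> \<langle>x, a\<rangle> \<otimes> x')"
proof -
  note [simp] = assms(1-3)
  have "x' \<otimes> \<langle>x, a\<rangle> \<otimes> x' = (x' \<otimes> x) \<otimes> a \<otimes> x' \<ominus> x' \<otimes> a \<otimes> (x \<otimes> x')"
    using assms(1-3) unfolding lie_bracket_def by algebra
  also have "\<dots> = \<langle>a, x'\<rangle>"
    unfolding assms(4,5) using assms(1-3) by (simp add: lie_bracket_def)
  finally show ?thesis using bracket_swap[OF assms(3,2)] by (simp only:)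
qed

lemma bracket_inverse_mult_bracket_T3:
  assumes "x \<in> carrier R" "x' \<in> carrier R" "a \<in> carrier R" "b \<in> carrier R" "r \<in> carrier R"
    "x' \<otimes> x = \<one>" "x \<otimes> x' = \<one>"
  shows "\<langle>x', a\<rangle> \<otimes> r \<otimes> \<langle>x, b\<rangle> \<in> T 3"
proof -
  note [simp] = assms(1-5)
  have "\<langle>x', a\<rangle> \<otimes> r \<otimes> \<langle>x, b\<rangle> = \<ominus> (x' \<otimes> (\<langle>x, a\<rangle> \<otimes> (x' \<otimes> r) \<otimes> \<langle>x, b\<rangle>))"
    unfolding bracket_inverse[OF assms(1,2,3,6,7)] by (simp add: l_minus m_assoc)
  then show ?thesis using bracket_mult_bracket_T3[OF assms(1,3,4), of "x' \<otimes> r"] assms(2,5)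
    by (simp only: ideal_uminus[OF T_ideal] ideal_l[OF T_ideal] m_closed)
qed

text \<open>
  For units \<open>x, y\<close> the argument of the bracket is the group commutator \<open>(x, y)\<close> minus \<open>1\<close>: group
  commutators of units are central modulo \<open>R\<^sup>[\<^sup>3\<^sup>]\<close>, because each term that could spoil this is a product of
  two brackets with a common entry.
\<close>

lemma unit_commutator_central_T3:
  assumes c: "x \<in> carrier R" "x' \<in> carrier R" "y \<in> carrier R" "y' \<in> carrier R" "z \<in> carrier R"
    and inv: "x' \<otimes> x = \<one>" "x \<otimes> x' = \<one>" "y' \<otimes> y = \<one>" "y \<otimes> y' = \<one>"
  shows "\<langle>x' \<otimes> y' \<otimes> \<langle>x, y\<rangle>, z\<rangle> \<in> T 3"
proof -
  note J = T_ideal[of 3] and [simp] = c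
  have "\<langle>y', z\<rangle> \<otimes> \<one> \<otimes> \<langle>y, x\<rangle> \<in> T 3" by (intro bracket_inverse_mult_bracket_T3 inv) auto
  moreover have "\<langle>y', z\<rangle> \<otimes> \<langle>x, y\<rangle> = \<ominus> (\<langle>y', z\<rangle> \<otimes> \<one> \<otimes> \<langle>y, x\<rangle>)"
    by (simp add: bracket_swap[of y x] r_minus)
  ultimately have 1: "\<langle>y', z\<rangle> \<otimes> \<langle>x, y\<rangle> \<in> T 3" using ideal_uminus[OF J] by simp
  have 2: "\<langle>x', z\<rangle> \<otimes> y' \<otimes> \<langle>x, y\<rangle> \<in> T 3" by (intro bracket_inverse_mult_bracket_T3 inv) auto
  have 3: "\<langle>\<langle>x, y\<rangle>, z\<rangle> \<in> T 3" by (intro commutators_T commutators_3I) auto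
  have "\<langle>x' \<otimes> y' \<otimes> \<langle>x, y\<rangle>, z\<rangle> = x' \<otimes> y' \<otimes> \<langle>\<langle>x, y\<rangle>, z\<rangle> \<oplus>
      (x' \<otimes> (\<langle>y', z\<rangle> \<otimes> \<langle>x, y\<rangle>) \<oplus> \<langle>x', z\<rangle> \<otimes> y' \<otimes> \<langle>x, y\<rangle>)"
    by (simp add: bracket_mult_left l_distr r_distr m_assoc a_assoc)
  then show ?thesis
    using ideal_add[OF J ideal_l[OF J 3, of "x' \<otimes> y'"] ideal_add[OF J ideal_l[OF J 1, of x'] 2]] by simp
qed

text \<open>
  For a unit \<open>x\<close> the element \<open>x' [w, x]\<close> is the difference of the conjugate \<open>x\<^sup>-\<^sup>1 w x\<close> and \<open>w\<close>. For
  \<open>w = r z\<close> with a long commutator \<open>z\<close> only \<open>r\<close> matters, and there two successive differences produce a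
  product of two brackets with the entries \<open>x\<^sup>-\<^sup>1\<close> and \<open>x\<close>.
\<close>

lemma conjugation_difference_T:
  assumes w: "w \<in> T n" and n: "n \<ge> 2"
    and c: "x' \<in> carrier R" "x \<in> carrier R" "y \<in> carrier R" and inv: "x' \<otimes> x = \<one>" "x \<otimes> x' = \<one>"
  shows "\<langle>x' \<otimes> \<langle>w, x\<rangle>, y\<rangle> \<in> T (Suc n)"
proof -
  note J = T_ideal[of "Suc n"]
  from w show ?thesis
  proof (induction w rule: T_induct)
    case zero
    show ?case using c ideal_zero[OF J] by simp
  next
    case (add v w)
    have "v \<in> carrier R" "w \<in> carrier R" using add ideal_carr[OF T_ideal] by auto
    then show ?case using add(3,4) c by (simp add: bracket_add_left r_distr ideal_add[OF J])
  next
    case (next_power w)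
    then show ?case using c by (intro ideal_bracket[OF J] ideal_l[OF J]) auto
  next
    case (gen r z)
    have z: "z \<in> carrier R" using gen commutators_carrier by auto
    note r = \<open>r \<in> carrier R\<close>
    let ?b = "\<langle>r, x\<rangle>"
    have zc: "\<langle>z, s\<rangle> \<in> T (Suc n)" if "s \<in> carrier R" for s
      using commutators_central gen that by blast
    have split: "\<langle>x' \<otimes> \<langle>r \<otimes> z, x\<rangle>, y\<rangle> = \<langle>x' \<otimes> (r \<otimes> \<langle>z, x\<rangle>), y\<rangle>
         \<oplus> (x' \<otimes> ?b \<otimes> \<langle>z, y\<rangle> \<oplus> \<langle>x' \<otimes> ?b, y\<rangle> \<otimes> z)"
    proof -
      have "x' \<otimes> \<langle>r \<otimes> z, x\<rangle> = x' \<otimes> (r \<otimes> \<langle>z, x\<rangle>) \<oplus> (x' \<otimes> ?b) \<otimes> z"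
        using r z c by (simp add: bracket_mult_left[of r z] r_distr m_assoc)
      then show ?thesis
        using r z c by (simp add: bracket_add_left bracket_mult_left[of "x' \<otimes> ?b" z])
    qed
    show ?case unfolding split
    proof (intro ideal_add[OF J])
      show "\<langle>x' \<otimes> (r \<otimes> \<langle>z, x\<rangle>), y\<rangle> \<in> T (Suc n)"
        using c ideal_l[OF J ideal_l[OF J zc[OF c(2)] r] c(1)] by (intro ideal_bracket[OF J]) auto
      show "x' \<otimes> ?b \<otimes> \<langle>z, y\<rangle> \<in> T (Suc n)"
        using r c by (intro ideal_l[OF J zc]) auto
      have "\<langle>x', y\<rangle> \<otimes> \<one> \<otimes> \<langle>x, r\<rangle> \<in> T 3"
        using r c by (intro bracket_inverse_mult_bracket_T3 inv) auto
      moreover have "\<langle>x', y\<rangle> \<otimes> ?b = \<ominus> (\<langle>x', y\<rangle> \<otimes> \<one> \<otimes> \<langle>x, r\<rangle>)"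
        using r c by (simp add: bracket_swap[of r x] r_minus)
      ultimately have 1: "\<langle>x', y\<rangle> \<otimes> ?b \<in> T 3" using ideal_uminus[OF T_ideal] by simp
      have "\<langle>?b, y\<rangle> \<in> T 3" using r c by (intro commutators_T commutators_3I) auto
      then have "x' \<otimes> \<langle>?b, y\<rangle> \<oplus> \<langle>x', y\<rangle> \<otimes> ?b \<in> T 3"
        by (rule ideal_add[OF T_ideal ideal_l[OF T_ideal _ c(1)] 1])
      then have "\<langle>x' \<otimes> ?b, y\<rangle> \<in> T 3"
        using r c by (simp add: bracket_mult_left)
      then show "\<langle>x' \<otimes> ?b, y\<rangle> \<otimes> z \<in> T (Suc n)"
        by (rule T3_mult_commutators[OF n gen(2)])
    qed
  qed
qed

text \<open>
  If \<open>u - 1\<close> lies in \<open>T n\<close>, the double group commutator \<open>((u, x), y)\<close> is one step deeper. The factor \<open>u\<^sup>-\<^sup>1\<close>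
  in front acts trivially because \<open>u\<^sup>-\<^sup>1 - 1\<close> multiplies \<open>T n\<close> into \<open>T (Suc n)\<close>; this needs \<open>n \<ge> 3\<close>.
\<close>

lemma double_commutator_T:
  assumes u: "u \<ominus> \<one> \<in> T n" "u' \<ominus> \<one> \<in> T n" "n \<ge> 3"
    and c: "u \<in> carrier R" "u' \<in> carrier R" "x' \<in> carrier R" "x \<in> carrier R" "y \<in> carrier R"
    and inv: "x' \<otimes> x = \<one>" "x \<otimes> x' = \<one>"
  shows "\<langle>u' \<otimes> x' \<otimes> \<langle>u, x\<rangle>, y\<rangle> \<in> T (Suc n)"
proof -
  note J = T_ideal[of "Suc n"] and Jn = T_ideal[of n]
  let ?X = "x' \<otimes> \<langle>u \<ominus> \<one>, x\<rangle>"
  have XT: "?X \<in> T n" by (intro ideal_l[OF Jn] ideal_bracket[OF Jn] u c)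
  then have X: "?X \<in> carrier R" by (rule ideal_carr[OF Jn])
  have e: "u' = \<one> \<oplus> (u' \<ominus> \<one>)"
  proof -
    have "\<one> \<oplus> (u' \<ominus> \<one>) = (\<one> \<ominus> \<one>) \<oplus> u'" using c by (simp add: minus_eq a_ac)
    then show ?thesis using c by (simp add: minus_eq r_neg)
  qed
  have "u' \<otimes> x' \<otimes> \<langle>u, x\<rangle> = u' \<otimes> ?X" using c by (simp add: bracket_minus_one m_assoc)
  also have "\<dots> = (\<one> \<oplus> (u' \<ominus> \<one>)) \<otimes> ?X" using e by simp
  also have "\<dots> = ?X \<oplus> (u' \<ominus> \<one>) \<otimes> ?X"
    using X c by (simp only: l_distr one_closed l_one minus_closed)
  finally have e: "u' \<otimes> x' \<otimes> \<langle>u, x\<rangle> = ?X \<oplus> (u' \<ominus> \<one>) \<otimes> ?X" .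
  have "?X \<in> T 3" using XT T_antimono[of 3 n] u(3) by auto
  then have Y: "(u' \<ominus> \<one>) \<otimes> ?X \<in> T (Suc n)"
    using u(3) by (intro T_mult_T3 u) auto
  have "\<langle>u' \<otimes> x' \<otimes> \<langle>u, x\<rangle>, y\<rangle> = \<langle>?X, y\<rangle> \<oplus> \<langle>(u' \<ominus> \<one>) \<otimes> ?X, y\<rangle>"
    unfolding e using X c ideal_carr[OF J Y] by (intro bracket_add_left) auto
  then show ?thesis
    using u(3) ideal_add[OF J conjugation_difference_T[OF u(1) _ c(3,4,5) inv] ideal_bracket[OF J Y c(5)]] by simp
qed

end

section \<open>Upper Lie powers\<close>

context ring
begin

text \<open>
  The index is shifted against the usual one, \<open>upper_lie_power j\<close> being \<open>R\<^sup>(\<^sup>j\<^sup>+\<^sup>1\<^sup>)\<close>: it counts brackets.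
\<close>

primrec upper_lie_power :: "nat \<Rightarrow> 'a set" where
  "upper_lie_power 0 = carrier R"
| "upper_lie_power (Suc j) = Idl {\<langle>v, r\<rangle> | v r. v \<in> upper_lie_power j \<and> r \<in> carrier R}"

declare upper_lie_power.simps(2) [simp del]

abbreviation V :: "nat \<Rightarrow> 'a set" where
  "V \<equiv> upper_lie_power"

lemma V_ideal: "ideal (V j) R"
proof (induction j)
  case 0
  then show ?case by (simp add: oneideal)
next
  case (Suc j)
  then show ?case unfolding upper_lie_power.simps(2) by (intro genideal_ideal) (auto dest: ideal_carr)
qed

lemma V_carr: "v \<in> V j \<Longrightarrow> v \<in> carrier R"
  using ideal_carr[OF V_ideal] .

lemma V_bracket:
  assumes "v \<in> V j" "r \<in> carrier R" shows "\<langle>v, r\<rangle> \<in> V (Suc j)"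
proof -
  have "{\<langle>v, r\<rangle> | v r. v \<in> V j \<and> r \<in> carrier R} \<subseteq> carrier R" by (auto dest: V_carr)
  from genideal_self[OF this] show ?thesis using assms unfolding upper_lie_power.simps(2) by auto
qed

lemma V_Suc_subsetI:
  assumes "ideal J R" "\<And>v r. v \<in> V j \<Longrightarrow> r \<in> carrier R \<Longrightarrow> \<langle>v, r\<rangle> \<in> J"
  shows "V (Suc j) \<subseteq> J"
  unfolding upper_lie_power.simps(2) by (rule genideal_minimal[OF assms(1)]) (use assms(2) in auto)

lemma V_Suc_subset: "V (Suc j) \<subseteq> V j"
  by (rule V_Suc_subsetI[OF V_ideal]) (rule ideal_bracket[OF V_ideal])

lemma V_antimono: "i \<le> j \<Longrightarrow> V j \<subseteq> V i"
proof (induction j)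
  case (Suc j)
  then show ?case using V_Suc_subset[of j] by (cases "i = Suc j") auto
qed simp

lemma T_subset_V: "T (Suc j) \<subseteq> V j"
proof (rule T_subsetI[OF V_ideal])
  show "commutators (Suc j) \<subseteq> V j"
  proof (induction j)
    case 0
    then show ?case by (simp add: commutators_1)
  next
    case (Suc j)
    show ?case
    proof
      fix c assume "c \<in> commutators (Suc (Suc j))"
      then obtain a r where "a \<in> commutators (Suc j)" "r \<in> carrier R" "c = \<langle>a, r\<rangle>"
        by (rule commutators_SucE) auto
      with Suc V_bracket show "c \<in> V (Suc j)" by blast
    qed
  qed
qed

definition central_mod :: "'a \<Rightarrow> 'a set \<Rightarrow> bool" where
  "central_mod u D \<longleftrightarrow> u \<in> carrier R \<and> (\<forall>r\<in>carrier R. \<langle>u, r\<rangle> \<in> D)"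

lemma central_modD: "central_mod u D \<Longrightarrow> r \<in> carrier R \<Longrightarrow> \<langle>u, r\<rangle> \<in> D"
  and central_mod_carrier: "central_mod u D \<Longrightarrow> u \<in> carrier R"
  and central_mod_mono: "central_mod u D \<Longrightarrow> D \<subseteq> D' \<Longrightarrow> central_mod u D'"
  by (auto simp: central_mod_def)

lemma central_modI:
  "u \<in> carrier R \<Longrightarrow> (\<And>r. r \<in> carrier R \<Longrightarrow> \<langle>u, r\<rangle> \<in> D) \<Longrightarrow> central_mod u D"
  by (auto simp: central_mod_def)

text \<open>
  The set \<open>u J + D\<close>. Statements of the form \<open>V n \<subseteq> lin u (V j) D\<close> say that, modulo \<open>D\<close>, the deep power
  \<open>V n\<close> is already divisible by \<open>u\<close> with a quotient in \<open>V j\<close>.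
\<close>

definition lin :: "'a \<Rightarrow> 'a set \<Rightarrow> 'a set \<Rightarrow> 'a set" where
  "lin u J D = {u \<otimes> v \<oplus> d | v d. v \<in> J \<and> d \<in> D}"

lemma linI: "v \<in> J \<Longrightarrow> d \<in> D \<Longrightarrow> x = u \<otimes> v \<oplus> d \<Longrightarrow> x \<in> lin u J D"
  by (auto simp: lin_def)

lemma lin_ideal:
  assumes u: "u \<in> carrier R" and J: "ideal J R" and D: "ideal D R"
    and c: "central_mod u D"
  shows "ideal (lin u J D) R"
proof (rule idealI_explicit)
  note Jc [simp] = ideal_carr[OF J] and Dc [simp] = ideal_carr[OF D]
  show "lin u J D \<subseteq> carrier R" using u by (auto simp: lin_def)
  have "\<zero> = u \<otimes> \<zero> \<oplus> \<zero>" using u by simp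
  then show "\<zero> \<in> lin u J D" by (rule linI[OF ideal_zero[OF J] ideal_zero[OF D]])
  fix x assume "x \<in> lin u J D"
  then obtain v d where x: "v \<in> J" "d \<in> D" "x = u \<otimes> v \<oplus> d" by (auto simp: lin_def)
  { fix y assume "y \<in> lin u J D"
    then obtain v' d' where y: "v' \<in> J" "d' \<in> D" "y = u \<otimes> v' \<oplus> d'" by (auto simp: lin_def)
    then have "x \<oplus> y = u \<otimes> (v \<oplus> v') \<oplus> (d \<oplus> d')"
      using u x by (simp add: r_distr a_ac)
    then show "x \<oplus> y \<in> lin u J D"
      by (rule linI[OF ideal_add[OF J x(1) y(1)] ideal_add[OF D x(2) y(2)]]) }
  fix r assume r: "r \<in> carrier R"
  have "x \<otimes> r = u \<otimes> (v \<otimes> r) \<oplus> d \<otimes> r"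
    using u x r by (simp add: l_distr m_assoc)
  then show "x \<otimes> r \<in> lin u J D"
    by (rule linI[OF ideal_r[OF J x(1) r] ideal_r[OF D x(2) r]])
  have "r \<otimes> (u \<otimes> v) = u \<otimes> (r \<otimes> v) \<oplus> \<langle>r, u\<rangle> \<otimes> v"
    using u x r by (intro mult_move) auto
  then have "r \<otimes> x = u \<otimes> (r \<otimes> v) \<oplus> (\<langle>r, u\<rangle> \<otimes> v \<oplus> r \<otimes> d)"
    using u x r by (simp add: r_distr a_ac)
  moreover have "\<langle>r, u\<rangle> \<in> D" unfolding bracket_swap[OF u r] using central_modD[OF c r] by (rule ideal_uminus[OF D])
  then have "\<langle>r, u\<rangle> \<otimes> v \<oplus> r \<otimes> d \<in> D"
    by (rule ideal_add[OF D ideal_r[OF D] ideal_l[OF D x(2) r]]) (rule Jc[OF x(1)])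
  ultimately show "r \<otimes> x \<in> lin u J D"
    by (intro linI[OF ideal_l[OF J x(1) r]])
qed

lemma lin_mult:
  assumes "u \<in> carrier R" "v \<in> J" "ideal J R" "ideal D R" shows "u \<otimes> v \<in> lin u J D"
proof -
  have "u \<otimes> v = u \<otimes> v \<oplus> \<zero>" using assms ideal_carr by simp
  then show ?thesis using assms ideal_zero by (intro linI)
qed

lemma lin_add:
  assumes "u \<in> carrier R" "d \<in> D" "ideal J R" "ideal D R" shows "d \<in> lin u J D"
proof -
  have "d = u \<otimes> \<zero> \<oplus> d" using assms ideal_carr by simp
  then show ?thesis using assms ideal_zero by (intro linI)
qed

lemma lin_mono: "J \<subseteq> J' \<Longrightarrow> D \<subseteq> D' \<Longrightarrow> lin u J D \<subseteq> lin u J' D'"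
  unfolding lin_def by blast

lemma lin_subsetI:
  assumes "ideal E R" "\<And>v. v \<in> J \<Longrightarrow> u \<otimes> v \<in> E" "D \<subseteq> E"
  shows "lin u J D \<subseteq> E"
  using assms by (auto simp: lin_def intro!: ideal_add)

text \<open>The Leibniz rule for a bracket \<open>[u v + d, r]\<close>.\<close>

lemma V_step:
  assumes V: "V n \<subseteq> lin u (V j) D" and u: "u \<in> carrier R" and D: "ideal D R" and E: "ideal E R"
    and 1: "\<And>v. v \<in> V (Suc j) \<Longrightarrow> u \<otimes> v \<in> E"
    and 2: "central_mod u E"
    and 3: "\<And>d r. d \<in> D \<Longrightarrow> r \<in> carrier R \<Longrightarrow> \<langle>d, r\<rangle> \<in> E"
  shows "V (Suc n) \<subseteq> E"
proof (rule V_Suc_subsetI[OF E])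
  fix x r assume "x \<in> V n" and r: "r \<in> carrier R"
  then obtain v d where x: "v \<in> V j" "d \<in> D" "x = u \<otimes> v \<oplus> d" using V by (auto simp: lin_def)
  have c: "v \<in> carrier R" "d \<in> carrier R" using x V_carr ideal_carr[OF D] by auto
  have "\<langle>x, r\<rangle> = (u \<otimes> \<langle>v, r\<rangle> \<oplus> \<langle>u, r\<rangle> \<otimes> v) \<oplus> \<langle>d, r\<rangle>"
    unfolding x(3) using c u r by (simp add: bracket_add_left bracket_mult_left)
  then show "\<langle>x, r\<rangle> \<in> E"
    using 1[OF V_bracket[OF x(1) r]] central_modD[OF 2 r] 3[OF x(2) r] c
    by (simp only: ideal_add[OF E] ideal_r[OF E])
qed

lemma central_pow:
  assumes u: "u \<in> carrier R" and I: "ideal I R" and c: "central_mod u I"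
  shows "central_mod (u [^] (k::nat)) I"
proof (rule central_modI)
  fix r assume r: "r \<in> carrier R"
  show "\<langle>u [^] k, r\<rangle> \<in> I"
  proof (induction k)
    case 0 then show ?case using r ideal_zero[OF I] by simp
  next
    case (Suc k)
    have "\<langle>u [^] Suc k, r\<rangle> = u [^] k \<otimes> \<langle>u, r\<rangle> \<oplus> \<langle>u [^] k, r\<rangle> \<otimes> u"
      using u r by (simp add: bracket_mult_left)
    then show ?case using Suc central_modD[OF c r] u
      by (simp only: ideal_add[OF I] ideal_r[OF I] ideal_l[OF I] nat_pow_closed)
  qed
qed (use u in simp)

lemma V_lin_shift:
  assumes u: "u \<in> carrier R" and I: "ideal I R" and c: "central_mod u I"
    and V: "V n \<subseteq> lin u (V j) I"
  shows "V (n + k) \<subseteq> lin u (V (j + k)) I"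
proof (induction k)
  case 0 then show ?case using V by simp
next
  case (Suc k)
  have "V (Suc (n + k)) \<subseteq> lin u (V (Suc (j + k))) I"
    by (rule V_step[OF Suc u I lin_ideal[OF u V_ideal I c] _ central_mod_mono[OF c]])
      (use lin_mult[OF u _ V_ideal I] lin_add[OF u _ V_ideal I] ideal_bracket[OF I] in \<open>auto intro: subsetI\<close>)
  then show ?case by simp
qed

text \<open>
  Each further \<open>s - e\<close> steps bring \<open>u\<^sup>k V e\<close> to \<open>u\<^sup>k V s\<close> and thereby produce one more factor \<open>u\<close>, until
  \<open>u\<^sup>p\<close> vanishes. For \<open>e = 0\<close> the index is \<open>p s\<close>; starting from \<open>e = 1\<close> saves \<open>p - 1\<close>.
\<close>

lemma V_power_step:
  assumes u: "u \<in> carrier R" and I: "ideal I R" and c: "central_mod u I"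
    and V: "V s \<subseteq> lin u (V e) I" and up: "u [^] (p::nat) \<in> I" and p: "p \<ge> 1" and e: "e \<le> s"
  shows "V (s + (p - 1) * (s - e)) \<subseteq> I"
proof -
  have *: "V (s + k * (s - e)) \<subseteq> lin (u [^] Suc k) (V e) I" for k
  proof (induction k)
    case 0 then show ?case using V u by simp
  next
    case (Suc k)
    let ?w = "u [^] Suc k"
    have w: "?w \<in> carrier R" using u by simp
    have wc: "central_mod ?w I" using central_pow[OF u I c] .
    have w'c: "central_mod (u [^] Suc (Suc k)) I" using central_pow[OF u I c] .
    have w': "u [^] Suc (Suc k) \<in> carrier R" using u by simp
    have L: "ideal (lin (u [^] Suc (Suc k)) (V e) I) R" by (rule lin_ideal[OF w' V_ideal I w'c])
    have "V (s + k * (s - e) + (s - e)) \<subseteq> lin ?w (V (e + (s - e))) I"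
      by (rule V_lin_shift[OF w I wc Suc])
    also have "\<dots> \<subseteq> lin (u [^] Suc (Suc k)) (V e) I"
    proof (rule lin_subsetI[OF L])
      fix v assume "v \<in> V (e + (s - e))"
      then have "v \<in> lin u (V e) I" using V e by auto
      then obtain v' d where v: "v' \<in> V e" "d \<in> I" "v = u \<otimes> v' \<oplus> d" by (auto simp: lin_def)
      have "?w \<otimes> v = (u [^] Suc (Suc k)) \<otimes> v' \<oplus> ?w \<otimes> d"
        using v u V_carr ideal_carr[OF I] by (simp add: r_distr m_assoc)
      then show "?w \<otimes> v \<in> lin (u [^] Suc (Suc k)) (V e) I"
        by (rule linI[OF v(1) ideal_l[OF I v(2) w]])
    qed (use lin_add[OF w' _ V_ideal I] in auto)
    finally show ?case by (simp add: add_ac)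
  qed
  have "lin (u [^] Suc (p - 1)) (V e) I \<subseteq> I"
    by (rule lin_subsetI[OF I]) (use p up ideal_r[OF I] V_carr in auto)
  with *[of "p - 1"] show ?thesis by blast
qed

lemma mult_lin_subset:
  assumes u: "u \<in> carrier R" and I: "ideal I R" and c: "central_mod u I"
    and v: "v \<in> J" and J: "ideal J R" and z: "z \<in> lin u (carrier R) I"
  shows "v \<otimes> z \<in> lin u J I" "z \<otimes> v \<in> lin u J I"
proof -
  have v': "v \<in> carrier R" using ideal_carr[OF J v] .
  note E = lin_ideal[OF u J I c]
  obtain r i where z: "r \<in> carrier R" "i \<in> I" "z = u \<otimes> r \<oplus> i" using z by (auto simp: lin_def)
  have i: "i \<in> carrier R" using ideal_carr[OF I z(2)] .
  have "z \<otimes> v = u \<otimes> (r \<otimes> v) \<oplus> i \<otimes> v" using z i v' u by (simp add: l_distr m_assoc)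
  then show "z \<otimes> v \<in> lin u J I" by (rule linI[OF ideal_l[OF J v z(1)] ideal_r[OF I z(2) v']])
  have "v \<otimes> (u \<otimes> r) = u \<otimes> (v \<otimes> r) \<oplus> \<langle>v, u\<rangle> \<otimes> r" using z u v' by (intro mult_move) auto
  then have "v \<otimes> z = u \<otimes> (v \<otimes> r) \<oplus> (\<langle>v, u\<rangle> \<otimes> r \<oplus> v \<otimes> i)"
    using z i v' u by (simp add: r_distr a_ac)
  moreover have "\<langle>v, u\<rangle> \<in> I" unfolding bracket_swap[OF u v'] using central_modD[OF c v'] by (rule ideal_uminus[OF I])
  then have "\<langle>v, u\<rangle> \<otimes> r \<oplus> v \<otimes> i \<in> I"
    by (intro ideal_add[OF I] ideal_r[OF I] ideal_l[OF I] z v')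
  ultimately show "v \<otimes> z \<in> lin u J I"
    by (intro linI[OF ideal_r[OF J v z(1)]])
qed

lemma lin_bracket:
  assumes u: "u \<in> carrier R" and I: "ideal I R" and c: "central_mod u I"
    and z: "z \<in> lin u (carrier R) I" and h: "h \<in> carrier R"
  shows "\<langle>z, h\<rangle> \<in> lin u (V 1) I"
proof -
  obtain r i where z: "r \<in> carrier R" "i \<in> I" "z = u \<otimes> r \<oplus> i" using z by (auto simp: lin_def)
  have i: "i \<in> carrier R" using ideal_carr[OF I z(2)] .
  have "\<langle>r, h\<rangle> \<in> V 1" using V_bracket[of r 0 h] z h by simp
  moreover have "\<langle>z, h\<rangle> = u \<otimes> \<langle>r, h\<rangle> \<oplus> (\<langle>u, h\<rangle> \<otimes> r \<oplus> \<langle>i, h\<rangle>)"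
    using z i h u by (simp add: bracket_add_left bracket_mult_left a_ac)
  moreover have "\<langle>u, h\<rangle> \<otimes> r \<oplus> \<langle>i, h\<rangle> \<in> I"
    by (intro ideal_add[OF I] ideal_r[OF I] ideal_bracket[OF I] central_modD[OF c] z h)
  ultimately show ?thesis by (intro linI)
qed

end

section \<open>Gains of one step\<close>

context ring
begin

text \<open>
  In the model case \<open>I = 0\<close> and \<open>V 1\<close> is generated by \<open>x\<close> and the central element \<open>y\<close>, where \<open>x\<close> has weight
  \<open>1\<close>, \<open>y\<close> has weight \<open>2\<close> and \<open>x\<^sup>p = 0\<close>. A monomial of weight \<open>p \<ge> 3\<close> other than \<open>x\<^sup>p\<close> contains \<open>y\<close> and
  one more factor. So \<open>V p\<close> lies in \<open>y V 1\<close> and not merely in \<open>y R\<close>.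
\<close>

lemma V_gain_two_generators:
  assumes I: "ideal I R" and y: "y \<in> carrier R" and x1: "x \<in> V 1"
    and cy: "central_mod y I"
    and cx: "central_mod x (lin y (carrier R) I)"
    and V1: "V 1 \<subseteq> lin x (carrier R) (lin y (carrier R) I)"
    and xp: "x [^] (p::nat) \<in> I" and p: "p \<ge> 3"
  shows "V p \<subseteq> lin y (V 1) I"
proof -
  let ?B = "lin y (carrier R) I" and ?C = "lin y (V 1) I"
  have x: "x \<in> carrier R" using V_carr x1 .
  have B: "ideal ?B R" by (rule lin_ideal[OF y oneideal I cy])
  have C: "ideal ?C R" by (rule lin_ideal[OF y V_ideal I cy])
  have CB: "?C \<subseteq> ?B" by (rule lin_mono) (auto dest: V_carr)
  note xB = mult_lin_subset(1)[OF y I cy x1 V_ideal] and Bx = mult_lin_subset(2)[OF y I cy x1 V_ideal]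
  have xnB: "x [^] n \<otimes> b \<in> ?C" if "b \<in> ?B" "n \<ge> 1" for b and n :: nat
    using that(2)
  proof (induction n rule: dec_induct)
    case base then show ?case using xB that x by simp
  next
    case (step n)
    have "x [^] Suc n \<otimes> b = x [^] n \<otimes> (x \<otimes> b)" using x ideal_carr[OF B that(1)] by (simp add: m_assoc)
    also have "\<dots> \<in> ?C" by (rule ideal_l[OF C xB[OF that(1)]]) (use x in simp)
    finally show ?case .
  qed
  have xnc': "\<langle>x [^] n, r\<rangle> \<in> ?C" if "n \<ge> 2" "r \<in> carrier R" for n :: nat and r
    using \<open>n \<ge> 2\<close>
  proof (induction n rule: dec_induct)
    case base
    have "\<langle>x [^] (2::nat), r\<rangle> = x \<otimes> \<langle>x, r\<rangle> \<oplus> \<langle>x, r\<rangle> \<otimes> x"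
      using x \<open>r \<in> carrier R\<close> by (simp add: numeral_2_eq_2 bracket_mult_left)
    then show ?case using xB[OF central_modD[OF cx]] Bx[OF central_modD[OF cx]] \<open>r \<in> carrier R\<close> by (simp only: ideal_add[OF C])
  next
    case (step n)
    have "\<langle>x [^] Suc n, r\<rangle> = x [^] n \<otimes> \<langle>x, r\<rangle> \<oplus> \<langle>x [^] n, r\<rangle> \<otimes> x"
      using x \<open>r \<in> carrier R\<close> by (simp add: bracket_mult_left)
    moreover have "x [^] n \<otimes> \<langle>x, r\<rangle> \<in> ?C" using step xnB[OF central_modD[OF cx]] \<open>r \<in> carrier R\<close> by simp
    ultimately show ?case using step ideal_r[OF C] x by (simp only: ideal_add[OF C])
  qed
  have xnc: "central_mod (x [^] n) ?C" if "n \<ge> 2" for n :: nat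
    using xnc'[OF that] x by (intro central_modI) auto
  have xnV: "x [^] n \<otimes> v \<in> lin (x [^] Suc n) (carrier R) ?C" if "n \<ge> 1" "v \<in> V 1" for n :: nat and v
  proof -
    obtain r b where v: "r \<in> carrier R" "b \<in> ?B" "v = x \<otimes> r \<oplus> b"
      using V1 \<open>v \<in> V 1\<close> by (auto simp: lin_def[of x])
    have "x [^] n \<otimes> v = x [^] Suc n \<otimes> r \<oplus> x [^] n \<otimes> b"
      using v x ideal_carr[OF B] by (simp add: r_distr m_assoc)
    then show ?thesis by (rule linI[OF v(1) xnB[OF v(2) that(1)]])
  qed
  have D: "ideal (lin (x [^] n) (carrier R) ?C) R" if "n \<ge> 2" for n :: nat
    by (rule lin_ideal[OF _ oneideal C xnc[OF that]]) (use x in simp)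
  have D2: "ideal (lin (x [^] (2::nat)) (carrier R) ?B) R"
    by (rule lin_ideal[OF _ oneideal B]) (use x central_mod_mono[OF xnc CB] in auto)
  have CD: "?C \<subseteq> lin (x [^] n) (carrier R) ?C" for n :: nat
    using lin_add[OF _ _ oneideal C] x by auto
  have V2: "V 2 \<subseteq> lin (x [^] (2::nat)) (carrier R) ?B"
  proof -
    have "V (Suc 1) \<subseteq> lin (x [^] (2::nat)) (carrier R) ?B"
    proof (rule V_step[where n = 1 and j = 0 and u = x and D = ?B])
      fix v assume "v \<in> V (Suc 0)"
      then have "x [^] (1::nat) \<otimes> v \<in> lin (x [^] Suc 1) (carrier R) ?C" by (intro xnV) auto
      then show "x \<otimes> v \<in> lin (x [^] (2::nat)) (carrier R) ?B"
        using lin_mono[OF order_refl CB] x by (auto simp: numeral_2_eq_2)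
    next
      have BD2: "?B \<subseteq> lin (x [^] (2::nat)) (carrier R) ?B"
        using lin_add[OF _ _ oneideal B] x by auto
      show "central_mod x (lin (x [^] (2::nat)) (carrier R) ?B)"
        by (rule central_mod_mono[OF cx BD2])
      show "\<langle>d, r\<rangle> \<in> lin (x [^] (2::nat)) (carrier R) ?B" if "d \<in> ?B" "r \<in> carrier R" for d r
        using ideal_bracket[OF B that] BD2 by blast
    qed (use V1 x D2 B in auto)
    then show ?thesis by (simp add: numeral_2_eq_2)
  qed
  have V3: "V 3 \<subseteq> lin (x [^] (3::nat)) (carrier R) ?C"
  proof -
    have "V (Suc 2) \<subseteq> lin (x [^] Suc 2) (carrier R) ?C"
    proof (rule V_step[where j = 0 and u = "x [^] (2::nat)" and D = ?B])
      fix d r assume "d \<in> ?B" "r \<in> carrier R"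
      then show "\<langle>d, r\<rangle> \<in> lin (x [^] Suc 2) (carrier R) ?C"
        using lin_bracket[OF y I cy] CD by blast
    next
      show "x [^] (2::nat) \<otimes> v \<in> lin (x [^] Suc 2) (carrier R) ?C" if "v \<in> V (Suc 0)" for v
        by (rule xnV) (use that in auto)
    qed (use V2 x B D central_mod_mono[OF xnc CD] in \<open>auto simp del: nat_pow_Suc\<close>)
    then show ?thesis by (simp add: numeral_3_eq_3)
  qed
  have "V n \<subseteq> lin (x [^] n) (carrier R) ?C" if "n \<ge> 3" for n :: nat
    using that
  proof (induction n rule: dec_induct)
    case base then show ?case by (rule V3)
  next
    case (step n)
    show ?case
    proof (rule V_step[where j = 0 and u = "x [^] n" and D = ?C])
      fix d r assume "d \<in> ?C" "r \<in> carrier R"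
      then show "\<langle>d, r\<rangle> \<in> lin (x [^] Suc n) (carrier R) ?C"
        using ideal_bracket[OF C] CD by blast
    next
      show "x [^] n \<otimes> v \<in> lin (x [^] Suc n) (carrier R) ?C" if "v \<in> V (Suc 0)" for v
        by (rule xnV) (use that step in auto)
      show "ideal (lin (x [^] Suc n) (carrier R) ?C) R" using D[of "Suc n"] step by simp
      show "central_mod (x [^] n) (lin (x [^] Suc n) (carrier R) ?C)"
        by (rule central_mod_mono[OF xnc CD]) (use step in simp)
    qed (use step x C in auto)
  qed
  from this[OF p] have "V p \<subseteq> lin (x [^] p) (carrier R) ?C" .
  also have "\<dots> \<subseteq> ?C"
    by (rule lin_subsetI[OF C]) (use lin_add[OF y _ V_ideal I] ideal_r[OF I xp] in auto)
  finally show ?thesis .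
qed

text \<open>For \<open>p = 2\<close> the same gain requires that \<open>x\<close> is central as well, so that \<open>x\<close> and \<open>y\<close> have equal weight.\<close>

lemma V_gain_two_central:
  assumes I: "ideal I R" and y: "y \<in> carrier R" and x1: "x \<in> V 1"
    and cy: "central_mod y I"
    and cx: "central_mod x I"
    and V1: "V 1 \<subseteq> lin x (carrier R) (lin y (carrier R) I)"
    and xp: "x [^] (2::nat) \<in> I"
  shows "V 2 \<subseteq> lin y (V 1) I"
proof -
  let ?B = "lin y (carrier R) I" and ?C = "lin y (V 1) I"
  have x: "x \<in> carrier R" using V_carr x1 .
  have B: "ideal ?B R" by (rule lin_ideal[OF y oneideal I cy])
  have C: "ideal ?C R" by (rule lin_ideal[OF y V_ideal I cy])
  have IC: "I \<subseteq> ?C" using lin_add[OF y _ V_ideal I] by auto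
  have "V (Suc 1) \<subseteq> ?C"
  proof (rule V_step[where n = 1 and j = 0 and u = x and D = ?B])
    fix v assume "v \<in> V (Suc 0)"
    then obtain r b where v: "r \<in> carrier R" "b \<in> ?B" "v = x \<otimes> r \<oplus> b"
      using V1 by (auto simp: lin_def[of x])
    have "x \<otimes> v = x [^] (2::nat) \<otimes> r \<oplus> x \<otimes> b"
      using v x ideal_carr[OF B] by (simp add: r_distr m_assoc numeral_2_eq_2)
    moreover have "x [^] (2::nat) \<otimes> r \<in> ?C" using ideal_r[OF I xp v(1)] IC by blast
    ultimately show "x \<otimes> v \<in> ?C"
      using mult_lin_subset(1)[OF y I cy x1 V_ideal v(2)] by (simp only: ideal_add[OF C])
  qed (use V1 x B C central_mod_mono[OF cx IC] lin_bracket[OF y I cy] in auto)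
  then show ?thesis by (simp add: numeral_2_eq_2)
qed

text \<open>
  The remaining case in characteristic \<open>2\<close>, with generators \<open>x, y, w\<close> of weights \<open>1, 2, 3\<close>. Modulo \<open>I\<close>
  one has \<open>y\<^sup>2 = 0\<close>, and \<open>x\<^sup>2\<close> is a multiple of \<open>w\<close>; so \<open>V 2\<close> lies in \<open>y R + w R\<close>, then \<open>V 3\<close> in \<open>y x R + w R\<close>,
  and \<open>V 4\<close> in \<open>w V 1\<close>.
\<close>

lemma V_gain_three_generators:
  assumes I: "ideal I R" and w1: "w \<in> V 1" and y1: "y \<in> V 1" and x1: "x \<in> V 1"
    and cw: "central_mod w I"
    and cy: "central_mod y (lin w (carrier R) I)"
    and cx: "central_mod x (lin y (carrier R) (lin w (carrier R) I))"
    and V1: "V 1 \<subseteq> lin x (carrier R) (lin y (carrier R) (lin w (carrier R) I))"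
    and yy: "y \<otimes> y \<in> I" and xx: "x \<otimes> x \<in> lin w (carrier R) I"
  shows "V 4 \<subseteq> lin w (V 1) I"
proof -
  let ?W = "lin w (carrier R) I" and ?C = "lin w (V 1) I" and ?B = "lin y (carrier R) (lin w (carrier R) I)"
  let ?D = "lin (y \<otimes> x) (carrier R) (lin w (carrier R) I)"
  have x: "x \<in> carrier R" and y: "y \<in> carrier R" and w: "w \<in> carrier R" using V_carr x1 y1 w1 by auto
  have W: "ideal ?W R" by (rule lin_ideal[OF w oneideal I cw])
  have C: "ideal ?C R" by (rule lin_ideal[OF w V_ideal I cw])
  have B: "ideal ?B R" by (rule lin_ideal[OF y oneideal W cy])
  have IC: "I \<subseteq> ?C" using lin_add[OF w _ V_ideal I] by auto
  have CW: "?C \<subseteq> ?W" by (rule lin_mono) (auto dest: V_carr)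
  have WB: "?W \<subseteq> ?B" using lin_add[OF y _ oneideal W] by auto
  note VW = mult_lin_subset(1)[OF w I cw _ V_ideal] and WV = mult_lin_subset(2)[OF w I cw _ V_ideal]
  have yB: "y \<otimes> b \<in> ?C" if "b \<in> ?B" for b
  proof -
    obtain r z where b: "r \<in> carrier R" "z \<in> ?W" "b = y \<otimes> r \<oplus> z" using \<open>b \<in> ?B\<close> by (auto simp: lin_def[of y])
    have "y \<otimes> b = (y \<otimes> y) \<otimes> r \<oplus> y \<otimes> z"
      using b y ideal_carr[OF W] by (simp add: r_distr m_assoc)
    moreover have "(y \<otimes> y) \<otimes> r \<in> ?C" using ideal_r[OF I yy b(1)] IC by blast
    ultimately show ?thesis using VW[OF y1 b(2)] by (simp only: ideal_add[OF C])
  qed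
  have cyx: "central_mod (y \<otimes> x) ?C"
    using x y yB[OF central_modD[OF cx]] WV[OF x1 central_modD[OF cy]]
    by (intro central_modI) (simp_all add: bracket_mult_left ideal_add[OF C] del: One_nat_def)
  have D: "ideal ?D R"
    by (rule lin_ideal[OF _ oneideal W]) (use x y central_mod_mono[OF cyx CW] in auto)
  have WD: "?W \<subseteq> ?D" using lin_add[OF _ _ oneideal W] x y by auto
  have V2: "V 2 \<subseteq> ?B"
  proof -
    have "V (Suc 1) \<subseteq> ?B"
    proof (rule V_step[where n = 1 and j = 0 and u = x and D = ?B])
      fix v assume "v \<in> V (Suc 0)"
      then obtain r b where v: "r \<in> carrier R" "b \<in> ?B" "v = x \<otimes> r \<oplus> b"
        using V1 by (auto simp: lin_def[of x])
      have "x \<otimes> v = (x \<otimes> x) \<otimes> r \<oplus> x \<otimes> b"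
        using v x ideal_carr[OF B] by (simp add: r_distr m_assoc)
      moreover have "(x \<otimes> x) \<otimes> r \<in> ?B" using ideal_r[OF W xx v(1)] WB by blast
      ultimately show "x \<otimes> v \<in> ?B" using v x by (simp only: ideal_add[OF B] ideal_l[OF B])
    qed (use V1 x B cx ideal_bracket[OF B] in auto)
    then show ?thesis by (simp add: numeral_2_eq_2)
  qed
  have V3: "V 3 \<subseteq> ?D"
  proof -
    have "V (Suc 2) \<subseteq> ?D"
    proof (rule V_step[where j = 0 and u = y and D = ?W])
      fix v assume "v \<in> V (Suc 0)"
      then obtain r b where v: "r \<in> carrier R" "b \<in> ?B" "v = x \<otimes> r \<oplus> b"
        using V1 by (auto simp: lin_def[of x])
      have "y \<otimes> v = (y \<otimes> x) \<otimes> r \<oplus> y \<otimes> b"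
        using v x y ideal_carr[OF B] by (simp add: r_distr m_assoc)
      then show "y \<otimes> v \<in> ?D" using yB[OF v(2)] CW by (intro linI[OF v(1), of "y \<otimes> b" ?W]) auto
    qed (use V2 y W D central_mod_mono[OF cy WD] ideal_bracket[OF W] WD in auto)
    then show ?thesis by (simp add: numeral_3_eq_3)
  qed
  have "V (Suc 3) \<subseteq> ?C"
  proof (rule V_step[where j = 0 and u = "y \<otimes> x" and D = ?W])
    fix v assume "v \<in> V (Suc 0)"
    then obtain r b where v: "r \<in> carrier R" "b \<in> ?B" "v = x \<otimes> r \<oplus> b"
      using V1 by (auto simp: lin_def[of x])
    have "y \<otimes> x \<otimes> v = (y \<otimes> (x \<otimes> x)) \<otimes> r \<oplus> y \<otimes> (x \<otimes> b)"
      using v x y ideal_carr[OF B] by (simp add: r_distr m_assoc)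
    moreover have "(y \<otimes> (x \<otimes> x)) \<otimes> r \<in> ?C" using VW[OF y1 xx] v ideal_r[OF C] by blast
    moreover have "y \<otimes> (x \<otimes> b) \<in> ?C" using yB[OF ideal_l[OF B v(2) x]] .
    ultimately show "y \<otimes> x \<otimes> v \<in> ?C" by (simp only: ideal_add[OF C])
  qed (use V3 x y W C cyx lin_bracket[OF w I cw] in auto)
  then show ?thesis by (simp add: numeral_eq_Suc)
qed

end

section \<open>Powers in characteristic p\<close>

context ring
begin

lemma one_plus_pow:
  assumes y: "y \<in> carrier R"
  shows "(y \<oplus> \<one>) [^] n = (\<Oplus>i\<in>{..n}. [(n choose i)] \<cdot> (y [^] i))"
proof (induction n)
  case 0 then show ?case using y by simp
next
  case (Suc n)
  have c: "(\<lambda>i. [(n choose i)] \<cdot> (y [^] i)) \<in> A \<rightarrow> carrier R"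
    "(\<lambda>i. [(n choose Suc i)] \<cdot> (y [^] Suc i)) \<in> A \<rightarrow> carrier R"
    "(\<lambda>i. [(n choose i)] \<cdot> (y [^] Suc i)) \<in> A \<rightarrow> carrier R"
    "(\<lambda>i. [(Suc n choose i)] \<cdot> (y [^] i)) \<in> A \<rightarrow> carrier R" for A
    using y by auto
  have "(\<Oplus>i\<in>{..Suc n}. [(Suc n choose i)] \<cdot> (y [^] i))
      = (\<Oplus>i\<in>{..n}. [(Suc n choose Suc i)] \<cdot> (y [^] Suc i)) \<oplus> \<one>"
    using y by (subst finsum_Suc2[OF c(4)]) simp
  also have "(\<Oplus>i\<in>{..n}. [(Suc n choose Suc i)] \<cdot> (y [^] Suc i))
     = (\<Oplus>i\<in>{..n}. [(n choose i)] \<cdot> (y [^] Suc i) \<oplus> [(n choose Suc i)] \<cdot> (y [^] Suc i))"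
    using y by (intro finsum_cong') (auto simp: add.nat_pow_mult)
  also have "\<dots> = (\<Oplus>i\<in>{..n}. [(n choose i)] \<cdot> (y [^] Suc i)) \<oplus> (\<Oplus>i\<in>{..n}. [(n choose Suc i)] \<cdot> (y [^] Suc i))"
    by (rule finsum_addf[OF c(3) c(2)])
  also have "(\<Oplus>i\<in>{..n}. [(n choose i)] \<cdot> (y [^] Suc i)) = (\<Oplus>i\<in>{..n}. [(n choose i)] \<cdot> (y [^] i)) \<otimes> y"
    using y by (subst finsum_ldistr[OF _ y c(1)]) (auto intro!: finsum_cong' simp: add_pow_ldistr)
  also have "(\<Oplus>i\<in>{..n}. [(n choose i)] \<cdot> (y [^] i)) \<otimes> y \<oplus> (\<Oplus>i\<in>{..n}. [(n choose Suc i)] \<cdot> (y [^] Suc i)) \<oplus> \<one>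
     = (\<Oplus>i\<in>{..n}. [(n choose i)] \<cdot> (y [^] i)) \<otimes> y \<oplus> ((\<Oplus>i\<in>{..n}. [(n choose Suc i)] \<cdot> (y [^] Suc i)) \<oplus> \<one>)"
    using y c finsum_closed by (simp add: a_assoc)
  also have "(\<Oplus>i\<in>{..n}. [(n choose Suc i)] \<cdot> (y [^] Suc i)) \<oplus> \<one> = (\<Oplus>i\<in>{..Suc n}. [(n choose i)] \<cdot> (y [^] i))"
    using y by (subst finsum_Suc2[OF c(1)]) simp
  also have "\<dots> = (\<Oplus>i\<in>{..n}. [(n choose i)] \<cdot> (y [^] i))"
    using y c(1) finsum_closed by (subst finsum_Suc[OF c(1)]) (simp add: binomial_eq_0)
  finally show ?case
    using y Suc c(1) finsum_closed by (simp add: r_distr)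
qed

lemma char_mult_zero:
  assumes "[p] \<cdot> \<one> = \<zero>" "x \<in> carrier R" "p dvd n"
  shows "[(n::nat)] \<cdot> x = \<zero>"
proof -
  obtain k where n: "n = p * k" using assms(3) by auto
  have "[n] \<cdot> x = [n] \<cdot> \<one> \<otimes> x" using assms by (simp add: add_pow_ldistr)
  also have "[n] \<cdot> \<one> = [k] \<cdot> ([p] \<cdot> \<one>)" unfolding n by (simp add: add.nat_pow_pow)
  finally show ?thesis using assms by simp
qed

lemma one_plus_pow_prime:
  assumes p: "prime (p::nat)" and ch: "[p] \<cdot> \<one> = \<zero>" and y: "y \<in> carrier R"
  shows "(y \<oplus> \<one>) [^] p = y [^] p \<oplus> \<one>"
proof -
  obtain m where m: "p = Suc (Suc m)" using p prime_ge_2_nat by (metis add_2_eq_Suc le_Suc_ex)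
  have c: "(\<lambda>i. [(p choose i)] \<cdot> (y [^] i)) \<in> A \<rightarrow> carrier R"
      "(\<lambda>i. [(p choose Suc i)] \<cdot> (y [^] Suc i)) \<in> A \<rightarrow> carrier R" for A using y by auto
  have z: "[(p choose Suc i)] \<cdot> (y [^] Suc i) = \<zero>" if "i \<le> m" for i
  proof (rule char_mult_zero[OF ch])
    show "p dvd (p choose Suc i)" using p that m by (intro dvd_choose_prime) auto
  qed (use y in simp)
  have "(y \<oplus> \<one>) [^] p = (\<Oplus>i\<in>{..Suc (Suc m)}. [(p choose i)] \<cdot> (y [^] i))"
    using one_plus_pow[OF y, of p] m by simp
  also have "\<dots> = [(p choose p)] \<cdot> (y [^] p) \<oplus> (\<Oplus>i\<in>{..Suc m}. [(p choose i)] \<cdot> (y [^] i))"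
    by (subst finsum_Suc[OF c(1)]) (simp only: m[symmetric])
  also have "(\<Oplus>i\<in>{..Suc m}. [(p choose i)] \<cdot> (y [^] i)) = (\<Oplus>i\<in>{..m}. [(p choose Suc i)] \<cdot> (y [^] Suc i)) \<oplus> [(p choose 0)] \<cdot> (y [^] (0::nat))"
    by (rule finsum_Suc2[OF c(1)])
  also have "(\<Oplus>i\<in>{..m}. [(p choose Suc i)] \<cdot> (y [^] Suc i)) = (\<Oplus>i\<in>{..m}. \<zero>)"
    by (rule finsum_cong') (use z in auto)
  finally show ?thesis using y by simp
qed

lemma minus_one_pow_prime:
  assumes p: "prime (p::nat)" and ch: "[p] \<cdot> \<one> = \<zero>" and x: "x \<in> carrier R"
  shows "(x \<ominus> \<one>) [^] p = x [^] p \<ominus> \<one>"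
proof -
  have "(x \<ominus> \<one>) \<oplus> \<one> = x" using x by (simp add: minus_eq a_assoc l_neg)
  then have "x [^] p = (x \<ominus> \<one>) [^] p \<oplus> \<one>"
    using one_plus_pow_prime[OF p ch, of "x \<ominus> \<one>"] x by simp
  moreover have "(x \<ominus> \<one>) [^] p = ((x \<ominus> \<one>) [^] p \<oplus> \<one>) \<ominus> \<one>"
    using x by (simp add: minus_eq a_assoc r_neg)
  ultimately show ?thesis by simp
qed

lemma minus_one_pow_prime_power:
  assumes p: "prime (p::nat)" and ch: "[p] \<cdot> \<one> = \<zero>" and x: "x \<in> carrier R"
  shows "(x \<ominus> \<one>) [^] (p ^ k) = x [^] (p ^ k) \<ominus> \<one>"
proof (induction k)
  case 0 then show ?case using x by (simp add: numeral_nat(7))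
next
  case (Suc k)
  have "(x \<ominus> \<one>) [^] (p ^ Suc k) = ((x \<ominus> \<one>) [^] (p ^ k)) [^] p"
    using x by (simp add: nat_pow_pow mult.commute)
  also have "\<dots> = x [^] (p ^ Suc k) \<ominus> \<one>"
    using x by (simp add: Suc minus_one_pow_prime[OF p ch] nat_pow_pow mult.commute)
  finally show ?case .
qed

end

section \<open>The group algebra as a ring\<close>

locale group_ring = group G + K: field K
  for G :: "('g, 'n) monoid_scheme" (structure) and K :: "('k, 'm) ring_scheme"
begin

abbreviation R :: "('k, 'g \<Rightarrow> 'k) module" where
  "R \<equiv> group_algebra K G"

definition monomial :: "'k \<Rightarrow> 'g \<Rightarrow> 'g \<Rightarrow> 'k" where
  "monomial k g = (\<lambda>x. if x = g then k else \<zero>\<^bsub>K\<^esub>)"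

abbreviation supp :: "('g \<Rightarrow> 'k) \<Rightarrow> 'g set" where
  "supp a \<equiv> {x. a x \<noteq> \<zero>\<^bsub>K\<^esub>}"

lemma R_simps:
  "carrier R = {a. range a \<subseteq> carrier K \<and> supp a \<subseteq> carrier G \<and> finite (supp a)}"
  "a \<otimes>\<^bsub>R\<^esub> b = (\<lambda>x. if x \<in> carrier G
                then \<Oplus>\<^bsub>K\<^esub>y\<in>supp a. a y \<otimes>\<^bsub>K\<^esub> b (inv y \<otimes> x) else \<zero>\<^bsub>K\<^esub>)"
  "\<one>\<^bsub>R\<^esub> = monomial \<one>\<^bsub>K\<^esub> \<one>"
  "\<zero>\<^bsub>R\<^esub> = (\<lambda>x. \<zero>\<^bsub>K\<^esub>)"
  "a \<oplus>\<^bsub>R\<^esub> b = (\<lambda>x. a x \<oplus>\<^bsub>K\<^esub> b x)"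
  by (auto simp: group_algebra_def monomial_def)

lemma R_carrierD:
  assumes "a \<in> carrier R"
  shows "a x \<in> carrier K" "finite (supp a)" "supp a \<subseteq> carrier G"
  using assms by (auto simp: R_simps)

lemma R_outside: "a \<in> carrier R \<Longrightarrow> x \<notin> carrier G \<Longrightarrow> a x = \<zero>\<^bsub>K\<^esub>"
  by (auto simp: R_simps)

lemma R_carrierI:
  assumes "\<And>x. a x \<in> carrier K" "finite S" "supp a \<subseteq> S" "S \<subseteq> carrier G"
  shows "a \<in> carrier R"
  using assms by (auto simp: R_simps intro: finite_subset)

lemma R_addition: "abelian_group R"
proof (rule abelian_groupI)
  fix a b assume a: "a \<in> carrier R" and b: "b \<in> carrier R"
  show "a \<oplus>\<^bsub>R\<^esub> b \<in> carrier R"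
    by (rule R_carrierI[where S = "supp a \<union> supp b"])
      (use R_carrierD[OF a] R_carrierD[OF b] in \<open>auto simp: R_simps\<close>)
  show "a \<oplus>\<^bsub>R\<^esub> b = b \<oplus>\<^bsub>R\<^esub> a"
    using R_carrierD[OF a] R_carrierD[OF b] by (auto simp: R_simps K.a_comm)
  { fix c assume c: "c \<in> carrier R"
    show "a \<oplus>\<^bsub>R\<^esub> b \<oplus>\<^bsub>R\<^esub> c = a \<oplus>\<^bsub>R\<^esub> (b \<oplus>\<^bsub>R\<^esub> c)"
      using R_carrierD[OF a] R_carrierD[OF b] R_carrierD[OF c] by (auto simp: R_simps K.a_assoc) }
next
  show "\<zero>\<^bsub>R\<^esub> \<in> carrier R" by (auto simp: R_simps)
next
  fix a assume a: "a \<in> carrier R"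
  show "\<zero>\<^bsub>R\<^esub> \<oplus>\<^bsub>R\<^esub> a = a" using R_carrierD[OF a] by (auto simp: R_simps)
  have "(\<lambda>x. \<ominus>\<^bsub>K\<^esub> a x) \<in> carrier R"
    by (rule R_carrierI[where S = "supp a"]) (use R_carrierD[OF a] in auto)
  moreover have "(\<lambda>x. \<ominus>\<^bsub>K\<^esub> a x) \<oplus>\<^bsub>R\<^esub> a = \<zero>\<^bsub>R\<^esub>"
    using R_carrierD[OF a] by (auto simp: R_simps K.l_neg)
  ultimately show "\<exists>y\<in>carrier R. y \<oplus>\<^bsub>R\<^esub> a = \<zero>\<^bsub>R\<^esub>" by blast
qed

lemma monomial_closed: "k \<in> carrier K \<Longrightarrow> g \<in> carrier G \<Longrightarrow> monomial k g \<in> carrier R"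
  by (rule R_carrierI[where S = "{g}"]) (auto simp: monomial_def)

text \<open>
  Laws that are additive in each argument need to be checked on monomials only. This spares the
  reindexing of double sums in the proof of associativity.
\<close>

lemma R_induct [consumes 1, case_names zero monomial add]:
  assumes a: "a \<in> carrier R" and 0: "P \<zero>\<^bsub>R\<^esub>"
    and m: "\<And>k g. k \<in> carrier K \<Longrightarrow> g \<in> carrier G \<Longrightarrow> P (monomial k g)"
    and s: "\<And>a b. a \<in> carrier R \<Longrightarrow> b \<in> carrier R \<Longrightarrow> P a \<Longrightarrow> P b \<Longrightarrow> P (a \<oplus>\<^bsub>R\<^esub> b)"
  shows "P a"
proof -
  have "P a" if "finite S" "a \<in> carrier R" "supp a \<subseteq> S" for S a
    using that
  proof (induction S arbitrary: a)
    case empty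
    then have "a = \<zero>\<^bsub>R\<^esub>" by (auto simp: R_simps)
    then show ?case using 0 by simp
  next
    case (insert g S)
    note a = R_carrierD[OF insert.prems(1)]
    show ?case
    proof (cases "g \<in> supp a")
      case False
      then show ?thesis using insert by auto
    next
      case True
      let ?b = "a(g := \<zero>\<^bsub>K\<^esub>)"
      have b: "?b \<in> carrier R"
        by (rule R_carrierI[where S = "supp a"]) (use a in auto)
      have "P ?b" using insert.prems(2) by (intro insert.IH b) (auto split: if_splits)
      moreover have "P (monomial (a g) g)" using a True by (intro m) auto
      moreover have "a = monomial (a g) g \<oplus>\<^bsub>R\<^esub> ?b"
        using a by (auto simp: R_simps monomial_def)
      ultimately show ?thesis using s[OF monomial_closed b] a True by (metis subsetD)
    qed
  qed
  from this[OF R_carrierD(2)[OF a] a] show ?thesis by simp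
qed

lemma R_mult_superset:
  assumes a: "a \<in> carrier R" and b: "b \<in> carrier R" and S: "finite S" "supp a \<subseteq> S" "S \<subseteq> carrier G"
    and x: "x \<in> carrier G"
  shows "(a \<otimes>\<^bsub>R\<^esub> b) x = (\<Oplus>\<^bsub>K\<^esub>y\<in>S. a y \<otimes>\<^bsub>K\<^esub> b (inv y \<otimes> x))"
proof -
  have "(\<Oplus>\<^bsub>K\<^esub>y\<in>supp a. a y \<otimes>\<^bsub>K\<^esub> b (inv y \<otimes> x)) = (\<Oplus>\<^bsub>K\<^esub>y\<in>S. a y \<otimes>\<^bsub>K\<^esub> b (inv y \<otimes> x))"
    using S R_carrierD[OF a] R_carrierD[OF b]
    by (intro K.add.finprod_mono_neutral_cong_left) auto
  then show ?thesis using x by (simp add: R_simps)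
qed

lemma R_mult_outside: "x \<notin> carrier G \<Longrightarrow> (a \<otimes>\<^bsub>R\<^esub> b) x = \<zero>\<^bsub>K\<^esub>"
  by (simp add: R_simps)

lemma R_mult_closed:
  assumes a: "a \<in> carrier R" and b: "b \<in> carrier R"
  shows "a \<otimes>\<^bsub>R\<^esub> b \<in> carrier R"
proof (rule R_carrierI)
  note aD = R_carrierD[OF a] and bD = R_carrierD[OF b]
  show "(a \<otimes>\<^bsub>R\<^esub> b) x \<in> carrier K" for x
    using aD bD by (auto simp: R_simps intro!: K.finsum_closed)
  let ?S = "(\<lambda>(y, z). y \<otimes> z) ` (supp a \<times> supp b)"
  show "finite ?S" using aD bD by auto
  show "?S \<subseteq> carrier G" using aD bD by auto
  show "supp (a \<otimes>\<^bsub>R\<^esub> b) \<subseteq> ?S"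
  proof (rule subsetI, rule ccontr)
    fix x assume x: "x \<in> supp (a \<otimes>\<^bsub>R\<^esub> b)" and n: "x \<notin> ?S"
    have xG: "x \<in> carrier G" using x R_mult_outside by force
    have "b (inv y \<otimes> x) = \<zero>\<^bsub>K\<^esub>" if "y \<in> supp a" for y
    proof (rule ccontr)
      assume "b (inv y \<otimes> x) \<noteq> \<zero>\<^bsub>K\<^esub>"
      moreover have "y \<otimes> (inv y \<otimes> x) = x" using that aD xG by (simp add: m_assoc[symmetric] subsetD)
      ultimately have "(y, inv y \<otimes> x) \<in> supp a \<times> supp b" "x = (\<lambda>(y, z). y \<otimes> z) (y, inv y \<otimes> x)"
        using that by auto
      then show False using n by blast
    qed
    then have "(a \<otimes>\<^bsub>R\<^esub> b) x = (\<Oplus>\<^bsub>K\<^esub>y\<in>supp a. \<zero>\<^bsub>K\<^esub>)"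
      using xG aD K.add.finprod_one_eqI[of "supp a" "\<lambda>y. a y \<otimes>\<^bsub>K\<^esub> b (inv y \<otimes> x)"]
      by (auto simp: R_simps)
    then show False using x by simp
  qed
qed

lemma R_l_distr:
  assumes a: "a \<in> carrier R" and b: "b \<in> carrier R" and c: "c \<in> carrier R"
  shows "(a \<oplus>\<^bsub>R\<^esub> b) \<otimes>\<^bsub>R\<^esub> c = a \<otimes>\<^bsub>R\<^esub> c \<oplus>\<^bsub>R\<^esub> b \<otimes>\<^bsub>R\<^esub> c"
proof
  fix x
  note D = R_carrierD[OF a] R_carrierD[OF b] R_carrierD[OF c]
  have ab: "a \<oplus>\<^bsub>R\<^esub> b \<in> carrier R" using R_addition a b by (simp add: abelian_monoid.a_closed abelian_group.axioms)
  show "((a \<oplus>\<^bsub>R\<^esub> b) \<otimes>\<^bsub>R\<^esub> c) x = (a \<otimes>\<^bsub>R\<^esub> c \<oplus>\<^bsub>R\<^esub> b \<otimes>\<^bsub>R\<^esub> c) x"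
  proof (cases "x \<in> carrier G")
    case True
    let ?S = "supp a \<union> supp b"
    have S: "finite ?S" "?S \<subseteq> carrier G" "supp (a \<oplus>\<^bsub>R\<^esub> b) \<subseteq> ?S" using D by (auto simp: R_simps(5))
    have "((a \<oplus>\<^bsub>R\<^esub> b) \<otimes>\<^bsub>R\<^esub> c) x = (\<Oplus>\<^bsub>K\<^esub>y\<in>?S. (a \<oplus>\<^bsub>R\<^esub> b) y \<otimes>\<^bsub>K\<^esub> c (inv y \<otimes> x))"
      by (rule R_mult_superset[OF ab c S(1,3,2) True])
    also have "\<dots> = (\<Oplus>\<^bsub>K\<^esub>y\<in>?S. a y \<otimes>\<^bsub>K\<^esub> c (inv y \<otimes> x) \<oplus>\<^bsub>K\<^esub> b y \<otimes>\<^bsub>K\<^esub> c (inv y \<otimes> x))"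
      using D by (intro K.finsum_cong') (auto simp: R_simps(5) K.l_distr)
    also have "\<dots> = (\<Oplus>\<^bsub>K\<^esub>y\<in>?S. a y \<otimes>\<^bsub>K\<^esub> c (inv y \<otimes> x)) \<oplus>\<^bsub>K\<^esub> (\<Oplus>\<^bsub>K\<^esub>y\<in>?S. b y \<otimes>\<^bsub>K\<^esub> c (inv y \<otimes> x))"
      using D by (intro K.finsum_addf) auto
    also have "\<dots> = (a \<otimes>\<^bsub>R\<^esub> c \<oplus>\<^bsub>R\<^esub> b \<otimes>\<^bsub>R\<^esub> c) x"
      using R_mult_superset[OF a c S(1) _ S(2) True] R_mult_superset[OF b c S(1) _ S(2) True]
      by (simp add: R_simps(5))
    finally show ?thesis .
  qed (simp add: R_simps)
qed

lemma R_r_distr: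
  assumes a: "a \<in> carrier R" and b: "b \<in> carrier R" and c: "c \<in> carrier R"
  shows "c \<otimes>\<^bsub>R\<^esub> (a \<oplus>\<^bsub>R\<^esub> b) = c \<otimes>\<^bsub>R\<^esub> a \<oplus>\<^bsub>R\<^esub> c \<otimes>\<^bsub>R\<^esub> b"
proof
  fix x
  note D = R_carrierD[OF a] R_carrierD[OF b] R_carrierD[OF c]
  show "(c \<otimes>\<^bsub>R\<^esub> (a \<oplus>\<^bsub>R\<^esub> b)) x = (c \<otimes>\<^bsub>R\<^esub> a \<oplus>\<^bsub>R\<^esub> c \<otimes>\<^bsub>R\<^esub> b) x"
  proof (cases "x \<in> carrier G")
    case True
    have "(c \<otimes>\<^bsub>R\<^esub> (a \<oplus>\<^bsub>R\<^esub> b)) x = (\<Oplus>\<^bsub>K\<^esub>y\<in>supp c. c y \<otimes>\<^bsub>K\<^esub> a (inv y \<otimes> x) \<oplus>\<^bsub>K\<^esub> c y \<otimes>\<^bsub>K\<^esub> b (inv y \<otimes> x))"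
      using D True by (simp add: R_simps K.r_distr)
    also have "\<dots> = (\<Oplus>\<^bsub>K\<^esub>y\<in>supp c. c y \<otimes>\<^bsub>K\<^esub> a (inv y \<otimes> x)) \<oplus>\<^bsub>K\<^esub> (\<Oplus>\<^bsub>K\<^esub>y\<in>supp c. c y \<otimes>\<^bsub>K\<^esub> b (inv y \<otimes> x))"
      using D by (intro K.finsum_addf) auto
    finally show ?thesis using True by (simp add: R_simps)
  qed (simp add: R_simps)
qed

lemma monomial_mult:
  assumes k: "k \<in> carrier K" and g: "g \<in> carrier G" and b: "b \<in> carrier R" and x: "x \<in> carrier G"
  shows "(monomial k g \<otimes>\<^bsub>R\<^esub> b) x = k \<otimes>\<^bsub>K\<^esub> b (inv g \<otimes> x)"
proof -
  have "(monomial k g \<otimes>\<^bsub>R\<^esub> b) x = (\<Oplus>\<^bsub>K\<^esub>y\<in>{g}. monomial k g y \<otimes>\<^bsub>K\<^esub> b (inv y \<otimes> x))"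
    by (rule R_mult_superset[OF monomial_closed[OF k g] b _ _ _ x]) (use g in \<open>auto simp: monomial_def\<close>)
  also have "\<dots> = k \<otimes>\<^bsub>K\<^esub> b (inv g \<otimes> x)"
    using k R_carrierD[OF b] by (simp add: monomial_def)
  finally show ?thesis .
qed

lemma monomial_mult_monomial:
  assumes "k \<in> carrier K" "g \<in> carrier G" "l \<in> carrier K" "h \<in> carrier G"
  shows "monomial k g \<otimes>\<^bsub>R\<^esub> monomial l h = monomial (k \<otimes>\<^bsub>K\<^esub> l) (g \<otimes> h)"
proof
  fix x show "(monomial k g \<otimes>\<^bsub>R\<^esub> monomial l h) x = monomial (k \<otimes>\<^bsub>K\<^esub> l) (g \<otimes> h) x"
  proof (cases "x \<in> carrier G")
    case True
    have "inv g \<otimes> x = h \<longleftrightarrow> x = g \<otimes> h" using True assms by (metis inv_solve_left)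
    then show ?thesis
      using monomial_mult[OF assms(1,2) monomial_closed[OF assms(3,4)] True] assms
      by (simp add: monomial_def)
  qed (use assms in \<open>auto simp: R_mult_outside monomial_def\<close>)
qed

lemma R_mult_zero: "a \<in> carrier R \<Longrightarrow> \<zero>\<^bsub>R\<^esub> \<otimes>\<^bsub>R\<^esub> a = \<zero>\<^bsub>R\<^esub>"
  by (auto simp: R_simps)

lemma R_one_mult: "a \<in> carrier R \<Longrightarrow> \<one>\<^bsub>R\<^esub> \<otimes>\<^bsub>R\<^esub> a = a"
proof
  fix x assume a: "a \<in> carrier R"
  show "(\<one>\<^bsub>R\<^esub> \<otimes>\<^bsub>R\<^esub> a) x = a x"
    using monomial_mult[OF K.one_closed one_closed a, of x] R_carrierD[OF a] R_outside[OF a, of x]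
      R_mult_outside[of x "\<one>\<^bsub>R\<^esub>" a]
    by (cases "x \<in> carrier G") (auto simp: R_simps(3))
qed

lemma R_mult_assoc:
  assumes a: "a \<in> carrier R" and b: "b \<in> carrier R" and c: "c \<in> carrier R"
  shows "a \<otimes>\<^bsub>R\<^esub> b \<otimes>\<^bsub>R\<^esub> c = a \<otimes>\<^bsub>R\<^esub> (b \<otimes>\<^bsub>R\<^esub> c)"
  using a
proof (induction a rule: R_induct)
  case zero
  then show ?case using b c R_mult_closed by (simp add: R_mult_zero)
next
  case (add a a')
  then show ?case using b c R_mult_closed by (simp add: R_l_distr)
next
  case (monomial k g)
  note m = monomial_closed[OF monomial]
  show ?case using b
  proof (induction b rule: R_induct)
    case zero
    have "monomial k g \<otimes>\<^bsub>R\<^esub> \<zero>\<^bsub>R\<^esub> = \<zero>\<^bsub>R\<^esub>"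
      using R_carrierD[OF m] by (auto simp: R_simps)
    then show ?case using c by (simp add: R_mult_zero)
  next
    case (add b b')
    then show ?case using c m R_mult_closed by (simp add: R_l_distr R_r_distr)
  next
    case (monomial l h)
    note g = \<open>k \<in> carrier K\<close> \<open>g \<in> carrier G\<close>
    show ?case
    proof
      fix x show "(monomial k g \<otimes>\<^bsub>R\<^esub> monomial l h \<otimes>\<^bsub>R\<^esub> c) x
        = (monomial k g \<otimes>\<^bsub>R\<^esub> (monomial l h \<otimes>\<^bsub>R\<^esub> c)) x"
      proof (cases "x \<in> carrier G")
        case True
        then show ?thesis
          using g monomial c R_carrierD[OF c] R_mult_closed[OF monomial_closed[OF monomial] c]
          by (simp add: monomial_mult_monomial monomial_mult K.m_assoc m_assoc inv_mult_group)
      qed (simp add: R_mult_outside)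
    qed
  qed
qed

lemma R_mult_one:
  assumes "a \<in> carrier R" shows "a \<otimes>\<^bsub>R\<^esub> \<one>\<^bsub>R\<^esub> = a"
  using assms
proof (induction a rule: R_induct)
  case zero
  then show ?case using monomial_closed by (simp add: R_mult_zero R_simps(3))
next
  case (monomial k g)
  then show ?case by (simp add: R_simps(3) monomial_mult_monomial)
next
  case (add a b)
  then show ?case using monomial_closed by (simp add: R_l_distr R_simps(3))
qed

sublocale R: ring R
proof (rule ringI[OF R_addition])
  show "monoid R"
    by (rule monoidI)
      (auto simp: R_mult_closed R_mult_assoc R_one_mult R_mult_one, simp add: R_simps(3) monomial_closed)
qed (auto simp: R_l_distr R_r_distr)

end

section \<open>Group commutators and sections\<close>

context group
begin

abbreviation gc :: "'a \<Rightarrow> 'a \<Rightarrow> 'a" where "gc \<equiv> group_commutator G"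

lemma left_cancel:
  "x \<in> carrier G \<Longrightarrow> y \<in> carrier G \<Longrightarrow> z \<in> carrier G \<Longrightarrow> x \<otimes> y = x \<otimes> z \<longleftrightarrow> y = z"
  by (simp add: Units_eq)

lemma mult_inv_cancel:
  "x \<in> carrier G \<Longrightarrow> z \<in> carrier G \<Longrightarrow> x \<otimes> (inv x \<otimes> z) = z"
  "x \<in> carrier G \<Longrightarrow> z \<in> carrier G \<Longrightarrow> inv x \<otimes> (x \<otimes> z) = z"
  by (simp_all flip: m_assoc)

lemma subgroup_nat_pow_closed:
  assumes "subgroup H G" "x \<in> H" shows "x [^] (n::nat) \<in> H"
  by (induction n) (use assms in \<open>auto simp: subgroup.one_closed subgroup.m_closed\<close>)

lemma gc_closed [simp, intro]: "x \<in> carrier G \<Longrightarrow> y \<in> carrier G \<Longrightarrow> gc x y \<in> carrier G"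
  by (simp add: group_commutator_def)

lemma mult_gc: "x \<in> carrier G \<Longrightarrow> y \<in> carrier G \<Longrightarrow> y \<otimes> x \<otimes> gc x y = x \<otimes> y"
  by (simp add: group_commutator_def m_assoc mult_inv_cancel)

lemma conj_eq_mult_gc: "x \<in> carrier G \<Longrightarrow> g \<in> carrier G \<Longrightarrow> inv g \<otimes> x \<otimes> g = x \<otimes> gc x g"
  by (simp add: group_commutator_def m_assoc mult_inv_cancel)

lemma gc_eq_one_iff:
  assumes "x \<in> carrier G" "y \<in> carrier G"
  shows "gc x y = \<one> \<longleftrightarrow> x \<otimes> y = y \<otimes> x"
proof -
  have "gc x y = \<one> \<longleftrightarrow> y \<otimes> x \<otimes> gc x y = y \<otimes> x \<otimes> \<one>"
    using assms by (subst left_cancel) auto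
  then show ?thesis using assms by (simp add: mult_gc)
qed

lemma gc_swap: "x \<in> carrier G \<Longrightarrow> y \<in> carrier G \<Longrightarrow> gc y x = inv (gc x y)"
  by (simp add: group_commutator_def inv_mult_group m_assoc)

lemma gc_derived: "x \<in> carrier G \<Longrightarrow> y \<in> carrier G \<Longrightarrow> gc x y \<in> derived G (carrier G)"
  unfolding lower_central_2[symmetric] numeral_2_eq_2 by (auto intro: generate.incl)

lemma derived_minimal:
  assumes "subgroup H G" "\<And>x y. x \<in> carrier G \<Longrightarrow> y \<in> carrier G \<Longrightarrow> gc x y \<in> H"
  shows "derived G (carrier G) \<subseteq> H"
  unfolding lower_central_2[symmetric] numeral_2_eq_2 lower_central.simps
  by (rule generate_subgroup_incl[OF _ assms(1)]) (use assms(2) in auto)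

lemma derived_normal: "derived G (carrier G) \<lhd> G"
  using derived_is_normal[OF normal_self] .

lemma pow_coprime_mem:
  assumes H: "subgroup H G" and x: "x \<in> carrier G" and i: "x [^] (i::nat) \<in> H" and j: "x [^] (j::nat) \<in> H"
    and c: "coprime i j"
  shows "x \<in> H"
proof -
  obtain u v where uv: "u * int i + v * int j = 1"
    using c bezout_int[of "int i" "int j"] by (metis coprime_iff_gcd_eq_1 coprime_int_iff)
  have "x = x [^] (u * int i + v * int j)" using x by (simp add: uv int_pow_1)
  also have "\<dots> = (x [^] i) [^] u \<otimes> (x [^] j) [^] v"
    using x by (simp add: int_pow_mult int_pow_pow mult.commute flip: int_pow_int)
  also have "\<dots> \<in> H"
    using H i j by (simp add: subgroup.m_closed subgroup_int_pow_closed)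
  finally show ?thesis .
qed

lemma pow_prime_mem:
  assumes "subgroup H G" "x \<in> carrier G" "x [^] (i::nat) \<in> H" "x [^] (p::nat) \<in> H"
    and "prime p" "\<not> p dvd i"
  shows "x \<in> H"
  using pow_coprime_mem[OF assms(1-4)] prime_imp_coprime[OF assms(5,6)] coprime_commute by blast

lemma conj_pow_nat:
  assumes "x \<in> carrier G" "g \<in> carrier G"
  shows "g \<otimes> x [^] (i::nat) \<otimes> inv g = (g \<otimes> x \<otimes> inv g) [^] i"
proof (induction i)
  case 0 then show ?case using assms by simp
next
  case (Suc i)
  have "g \<otimes> x [^] Suc i \<otimes> inv g = (g \<otimes> x [^] i \<otimes> inv g) \<otimes> (g \<otimes> x \<otimes> inv g)"
    using assms by (simp add: m_assoc mult_inv_cancel)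
  then show ?case using Suc by simp
qed

text \<open>The preimage in \<open>G\<close> of the centre of \<open>G / M\<close>, for a normal subgroup \<open>M\<close>.\<close>

definition centralizer_mod :: "'a set \<Rightarrow> 'a set" where
  "centralizer_mod M = {c \<in> carrier G. \<forall>g\<in>carrier G. gc c g \<in> M}"

text \<open>
  The subgroup \<open>\<langle>c\<rangle> M\<close>, provided that \<open>M\<close> is normal and some positive power of \<open>c\<close> lies in \<open>M\<close>: then
  exponents in the natural numbers suffice.
\<close>

definition adjoin :: "'a \<Rightarrow> 'a set \<Rightarrow> 'a set" where
  "adjoin c M = {c [^] i \<otimes> m | (i::nat) m. m \<in> M}"

lemma commuting_set_subgroup:
  assumes S: "S \<subseteq> carrier G"
  shows "subgroup {c \<in> carrier G. \<forall>g\<in>S. c \<otimes> g = g \<otimes> c} G"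
proof
  fix x y assume x: "x \<in> {c \<in> carrier G. \<forall>g\<in>S. c \<otimes> g = g \<otimes> c}"
  { assume y: "y \<in> {c \<in> carrier G. \<forall>g\<in>S. c \<otimes> g = g \<otimes> c}"
    have "x \<otimes> y \<otimes> g = g \<otimes> (x \<otimes> y)" if "g \<in> S" for g
    proof -
      have c: "x \<in> carrier G" "y \<in> carrier G" "g \<in> carrier G" using x y S that by auto
      have "x \<otimes> y \<otimes> g = x \<otimes> (g \<otimes> y)" using c y that by (simp add: m_assoc)
      also have "\<dots> = x \<otimes> g \<otimes> y" using c by (simp add: m_assoc)
      also have "\<dots> = g \<otimes> x \<otimes> y" using x that by simp
      finally show ?thesis using c by (simp add: m_assoc)
    qed
    then show "x \<otimes> y \<in> {c \<in> carrier G. \<forall>g\<in>S. c \<otimes> g = g \<otimes> c}" using x y by auto }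
  have "inv x \<otimes> g = g \<otimes> inv x" if "g \<in> S" for g
  proof -
    have c: "x \<in> carrier G" "g \<in> carrier G" and xg: "g \<otimes> x = x \<otimes> g" using x S that by auto
    have "inv x \<otimes> g = inv x \<otimes> (g \<otimes> x) \<otimes> inv x" using c by (simp add: m_assoc)
    then show ?thesis unfolding xg using c by (simp add: mult_inv_cancel)
  qed
  then show "inv x \<in> {c \<in> carrier G. \<forall>g\<in>S. c \<otimes> g = g \<otimes> c}" using x by auto
qed (use S in auto)

lemma commuting_product_pow:
  assumes "a \<in> carrier G" "c \<in> carrier G" "a \<otimes> c = c \<otimes> a" "c [^] (p::nat) = \<one>"
  shows "(a [^] (i::nat) \<otimes> c [^] (j::nat)) [^] p = (a [^] p) [^] i"
proof -
  have "a [^] i \<otimes> c [^] j = c [^] j \<otimes> a [^] i"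
    using assms group_commutes_pow[of a c i] group_commutes_pow[of c "a [^] i" j] by simp
  then have "(a [^] i \<otimes> c [^] j) [^] p = (a [^] i) [^] p \<otimes> (c [^] j) [^] p"
    by (rule pow_mult_distrib) (use assms in auto)
  also have "(c [^] j) [^] p = \<one>"
    using nat_pow_pow[OF assms(2), of p j] nat_pow_pow[OF assms(2), of j p] assms(4) by (simp add: mult.commute)
  also have "(a [^] i) [^] p = (a [^] p) [^] i"
    using assms by (simp add: nat_pow_pow mult.commute)
  finally show ?thesis using assms by simp
qed

lemma conj_eq_inv:
  assumes c: "c \<in> carrier G" "g \<in> carrier G" and i: "gc c g \<otimes> (c \<otimes> c) = \<one>"
  shows "inv g \<otimes> c \<otimes> g = inv c"
proof -
  have "c \<otimes> gc c g \<otimes> c \<otimes> c = c \<otimes> (gc c g \<otimes> (c \<otimes> c))" using c by (simp add: m_assoc)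
  also have "\<dots> = c" unfolding i using c by simp
  finally have "c \<otimes> gc c g \<otimes> c = \<one>" using c r_cancel_one[of c "c \<otimes> gc c g \<otimes> c"] by simp
  then have "c \<otimes> gc c g = inv c" using c by (intro inv_equality[symmetric]) auto
  then show ?thesis using conj_eq_mult_gc[OF c] by simp
qed

lemma inverted_twice:
  assumes c: "c \<in> carrier G" "g \<in> carrier G" "h \<in> carrier G"
    and i: "gc c g \<otimes> (c \<otimes> c) = \<one>" "gc c h \<otimes> (c \<otimes> c) = \<one>"
  shows "gc c (g \<otimes> h) = \<one>"
proof -
  have "inv (g \<otimes> h) \<otimes> c \<otimes> (g \<otimes> h) = inv h \<otimes> (inv g \<otimes> c \<otimes> g) \<otimes> h"
    using c by (simp add: inv_mult_group m_assoc)
  also have "\<dots> = inv (inv h \<otimes> c \<otimes> h)"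
    unfolding conj_eq_inv[OF c(1,2) i(1)] using c by (simp add: inv_mult_group m_assoc)
  also have "\<dots> = c" unfolding conj_eq_inv[OF c(1,3) i(2)] using c by simp
  finally have "c \<otimes> gc c (g \<otimes> h) = c" using conj_eq_mult_gc[of c "g \<otimes> h"] c by simp
  then show ?thesis using c l_cancel_one[of c "gc c (g \<otimes> h)"] by simp
qed

text \<open>Compare the squares of both sides of \<open>a\<^sup>h = a c m\<close>.\<close>

lemma square_commuting:
  assumes c: "a \<in> carrier G" "c \<in> carrier G" "h \<in> carrier G" "m \<in> carrier G"
    and e: "inv h \<otimes> a \<otimes> h = a \<otimes> c \<otimes> m" and ac: "a \<otimes> c = c \<otimes> a" and am: "a \<otimes> m = m \<otimes> a" and cm: "c \<otimes> m = m \<otimes> c"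
    and m: "m \<otimes> m = \<one>" and h: "h \<otimes> (a \<otimes> a) = a \<otimes> a \<otimes> h"
  shows "c \<otimes> c = \<one>"
proof -
  have "inv h \<otimes> a \<otimes> h \<otimes> (inv h \<otimes> a \<otimes> h) = inv h \<otimes> (a \<otimes> a \<otimes> h)"
    using c by (simp add: m_assoc mult_inv_cancel)
  also have "\<dots> = a \<otimes> a"
    unfolding h[symmetric] using c by (simp add: mult_inv_cancel)
  finally have "a \<otimes> a = a \<otimes> c \<otimes> m \<otimes> (a \<otimes> c \<otimes> m)" using e by simp
  also have "\<dots> = a \<otimes> a \<otimes> (c \<otimes> c) \<otimes> (m \<otimes> m)"
  proof -
    have "a \<otimes> c \<otimes> m \<otimes> (a \<otimes> c \<otimes> m) = a \<otimes> (c \<otimes> ((m \<otimes> a) \<otimes> (c \<otimes> m)))" using c by (simp add: m_assoc)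
    also have "\<dots> = a \<otimes> ((c \<otimes> a) \<otimes> ((m \<otimes> c) \<otimes> m))" using c by (simp add: m_assoc flip: am)
    also have "\<dots> = a \<otimes> a \<otimes> (c \<otimes> c) \<otimes> (m \<otimes> m)" using c by (simp add: m_assoc flip: ac cm)
    finally show ?thesis .
  qed
  finally have "a \<otimes> a \<otimes> \<one> = a \<otimes> a \<otimes> (c \<otimes> c)" using c m by simp
  then show ?thesis using c left_cancel[of "a \<otimes> a" \<one> "c \<otimes> c"] by simp
qed

end

text \<open>
  An abstract quotient map. Working with it instead of cosets keeps calculations modulo a normal subgroup
  in the language of groups.
\<close>

locale quotient_hom = group_hom G Q q
  for G :: "('a, 'b) monoid_scheme" (structure) and Q :: "('c, 'd) monoid_scheme" and q +
  fixes M :: "'a set"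
  assumes ker: "x \<in> carrier G \<Longrightarrow> q x = \<one>\<^bsub>Q\<^esub> \<longleftrightarrow> x \<in> M"
begin

lemma image_gc:
  "x \<in> carrier G \<Longrightarrow> y \<in> carrier G \<Longrightarrow> q (G.gc x y) = H.gc (q x) (q y)"
  by (simp add: group_commutator_def)

lemma gc_mem_iff:
  assumes "x \<in> carrier G" "y \<in> carrier G"
  shows "G.gc x y \<in> M \<longleftrightarrow> q x \<otimes>\<^bsub>Q\<^esub> q y = q y \<otimes>\<^bsub>Q\<^esub> q x"
  using ker[of "G.gc x y"] image_gc[OF assms] H.gc_eq_one_iff assms by auto

lemma image_eq_iff:
  assumes "x \<in> carrier G" "y \<in> carrier G"
  shows "q x = q y \<longleftrightarrow> inv x \<otimes> y \<in> M"
proof -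
  have "inv x \<otimes> y \<in> M \<longleftrightarrow> inv\<^bsub>Q\<^esub> q x \<otimes>\<^bsub>Q\<^esub> q y = \<one>\<^bsub>Q\<^esub>"
    using ker[of "inv x \<otimes> y"] assms by simp
  also have "\<dots> \<longleftrightarrow> inv\<^bsub>Q\<^esub> q x \<otimes>\<^bsub>Q\<^esub> q y = inv\<^bsub>Q\<^esub> q x \<otimes>\<^bsub>Q\<^esub> q x" using assms by simp
  also have "\<dots> \<longleftrightarrow> q x = q y" using assms by (subst H.left_cancel) auto
  finally show ?thesis by simp
qed

end

context normal
begin

lemma quotient_hom_exists:
  obtains Q :: "'a set monoid" and q where "quotient_hom G Q q H"
proof
  show "quotient_hom G (G Mod H) (\<lambda>x. H #> x) H"
  proof (intro quotient_hom.intro quotient_hom_axioms.intro)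
    show "group_hom G (G Mod H) (\<lambda>x. H #> x)"
      unfolding group_hom_def group_hom_axioms_def
      using factorgroup_is_group r_coset_hom_Mod is_group by auto
    show "H #> x = \<one>\<^bsub>G Mod H\<^esub> \<longleftrightarrow> x \<in> H" if "x \<in> carrier G" for x
      using coset_join1[of H x] coset_join2[of x H] that is_subgroup subset by (auto simp: FactGroup_def)
  qed
qed

lemma gc_mem_swap:
  assumes "x \<in> carrier G" "y \<in> carrier G" "gc x y \<in> H" shows "gc y x \<in> H"
  unfolding gc_swap[OF assms(1,2)] using assms(3) by simp

lemma gc_mem_left:
  assumes x: "x \<in> H" and y: "y \<in> carrier G" shows "gc x y \<in> H"
proof -
  obtain Q :: "'a set monoid" and q where "quotient_hom G Q q H" by (rule quotient_hom_exists)
  then interpret q: quotient_hom G Q q H .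
  show ?thesis using x y q.ker[of x] by (simp add: q.gc_mem_iff mem_carrier)
qed

lemma commuting_mod_subgroup:
  assumes S: "S \<subseteq> carrier G"
  shows "subgroup {c \<in> carrier G. \<forall>g\<in>S. gc c g \<in> H} G"
proof -
  obtain Q :: "'a set monoid" and q where "quotient_hom G Q q H" by (rule quotient_hom_exists)
  then interpret q: quotient_hom G Q q H .
  let ?C = "{k \<in> carrier Q. \<forall>g\<in>q ` S. k \<otimes>\<^bsub>Q\<^esub> g = g \<otimes>\<^bsub>Q\<^esub> k}"
  have "{c \<in> carrier G. \<forall>g\<in>S. gc c g \<in> H} = {c \<in> carrier G. q c \<in> ?C}"
    using S by (auto simp: q.gc_mem_iff subsetD)
  moreover have C: "subgroup ?C Q" by (rule q.H.commuting_set_subgroup) (use S in auto)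
  have "subgroup {c \<in> carrier G. q c \<in> ?C} G"
  proof
    fix x y assume "x \<in> {c \<in> carrier G. q c \<in> ?C}" "y \<in> {c \<in> carrier G. q c \<in> ?C}"
    then show "x \<otimes> y \<in> {c \<in> carrier G. q c \<in> ?C}" using subgroup.m_closed[OF C, of "q x" "q y"] by simp
  next
    fix x assume "x \<in> {c \<in> carrier G. q c \<in> ?C}"
    then show "inv x \<in> {c \<in> carrier G. q c \<in> ?C}" using subgroup.m_inv_closed[OF C, of "q x"] by simp
  qed (use subgroup.one_closed[OF C] in auto)
  ultimately show ?thesis by simp
qed

lemma centralizer_mod_subgroup: "subgroup (centralizer_mod H) G"
  unfolding centralizer_mod_def by (rule commuting_mod_subgroup) simp

lemma subset_centralizer_mod: "H \<subseteq> centralizer_mod H"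
  using gc_mem_left subset by (auto simp: centralizer_mod_def)

lemma adjoin_subgroup:
  assumes cG: "c \<in> carrier G" and k: "c [^] (k::nat) \<in> H" "k > 0"
  shows "subgroup (adjoin c H) G" "H \<subseteq> adjoin c H" "c \<in> adjoin c H"
proof -
  obtain Q :: "'a set monoid" and q where "quotient_hom G Q q H" by (rule quotient_hom_exists)
  then interpret q: quotient_hom G Q q H .
  have C: "q c \<in> carrier Q" using cG by simp
  have mem: "x \<in> adjoin c H \<longleftrightarrow> x \<in> carrier G \<and> (\<exists>i::nat. q x = q c [^]\<^bsub>Q\<^esub> i)" for x
  proof -
    have "q x = q c [^]\<^bsub>Q\<^esub> i \<longleftrightarrow> (\<exists>m\<in>H. x = c [^] i \<otimes> m)" if "x \<in> carrier G" for i :: nat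
    proof -
      have "q x = q c [^]\<^bsub>Q\<^esub> i \<longleftrightarrow> q (c [^] i) = q x" using cG by (auto simp: q.hom_nat_pow)
      also have "\<dots> \<longleftrightarrow> inv (c [^] i) \<otimes> x \<in> H" using q.image_eq_iff cG that by simp
      also have "\<dots> \<longleftrightarrow> (\<exists>m\<in>H. x = c [^] i \<otimes> m)"
      proof
        assume "inv (c [^] i) \<otimes> x \<in> H"
        then show "\<exists>m\<in>H. x = c [^] i \<otimes> m"
          using cG that by (intro bexI[of _ "inv (c [^] i) \<otimes> x"]) (auto simp: mult_inv_cancel)
      next
        assume "\<exists>m\<in>H. x = c [^] i \<otimes> m"
        then show "inv (c [^] i) \<otimes> x \<in> H" using cG by (auto simp: mult_inv_cancel mem_carrier)
      qed
      finally show ?thesis .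
    qed
    moreover have "x \<in> adjoin c H \<longleftrightarrow> x \<in> carrier G \<and> (\<exists>i::nat. \<exists>m\<in>H. x = c [^] i \<otimes> m)"
      using cG by (auto simp: adjoin_def mem_carrier)
    ultimately show ?thesis by blast
  qed
  have Ck: "q c [^]\<^bsub>Q\<^esub> k = \<one>\<^bsub>Q\<^esub>"
    using q.ker[of "c [^] k"] k cG by (simp add: q.hom_nat_pow)
  show "H \<subseteq> adjoin c H"
  proof
    fix t assume t: "t \<in> H"
    then have "t \<in> carrier G" "q t = q c [^]\<^bsub>Q\<^esub> (0::nat)" using q.ker[of t] by (auto simp: mem_carrier)
    then show "t \<in> adjoin c H" unfolding mem by blast
  qed
  show "c \<in> adjoin c H" unfolding mem using cG by (auto intro!: exI[of _ "Suc 0"])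
  show "subgroup (adjoin c H) G"
  proof
    show "adjoin c H \<subseteq> carrier G" using mem by auto
    show "\<one> \<in> adjoin c H" unfolding mem by (auto intro!: exI[of _ "0::nat"])
    fix x assume "x \<in> adjoin c H"
    then obtain i :: nat where x: "x \<in> carrier G" "q x = q c [^]\<^bsub>Q\<^esub> i" unfolding mem by auto
    { fix y assume "y \<in> adjoin c H"
      then obtain j :: nat where y: "y \<in> carrier G" "q y = q c [^]\<^bsub>Q\<^esub> j" unfolding mem by auto
      show "x \<otimes> y \<in> adjoin c H"
        unfolding mem using x y C by (auto simp: q.H.nat_pow_mult intro!: exI[of _ "i + j"]) }
    have "(k - 1) * i + i = k * i" using k(2) by (cases k) auto
    then have "q c [^]\<^bsub>Q\<^esub> ((k - 1) * i) \<otimes>\<^bsub>Q\<^esub> q c [^]\<^bsub>Q\<^esub> i = q c [^]\<^bsub>Q\<^esub> (k * i)"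
      using C by (simp add: q.H.nat_pow_mult)
    also have "\<dots> = \<one>\<^bsub>Q\<^esub>" using C Ck by (simp flip: q.H.nat_pow_pow)
    finally have "inv\<^bsub>Q\<^esub> (q x) = q c [^]\<^bsub>Q\<^esub> ((k - 1) * i)"
      unfolding x(2) using C by (intro q.H.inv_equality) auto
    then show "inv x \<in> adjoin c H" unfolding mem using x(1) by auto
  qed
qed

lemma adjoin_normalI:
  assumes cG: "c \<in> carrier G" and k: "c [^] (k::nat) \<in> H" "k > 0"
    and conj: "\<And>g. g \<in> carrier G \<Longrightarrow> g \<otimes> c \<otimes> inv g \<in> adjoin c H"
  shows "adjoin c H \<lhd> G"
proof (rule normal_invI[OF adjoin_subgroup(1)[OF cG k]])
  note A = adjoin_subgroup[OF cG k]
  fix g x assume g: "g \<in> carrier G" and "x \<in> adjoin c H"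
  then obtain i :: nat and t where x: "t \<in> H" "x = c [^] i \<otimes> t" by (auto simp: adjoin_def)
  have "g \<otimes> c [^] i \<otimes> inv g = (g \<otimes> c \<otimes> inv g) [^] i" by (rule conj_pow_nat[OF cG g])
  then have "g \<otimes> c [^] i \<otimes> inv g \<in> adjoin c H"
    using subgroup_nat_pow_closed[OF A(1) conj[OF g]] by simp
  moreover have "g \<otimes> t \<otimes> inv g \<in> adjoin c H"
    using inv_op_closed2[OF g x(1)] A(2) by blast
  moreover have "g \<otimes> x \<otimes> inv g = (g \<otimes> c [^] i \<otimes> inv g) \<otimes> (g \<otimes> t \<otimes> inv g)"
    using x g cG by (simp add: m_assoc mult_inv_cancel mem_carrier)
  ultimately show "g \<otimes> x \<otimes> inv g \<in> adjoin c H" using subgroup.m_closed[OF A(1)] by simp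
qed

lemma adjoin_normal:
  assumes c: "c \<in> centralizer_mod H" and k: "c [^] (k::nat) \<in> H" "k > 0"
  shows "adjoin c H \<lhd> G"
proof (rule adjoin_normalI[OF _ k])
  show cG: "c \<in> carrier G" using c by (simp add: centralizer_mod_def)
  fix g assume g: "g \<in> carrier G"
  have "g \<otimes> c \<otimes> inv g = c [^] Suc 0 \<otimes> gc c (inv g)"
    using conj_eq_mult_gc[OF cG inv_closed[OF g]] cG g by simp
  moreover have "gc c (inv g) \<in> H" using c g by (simp add: centralizer_mod_def)
  ultimately show "g \<otimes> c \<otimes> inv g \<in> adjoin c H" unfolding adjoin_def by blast
qed

lemma adjoin_subset:
  assumes "subgroup L G" "c \<in> L" "H \<subseteq> L" shows "adjoin c H \<subseteq> L"
  using assms by (auto simp: adjoin_def intro!: subgroup.m_closed[OF assms(1)] subgroup_nat_pow_closed[OF assms(1)])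

lemma adjoin_card:
  assumes c: "c \<in> carrier G" "c \<notin> H" "c [^] (p::nat) \<in> H" "prime p" and L: "adjoin c H \<subseteq> L" "finite L"
  shows "p * card H \<le> card L"
proof -
  have key: "i = j" if "c [^] i \<otimes> m = c [^] j \<otimes> m'" "m \<in> H" "m' \<in> H" "i \<le> j" "j < p" for i j :: nat and m m'
  proof (rule ccontr)
    assume "i \<noteq> j"
    then have nd: "\<not> p dvd (j - i)" using that by (auto dest: dvd_imp_le)
    have mG: "m \<in> carrier G" "m' \<in> carrier G" using that subset by auto
    have "c [^] j = c [^] i \<otimes> c [^] (j - i)" using c that by (simp add: nat_pow_mult)
    with that(1) have "c [^] i \<otimes> m = c [^] i \<otimes> (c [^] (j - i) \<otimes> m')"
      using c mG by (simp add: m_assoc)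
    then have "m = c [^] (j - i) \<otimes> m'" using c mG by (subst (asm) left_cancel) auto
    then have "c [^] (j - i) = m \<otimes> inv m'" using c mG by (simp add: inv_solve_right)
    then have "c [^] (j - i) \<in> H" using that by simp
    then show False using pow_prime_mem[OF is_subgroup c(1) _ c(3,4) nd] c(2) by blast
  qed
  have "inj_on (\<lambda>(i, m). c [^] i \<otimes> m) ({..<p} \<times> H)"
  proof (rule inj_onI, clarify)
    fix i m j m' assume *: "c [^] i \<otimes> m = c [^] j \<otimes> m'" "i < p" "j < p" "m \<in> H" "m' \<in> H"
    have "i = j" using key[of i m j m'] key[of j m' i m] * by (cases "i \<le> j") auto
    then show "i = j \<and> m = m'" using * c by (auto simp: mem_carrier)
  qed
  then have "card ({..<p} \<times> H) = card ((\<lambda>(i, m). c [^] i \<otimes> m) ` ({..<p} \<times> H))" by (rule card_image[symmetric])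
  also have "\<dots> \<le> card L" by (rule card_mono[OF L(2)]) (use L(1) in \<open>auto simp: adjoin_def\<close>)
  finally show ?thesis by (simp add: card_cartesian_product)
qed

lemma inversion_parity:
  assumes c: "c \<in> carrier G"
    and inv: "\<And>g. g \<in> carrier G \<Longrightarrow> gc c g \<in> H \<or> gc c g \<otimes> (c \<otimes> c) \<in> H"
    and g: "g \<in> carrier G" "gc c g \<notin> H" and h: "h \<in> carrier G" "gc c h \<notin> H"
  shows "gc c (g \<otimes> h) \<in> H"
proof -
  obtain Q :: "'a set monoid" and q where "quotient_hom G Q q H" by (rule quotient_hom_exists)
  then interpret q: quotient_hom G Q q H .
  have i: "q.H.gc (q c) (q g) \<otimes>\<^bsub>Q\<^esub> (q c \<otimes>\<^bsub>Q\<^esub> q c) = \<one>\<^bsub>Q\<^esub>" if g: "g \<in> carrier G" "gc c g \<notin> H" for g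
    using q.ker[of "gc c g \<otimes> (c \<otimes> c)"] inv[OF g(1)] g c q.image_gc[OF c g(1)] by auto
  have "q.H.gc (q c) (q g \<otimes>\<^bsub>Q\<^esub> q h) = \<one>\<^bsub>Q\<^esub>"
    by (rule q.H.inverted_twice) (use c g h i in auto)
  then show ?thesis
    using q.ker[of "gc c (g \<otimes> h)"] q.image_gc[of c "g \<otimes> h"] g h c by simp
qed

text \<open>
  If every element of \<open>G\<close> fixes or inverts \<open>c\<close> modulo \<open>H\<close>, then \<open>G\<close> acts through a group of order at most
  \<open>2\<close>, and commutators act trivially.
\<close>

lemma derived_centralizes_inverted:
  assumes c: "c \<in> carrier G"
    and inv: "\<And>g. g \<in> carrier G \<Longrightarrow> gc c g \<in> H \<or> gc c g \<otimes> (c \<otimes> c) \<in> H"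
    and g: "g \<in> derived G (carrier G)"
  shows "gc c g \<in> H"
proof -
  define X where "X = {g \<in> carrier G. \<forall>x\<in>{c}. gc g x \<in> H}"
  have X: "subgroup X G" unfolding X_def by (rule commuting_mod_subgroup) (use c in auto)
  have X_iff: "g \<in> X \<longleftrightarrow> g \<in> carrier G \<and> gc c g \<in> H" for g
    using gc_mem_swap c by (auto simp: X_def)
  have par: "x \<otimes> y \<in> X" if "x \<in> carrier G" "y \<in> carrier G" "x \<notin> X" "y \<notin> X" for x y
    using inversion_parity[OF c inv] that by (auto simp: X_iff)
  have Xinv: "inv x \<in> X \<longleftrightarrow> x \<in> X" if "x \<in> carrier G" for x
    using subgroup.m_inv_closed[OF X] that by (metis inv_inv)
  have Xl: "x \<otimes> y \<in> X \<longleftrightarrow> (x \<in> X \<longleftrightarrow> y \<in> X)" if "x \<in> carrier G" "y \<in> carrier G" for x y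
  proof -
    have "y \<in> X" if "x \<in> X" "x \<otimes> y \<in> X"
    proof -
      have "inv x \<otimes> (x \<otimes> y) \<in> X" using that X by (simp add: subgroup.m_closed subgroup.m_inv_closed)
      then show ?thesis using \<open>x \<in> carrier G\<close> \<open>y \<in> carrier G\<close> by (simp add: m_assoc[symmetric])
    qed
    moreover have "x \<in> X" if "y \<in> X" "x \<otimes> y \<in> X"
    proof -
      have "(x \<otimes> y) \<otimes> inv y \<in> X" using that X by (simp add: subgroup.m_closed subgroup.m_inv_closed)
      then show ?thesis using \<open>x \<in> carrier G\<close> \<open>y \<in> carrier G\<close> by (simp add: m_assoc)
    qed
    ultimately show ?thesis using par[OF that] subgroup.m_closed[OF X] by blast
  qed
  have "derived G (carrier G) \<subseteq> X"
    by (rule derived_minimal[OF X]) (auto simp: group_commutator_def Xl Xinv)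
  then show ?thesis using g X_iff by blast
qed

end

context group
begin

text \<open>
  Modulo \<open>M\<close> the element \<open>c\<close> is central with \<open>c\<^sup>p = 1\<close>, so \<open>(a\<^sup>i c\<^sup>j)\<^sup>p = (a\<^sup>p)\<^sup>i\<close>.
\<close>

lemma pow_product_central_mod:
  assumes "normal M G" and c: "c \<in> centralizer_mod M" and a: "a \<in> carrier G" and p: "c [^] (p::nat) \<in> M" and m: "m \<in> M"
  shows "(a [^] (i::nat) \<otimes> (c [^] (j::nat) \<otimes> m)) [^] p \<in> adjoin (a [^] p) M"
proof -
  interpret M: normal M G by fact
  obtain Q :: "'a set monoid" and q where "quotient_hom G Q q M" by (rule M.quotient_hom_exists)
  then interpret q: quotient_hom G Q q M .
  have cG: "c \<in> carrier G" and mG: "m \<in> carrier G" using c m by (auto simp: centralizer_mod_def M.mem_carrier)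
  let ?x = "(a [^] i \<otimes> (c [^] j \<otimes> m)) [^] p"
  have xG: "?x \<in> carrier G" using a cG mG by simp
  have "q ?x = (q a [^]\<^bsub>Q\<^esub> i \<otimes>\<^bsub>Q\<^esub> q c [^]\<^bsub>Q\<^esub> j) [^]\<^bsub>Q\<^esub> p"
    using a cG mG m q.ker[OF mG] by (simp add: q.hom_nat_pow)
  also have "\<dots> = (q a [^]\<^bsub>Q\<^esub> p) [^]\<^bsub>Q\<^esub> i"
  proof (rule q.H.commuting_product_pow)
    show "q a \<otimes>\<^bsub>Q\<^esub> q c = q c \<otimes>\<^bsub>Q\<^esub> q a"
      using c a cG q.gc_mem_iff[of c a] by (auto simp: centralizer_mod_def)
    show "q c [^]\<^bsub>Q\<^esub> p = \<one>\<^bsub>Q\<^esub>" using q.ker[of "c [^] p"] p cG by (simp add: q.hom_nat_pow)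
  qed (use a cG in auto)
  finally have "q ((a [^] p) [^] i) = q ?x" using a by (simp add: q.hom_nat_pow)
  then have y: "inv ((a [^] p) [^] i) \<otimes> ?x \<in> M" using q.image_eq_iff[of "(a [^] p) [^] i" ?x] a xG by simp
  have "?x = (a [^] p) [^] i \<otimes> (inv ((a [^] p) [^] i) \<otimes> ?x)" using a xG by (simp add: mult_inv_cancel)
  then show ?thesis unfolding adjoin_def using y by blast
qed

lemma index_two_product:
  assumes "normal M G" and z: "z \<in> carrier G" "z [^] (2::nat) \<in> M"
    and u: "u \<in> adjoin z M" "u \<notin> M" and v: "v \<in> adjoin z M" "v \<notin> M"
  shows "u \<otimes> v \<in> M"
proof -
  interpret M: normal M G by fact
  obtain Q :: "'a set monoid" and q where "quotient_hom G Q q M" by (rule M.quotient_hom_exists)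
  then interpret q: quotient_hom G Q q M .
  have Z: "q z \<in> carrier Q" using z by simp
  have zz: "q z [^]\<^bsub>Q\<^esub> (2::nat) = \<one>\<^bsub>Q\<^esub>" using q.ker[of "z [^] (2::nat)"] z by (simp add: q.hom_nat_pow)
  have *: "w \<in> carrier G \<and> q w = q z" if w: "w \<in> adjoin z M" "w \<notin> M" for w
  proof -
    obtain i :: nat and m where m: "m \<in> M" "w = z [^] i \<otimes> m" using w(1) by (auto simp: adjoin_def)
    have mG: "m \<in> carrier G" using m by (simp add: M.mem_carrier)
    have wG: "w \<in> carrier G" using m z mG by simp
    have qw: "q w = q z [^]\<^bsub>Q\<^esub> i" using m mG z q.ker[OF mG] by (simp add: q.hom_nat_pow)
    have even: "q z [^]\<^bsub>Q\<^esub> (2 * k) = \<one>\<^bsub>Q\<^esub>" for k :: nat using zz Z by (simp flip: q.H.nat_pow_pow)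
    have "odd i"
    proof
      assume "even i"
      then have "q w = \<one>\<^bsub>Q\<^esub>" using qw even by (auto elim: evenE)
      then show False using q.ker[OF wG] w(2) by simp
    qed
    then obtain k where "i = Suc (2 * k)" by (auto elim: oddE)
    then show ?thesis using qw even Z wG by simp
  qed
  have "q (u \<otimes> v) = q z [^]\<^bsub>Q\<^esub> (2::nat)" using *[OF u] *[OF v] Z by (simp add: numeral_2_eq_2)
  then show ?thesis using zz q.ker[of "u \<otimes> v"] *[OF u] *[OF v] by simp
qed

end

section \<open>Group elements in the group algebra\<close>

context group_ring
begin

abbreviation delta :: "'g \<Rightarrow> 'g \<Rightarrow> 'k" ("\<delta>") where
  "\<delta> g \<equiv> monomial \<one>\<^bsub>K\<^esub> g"

abbreviation delta_minus_one :: "'g \<Rightarrow> 'g \<Rightarrow> 'k" ("\<Delta>") where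
  "\<Delta> g \<equiv> \<delta> g \<ominus>\<^bsub>R\<^esub> \<one>\<^bsub>R\<^esub>"

abbreviation R_mult :: "('g \<Rightarrow> 'k) \<Rightarrow> ('g \<Rightarrow> 'k) \<Rightarrow> 'g \<Rightarrow> 'k" (infixl "\<odot>" 70) where
  "a \<odot> b \<equiv> a \<otimes>\<^bsub>R\<^esub> b"

abbreviation scalar :: "'k \<Rightarrow> 'g \<Rightarrow> 'k" where
  "scalar k \<equiv> monomial k \<one>"

lemma delta_closed [simp, intro]: "g \<in> carrier G \<Longrightarrow> \<delta> g \<in> carrier R"
  by (simp add: monomial_closed)

lemma delta_one: "\<delta> \<one> = \<one>\<^bsub>R\<^esub>"
  by (simp add: R_simps)

lemma delta_mult: "g \<in> carrier G \<Longrightarrow> h \<in> carrier G \<Longrightarrow> \<delta> g \<odot> \<delta> h = \<delta> (g \<otimes> h)"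
  by (simp add: monomial_mult_monomial)

lemma delta_inv:
  "g \<in> carrier G \<Longrightarrow> \<delta> (inv g) \<odot> \<delta> g = \<one>\<^bsub>R\<^esub>" "g \<in> carrier G \<Longrightarrow> \<delta> g \<odot> \<delta> (inv g) = \<one>\<^bsub>R\<^esub>"
  by (simp_all add: delta_mult flip: delta_one)

lemma delta_inj: "\<delta> g = \<delta> h \<Longrightarrow> g = h"
  using K.one_not_zero unfolding monomial_def by metis

lemma delta_pow: "g \<in> carrier G \<Longrightarrow> \<delta> g [^]\<^bsub>R\<^esub> (n::nat) = \<delta> (g [^] n)"
  by (induction n) (simp_all add: delta_one delta_mult)

lemma monomial_eq: "k \<in> carrier K \<Longrightarrow> g \<in> carrier G \<Longrightarrow> monomial k g = scalar k \<odot> \<delta> g"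
  by (simp add: monomial_mult_monomial)

lemma scalar_commute:
  assumes "a \<in> carrier R" "k \<in> carrier K"
  shows "scalar k \<odot> a = a \<odot> scalar k"
  using assms(1)
proof (induction a rule: R_induct)
  case zero
  show ?case using assms(2) monomial_closed by simp
next
  case (monomial l g)
  then show ?case using assms(2) by (simp add: monomial_mult_monomial K.m_comm)
next
  case (add a b)
  then show ?case using assms(2) monomial_closed by (simp add: R.r_distr R.l_distr)
qed

lemma central_mod_deltaI:
  assumes u: "u \<in> carrier R" and I: "ideal I R" and c: "\<And>g. g \<in> carrier G \<Longrightarrow> lie_bracket R u (\<delta> g) \<in> I"
  shows "R.central_mod u I"
proof (rule R.central_modI[OF u])
  fix r assume "r \<in> carrier R"
  then show "lie_bracket R u r \<in> I"
  proof (induction r rule: R_induct)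
    case zero
    then show ?case using u R.ideal_zero[OF I] by simp
  next
    case (monomial k g)
    have s: "scalar k \<in> carrier R" using monomial monomial_closed by simp
    have 0: "lie_bracket R u (scalar k) = \<zero>\<^bsub>R\<^esub>"
      using R.bracket_eq_zero_iff[OF u s] scalar_commute[OF u] monomial by simp
    have "lie_bracket R u (scalar k \<odot> \<delta> g)
        = lie_bracket R u (scalar k) \<odot> \<delta> g \<oplus>\<^bsub>R\<^esub> scalar k \<odot> lie_bracket R u (\<delta> g)"
      using u s monomial by (intro R.bracket_mult_right) auto
    also have "\<dots> = scalar k \<odot> lie_bracket R u (\<delta> g)" unfolding 0 using u s monomial by simp
    also have "\<dots> \<in> I" using R.ideal_l[OF I c s] monomial by simp
    finally show ?case unfolding monomial_eq[OF monomial] .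
  next
    case (add a b)
    then show ?case using u by (simp add: R.bracket_add_right R.ideal_add[OF I])
  qed
qed

lemma V1_subsetI:
  assumes I: "ideal I R"
    and c: "\<And>g h. g \<in> carrier G \<Longrightarrow> h \<in> carrier G \<Longrightarrow> lie_bracket R (\<delta> g) (\<delta> h) \<in> I"
  shows "R.V 1 \<subseteq> I"
proof -
  have "R.V (Suc 0) \<subseteq> I"
  proof (rule R.V_Suc_subsetI[OF I])
    fix v r assume "v \<in> R.V 0" and r: "r \<in> carrier R"
    then have v: "v \<in> carrier R" by simp
    have "lie_bracket R v (\<delta> g) \<in> I" if g: "g \<in> carrier G" for g
    proof -
      have "lie_bracket R (\<delta> g) v \<in> I"
        using central_mod_deltaI[OF delta_closed[OF g] I] c g v R.central_modD by blast
      then show ?thesis using R.bracket_swap[of "\<delta> g" v] g v R.ideal_uminus[OF I] by simp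
    qed
    from central_mod_deltaI[OF v I this] show "lie_bracket R v r \<in> I" using r R.central_modD by blast
  qed
  then show ?thesis by simp
qed

lemma bracket_delta:
  assumes g: "g \<in> carrier G" and h: "h \<in> carrier G"
  shows "lie_bracket R (\<delta> g) (\<delta> h) = \<delta> (h \<otimes> g) \<odot> \<Delta> (gc g h)"
  using g h
  by (simp add: lie_bracket_def R.minus_eq R.r_distr R.r_minus delta_mult mult_gc)

lemma delta_gc:
  assumes g: "g \<in> carrier G" and h: "h \<in> carrier G"
  shows "\<Delta> (gc g h) = \<delta> (inv g) \<odot> \<delta> (inv h) \<odot> lie_bracket R (\<delta> g) (\<delta> h)"
proof -
  have "\<delta> (inv g) \<odot> \<delta> (inv h) \<odot> lie_bracket R (\<delta> g) (\<delta> h)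
     = (\<delta> (inv g \<otimes> inv h) \<odot> \<delta> (h \<otimes> g)) \<odot> \<Delta> (gc g h)"
    unfolding bracket_delta[OF g h] delta_mult[OF inv_closed[OF g] inv_closed[OF h]]
    by (rule R.m_assoc[symmetric]) (use g h in auto)
  also have "\<delta> (inv g \<otimes> inv h) \<odot> \<delta> (h \<otimes> g) = \<one>\<^bsub>R\<^esub>"
    using g h by (simp add: delta_mult m_assoc mult_inv_cancel delta_one)
  finally show ?thesis using g h by simp
qed

text \<open>The Lie dimension subgroups are the case where \<open>J\<close> is a lower Lie power.\<close>

definition dim_subgroup :: "('g \<Rightarrow> 'k) set \<Rightarrow> 'g set" where
  "dim_subgroup J = {g \<in> carrier G. \<Delta> g \<in> J}"

lemma delta_diff_mult:
  assumes "g \<in> carrier G" "h \<in> carrier G"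
  shows "\<Delta> (g \<otimes> h) = \<delta> g \<odot> \<Delta> h \<oplus>\<^bsub>R\<^esub> \<Delta> g"
proof -
  have "\<delta> g \<odot> \<Delta> h \<oplus>\<^bsub>R\<^esub> \<Delta> g = \<delta> g \<odot> \<delta> h \<ominus>\<^bsub>R\<^esub> \<one>\<^bsub>R\<^esub>"
    using assms by (simp add: R.minus_eq R.r_distr R.r_minus R.a_assoc R.r_neg1)
  then show ?thesis using assms by (simp add: delta_mult)
qed

lemma dim_subgroup_normal:
  assumes J: "ideal J R" shows "dim_subgroup J \<lhd> G"
proof (rule normal_invI)
  show "subgroup (dim_subgroup J) G"
  proof
    show "\<one> \<in> dim_subgroup J"
      using R.ideal_zero[OF J] by (simp add: dim_subgroup_def delta_one R.minus_eq R.r_neg)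
    fix x assume x: "x \<in> dim_subgroup J"
    then have xG: "x \<in> carrier G" and xJ: "\<Delta> x \<in> J" by (auto simp: dim_subgroup_def)
    { fix y assume y: "y \<in> dim_subgroup J"
      show "x \<otimes> y \<in> dim_subgroup J"
        using x y by (auto simp: dim_subgroup_def delta_diff_mult intro!: R.ideal_add[OF J] R.ideal_l[OF J]) }
    have "\<delta> (inv x) \<odot> \<Delta> x = \<one>\<^bsub>R\<^esub> \<ominus>\<^bsub>R\<^esub> \<delta> (inv x)"
      using xG by (simp add: R.minus_eq R.r_distr R.r_minus delta_inv)
    then have "\<Delta> (inv x) = \<ominus>\<^bsub>R\<^esub> (\<delta> (inv x) \<odot> \<Delta> x)"
      using xG by (simp add: R.minus_eq R.minus_add R.a_comm)
    also have "\<dots> \<in> J" using R.ideal_uminus[OF J R.ideal_l[OF J xJ]] xG by simp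
    finally show "inv x \<in> dim_subgroup J" using xG by (simp add: dim_subgroup_def)
  qed (auto simp: dim_subgroup_def)
  fix x h assume x: "x \<in> carrier G" and "h \<in> dim_subgroup J"
  then have h: "h \<in> carrier G" "\<Delta> h \<in> J" by (auto simp: dim_subgroup_def)
  have "\<delta> x \<odot> \<Delta> h \<odot> \<delta> (inv x) = \<Delta> (x \<otimes> h \<otimes> inv x)"
    using x h by (simp add: R.minus_eq R.r_distr R.l_distr R.r_minus R.l_minus delta_mult delta_one)
  moreover have "\<delta> x \<odot> \<Delta> h \<odot> \<delta> (inv x) \<in> J"
    using x h by (intro R.ideal_l[OF J] R.ideal_r[OF J]) auto
  ultimately show "x \<otimes> h \<otimes> inv x \<in> dim_subgroup J" using x h by (simp add: dim_subgroup_def)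
qed

lemma gc_dim_subgroup_iff:
  assumes J: "ideal J R" and g: "g \<in> carrier G" and h: "h \<in> carrier G"
  shows "gc g h \<in> dim_subgroup J \<longleftrightarrow> lie_bracket R (\<delta> g) (\<delta> h) \<in> J"
proof
  assume "gc g h \<in> dim_subgroup J"
  then show "lie_bracket R (\<delta> g) (\<delta> h) \<in> J"
    unfolding bracket_delta[OF g h] using g h by (intro R.ideal_l[OF J]) (auto simp: dim_subgroup_def)
next
  assume "lie_bracket R (\<delta> g) (\<delta> h) \<in> J"
  then show "gc g h \<in> dim_subgroup J"
    unfolding dim_subgroup_def mem_Collect_eq delta_gc[OF g h] using g h by (intro conjI R.ideal_l[OF J]) auto
qed

lemma gc_gc_dim_subgroup_iff:
  assumes J: "ideal J R" and c: "g \<in> carrier G" "h \<in> carrier G" "k \<in> carrier G"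
  shows "gc (gc g h) k \<in> dim_subgroup J \<longleftrightarrow>
    lie_bracket R (\<delta> (inv g) \<odot> \<delta> (inv h) \<odot> lie_bracket R (\<delta> g) (\<delta> h)) (\<delta> k) \<in> J"
  using gc_dim_subgroup_iff[OF J gc_closed[OF c(1,2)] c(3)] R.bracket_minus_one[of "\<delta> (gc g h)" "\<delta> k"] c
  unfolding delta_gc[OF c(1,2)] by simp

text \<open>
  For a normal subgroup \<open>H\<close> this ideal is the kernel of \<open>K G \<rightarrow> K (G / H)\<close>, so membership in it replaces
  calculations in the group algebra of the quotient.
\<close>

definition aug :: "'g set \<Rightarrow> ('g \<Rightarrow> 'k) set" where
  "aug H = Idl\<^bsub>R\<^esub> ((\<lambda>h. \<Delta> h) ` H)"

lemma aug_ideal: "H \<subseteq> carrier G \<Longrightarrow> ideal (aug H) R"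
  unfolding aug_def by (rule R.genideal_ideal) auto

lemma aug_mem: "H \<subseteq> carrier G \<Longrightarrow> h \<in> H \<Longrightarrow> \<Delta> h \<in> aug H"
  unfolding aug_def using R.genideal_self[of "(\<lambda>h. \<Delta> h) ` H"] by auto

lemma aug_subsetI: "ideal J R \<Longrightarrow> (\<And>h. h \<in> H \<Longrightarrow> \<Delta> h \<in> J) \<Longrightarrow> aug H \<subseteq> J"
  unfolding aug_def by (rule R.genideal_minimal) auto

lemma aug_one: "aug {\<one>} = {\<zero>\<^bsub>R\<^esub>}"
  by (simp add: aug_def delta_one R.minus_eq R.r_neg R.genideal_zero)

lemma gc_aug:
  assumes "H \<subseteq> carrier G" "g \<in> carrier G" "h \<in> carrier G" "gc g h \<in> H"
  shows "lie_bracket R (\<delta> g) (\<delta> h) \<in> aug H"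
  using gc_dim_subgroup_iff[OF aug_ideal[OF assms(1)] assms(2,3)] aug_mem[OF assms(1,4)] assms(2,3)
  by (simp add: dim_subgroup_def)

lemma V1_subset_aug_derived: "R.V 1 \<subseteq> aug (derived G (carrier G))"
  using derived_in_carrier by (intro V1_subsetI aug_ideal gc_aug gc_derived) auto

lemma aug_derived_subset_V1: "aug (derived G (carrier G)) \<subseteq> R.V 1"
proof (rule aug_subsetI[OF R.V_ideal])
  have "derived G (carrier G) \<subseteq> dim_subgroup (R.V 1)"
  proof (rule derived_minimal)
    show "subgroup (dim_subgroup (R.V 1)) G"
      using dim_subgroup_normal[OF R.V_ideal] by (rule normal_imp_subgroup)
    show "gc x y \<in> dim_subgroup (R.V 1)" if "x \<in> carrier G" "y \<in> carrier G" for x y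
      using that R.V_bracket[of "\<delta> x" 0 "\<delta> y"] by (subst gc_dim_subgroup_iff[OF R.V_ideal]) auto
  qed
  then show "\<Delta> h \<in> R.V 1" if "h \<in> derived G (carrier G)" for h
    using that by (auto simp: dim_subgroup_def)
qed

lemma central_mod_aug:
  assumes H: "H \<subseteq> carrier G" and c: "c \<in> centralizer_mod H"
  shows "R.central_mod (\<Delta> c) (aug H)"
proof (rule central_mod_deltaI[OF _ aug_ideal[OF H]])
  have cG: "c \<in> carrier G" using c by (simp add: centralizer_mod_def)
  then show "\<Delta> c \<in> carrier R" by simp
  fix g assume g: "g \<in> carrier G"
  have "lie_bracket R (\<Delta> c) (\<delta> g) = lie_bracket R (\<delta> c) (\<delta> g)"
    using g cG by (simp add: R.bracket_minus_one)
  then show "lie_bracket R (\<Delta> c) (\<delta> g) \<in> aug H"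
    using gc_aug[OF H cG g] c g by (auto simp: centralizer_mod_def)
qed

lemma aug_adjoin:
  assumes H: "H \<subseteq> carrier G" and c: "c \<in> centralizer_mod H"
  shows "aug (adjoin c H) \<subseteq> R.lin (\<Delta> c) (carrier R) (aug H)"
proof -
  let ?u = "\<Delta> c" and ?J = "R.lin (\<Delta> c) (carrier R) (aug H)"
  have cG: "c \<in> carrier G" using c by (simp add: centralizer_mod_def)
  then have u: "?u \<in> carrier R" by simp
  note A = aug_ideal[OF H]
  have J: "ideal ?J R" by (rule R.lin_ideal[OF u R.oneideal A central_mod_aug[OF H c]])
  have "?u \<in> ?J" using R.lin_mult[OF u R.one_closed R.oneideal A] u by simp
  then have "c \<in> dim_subgroup ?J" using cG by (simp add: dim_subgroup_def)
  moreover have "H \<subseteq> dim_subgroup ?J"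
    using R.lin_add[OF u aug_mem[OF H] R.oneideal A] H by (auto simp: dim_subgroup_def)
  moreover have S: "subgroup (dim_subgroup ?J) G" by (rule normal_imp_subgroup[OF dim_subgroup_normal[OF J]])
  ultimately have "adjoin c H \<subseteq> dim_subgroup ?J"
    by (auto simp: adjoin_def intro!: subgroup.m_closed[OF S] subgroup_nat_pow_closed[OF S])
  then show ?thesis by (intro aug_subsetI[OF J]) (auto simp: dim_subgroup_def)
qed

end

section \<open>Consequences of Lie nilpotency for the group\<close>

locale modular_group_ring = group_ring G K
  for G :: "('g, 'n) monoid_scheme" (structure) and K :: "('k, 'm) ring_scheme" +
  fixes p :: nat
  assumes prime: "prime p" and char: "[p] \<cdot>\<^bsub>K\<^esub> \<one>\<^bsub>K\<^esub> = \<zero>\<^bsub>K\<^esub>"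
begin

lemma R_char: "[p] \<cdot>\<^bsub>R\<^esub> \<one>\<^bsub>R\<^esub> = \<zero>\<^bsub>R\<^esub>"
proof -
  have "[n] \<cdot>\<^bsub>R\<^esub> \<one>\<^bsub>R\<^esub> = scalar ([n] \<cdot>\<^bsub>K\<^esub> \<one>\<^bsub>K\<^esub>)" for n :: nat
  proof (induction n)
    case 0
    then show ?case by (simp add: R_simps monomial_def)
  next
    case (Suc n)
    then show ?case by (auto simp: R_simps monomial_def fun_eq_iff)
  qed
  then show ?thesis using char by (auto simp: R_simps(4) monomial_def fun_eq_iff)
qed

lemma delta_minus_one_pow:
  "g \<in> carrier G \<Longrightarrow> (\<Delta> g) [^]\<^bsub>R\<^esub> (p ^ k) = \<Delta> (g [^] (p ^ k))"
  using R.minus_one_pow_prime_power[OF prime R_char, of "\<delta> g" k] by (simp add: delta_pow)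

lemma delta_minus_one_pow_p:
  "g \<in> carrier G \<Longrightarrow> (\<Delta> g) [^]\<^bsub>R\<^esub> p = \<Delta> (g [^] p)"
  using delta_minus_one_pow[of g 1] by simp

end

locale lie_nilpotent_group_ring = modular_group_ring G K p
  for G :: "('g, 'n) monoid_scheme" (structure) and K :: "('k, 'm) ring_scheme" and p +
  fixes m :: nat
  assumes m: "m \<ge> 1" and T_m: "R.T m = {\<zero>\<^bsub>R\<^esub>}"
begin

lemma derived_central_mod_T3: "derived G (carrier G) \<subseteq> centralizer_mod (dim_subgroup (R.T 3))"
proof (rule derived_minimal)
  note J = R.T_ideal[of 3]
  show "subgroup (centralizer_mod (dim_subgroup (R.T 3))) G"
    by (rule normal.centralizer_mod_subgroup[OF dim_subgroup_normal[OF J]])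
  fix g h assume gh: "g \<in> carrier G" "h \<in> carrier G"
  have "gc (gc g h) k \<in> dim_subgroup (R.T 3)" if k: "k \<in> carrier G" for k
    unfolding gc_gc_dim_subgroup_iff[OF J gh k]
    using gh k by (intro R.unit_commutator_central_T3) (auto simp: delta_inv)
  then show "gc g h \<in> centralizer_mod (dim_subgroup (R.T 3))" using gh by (simp add: centralizer_mod_def)
qed

text \<open>
  In the quotient by the normal subgroup of \<open>R\<^sup>[\<^sup>3\<^sup>]\<close> the group \<open>G'\<close> is central, and for a commutator the square of
  \<open>(g, h) - 1\<close> contains \<open>[g, h]\<close> twice, so its \<open>p\<close>-th power lies in \<open>R\<^sup>[\<^sup>3\<^sup>]\<close>.
\<close>

lemma derived_pow_p_T3:
  assumes "x \<in> derived G (carrier G)"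
  shows "x [^] p \<in> dim_subgroup (R.T 3)"
proof -
  let ?D = "dim_subgroup (R.T 3)" and ?N = "derived G (carrier G)"
  note J = R.T_ideal[of 3]
  interpret D: normal ?D G by (rule dim_subgroup_normal[OF J])
  obtain Q :: "'g set monoid" and q where "quotient_hom G Q q ?D" by (rule D.quotient_hom_exists)
  then interpret q: quotient_hom G Q q ?D .
  have N: "subgroup ?N G" by (rule derived_is_subgroup) simp
  have NG: "x \<in> carrier G" if "x \<in> ?N" for x using that subgroup.mem_carrier[OF N] by auto
  have pow_iff: "x [^] p \<in> ?D \<longleftrightarrow> q x [^]\<^bsub>Q\<^esub> p = \<one>\<^bsub>Q\<^esub>" if "x \<in> carrier G" for x
    using q.ker[of "x [^] p"] that by (simp add: q.hom_nat_pow)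
  let ?S = "{x \<in> ?N. x [^] p \<in> ?D}"
  have "subgroup ?S G"
  proof
    fix x assume x: "x \<in> ?S"
    { fix y assume y: "y \<in> ?S"
      have "q x \<otimes>\<^bsub>Q\<^esub> q y = q y \<otimes>\<^bsub>Q\<^esub> q x"
        using derived_central_mod_T3 x y NG q.gc_mem_iff[of x y] by (auto simp: centralizer_mod_def)
      then have "q (x \<otimes> y) [^]\<^bsub>Q\<^esub> p = q x [^]\<^bsub>Q\<^esub> p \<otimes>\<^bsub>Q\<^esub> q y [^]\<^bsub>Q\<^esub> p"
        using x y NG q.H.pow_mult_distrib[of "q x" "q y" p] by simp
      then show "x \<otimes> y \<in> ?S"
        using x y NG N pow_iff[of x] pow_iff[of y] pow_iff[of "x \<otimes> y"] by (auto simp: subgroup.m_closed) }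
    show "inv x \<in> ?S"
      using x NG N D.m_inv_closed[of "x [^] p"] by (auto simp: subgroup.m_inv_closed nat_pow_inv)
  qed (use NG subgroup.one_closed[OF N] in auto)
  moreover have "gc g h \<in> ?S" if g: "g \<in> carrier G" and h: "h \<in> carrier G" for g h
  proof -
    let ?w = "\<Delta> (gc g h)"
    let ?v = "\<delta> (inv g) \<odot> \<delta> (inv h)" and ?c = "lie_bracket R (\<delta> g) (\<delta> h)"
    have w: "?w \<in> carrier R" using g h by simp
    have "?w \<odot> ?w = ?v \<odot> (?c \<odot> ?v \<odot> ?c)"
      unfolding delta_gc[OF g h] using g h by (simp add: R.m_assoc)
    also have "\<dots> \<in> R.T 3"
      using g h by (intro R.ideal_l[OF J] R.bracket_mult_bracket_T3) auto
    finally have ww: "?w \<odot> ?w \<in> R.T 3" .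
    have "p \<ge> 2" using prime prime_ge_2_nat by blast
    then obtain i where i: "p = i + 2" by (metis add.commute le_Suc_ex)
    have "?w [^]\<^bsub>R\<^esub> p = ?w [^]\<^bsub>R\<^esub> i \<odot> (?w \<odot> ?w)"
      unfolding i using w by (simp add: numeral_2_eq_2 R.m_assoc)
    also have "\<dots> \<in> R.T 3" using w by (intro R.ideal_l[OF J ww]) auto
    finally have "\<Delta> (gc g h [^] p) \<in> R.T 3"
      unfolding delta_minus_one_pow_p[OF gc_closed[OF g h]] .
    then have "gc g h [^] p \<in> ?D" using g h unfolding dim_subgroup_def by blast
    then show ?thesis using gc_derived[OF g h] by blast
  qed
  ultimately have "?N \<subseteq> ?S" by (rule derived_minimal)
  then show ?thesis using assms by blast
qed

lemma T3_torsion: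
  assumes "x \<in> dim_subgroup (R.T 3)" shows "x [^] (p ^ m) = \<one>"
proof -
  let ?w = "\<Delta> x"
  have x: "x \<in> carrier G" and w: "?w \<in> R.T 3" using assms by (auto simp: dim_subgroup_def)
  have "m < p ^ m" using power_gt_expt[of p m] prime_gt_1_nat[OF prime] by simp
  then obtain k where k: "p ^ m = Suc k" "m \<le> k + 3" using gr0_implies_Suc[of "p ^ m"] by fastforce
  have "?w [^]\<^bsub>R\<^esub> (p ^ m) \<in> R.T (k + 3)" unfolding k(1) by (rule R.T3_pow[OF w])
  then have "?w [^]\<^bsub>R\<^esub> (p ^ m) = \<zero>\<^bsub>R\<^esub>" using R.T_antimono[OF m k(2)] unfolding T_m by blast
  then have "\<Delta> (x [^] (p ^ m)) = \<zero>\<^bsub>R\<^esub>" unfolding delta_minus_one_pow[OF x] .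
  then have "\<delta> (x [^] (p ^ m)) = \<delta> \<one>"
    unfolding delta_one by (intro R.eq_one_if_minus_one_eq_zero) (use x in auto)
  then show ?thesis by (rule delta_inj)
qed

lemma derived_torsion:
  assumes "x \<in> derived G (carrier G)" shows "x [^] (p ^ Suc m) = \<one>"
proof -
  have "x \<in> carrier G" using assms derived_in_carrier[of "carrier G"] by auto
  then show ?thesis using T3_torsion[OF derived_pow_p_T3[OF assms]] by (simp add: nat_pow_pow)
qed

lemma double_commutator_dim_subgroup:
  assumes u: "u \<in> dim_subgroup (R.T n)" and n: "n \<ge> 3" and g: "g \<in> carrier G" and h: "h \<in> carrier G"
  shows "gc (gc u g) h \<in> dim_subgroup (R.T (Suc n))"
proof -
  note D = normal_imp_subgroup[OF dim_subgroup_normal[OF R.T_ideal[of n]]]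
  have uG: "u \<in> carrier G" and w: "\<Delta> u \<in> R.T n" using u unfolding dim_subgroup_def by blast+
  have u': "\<Delta> (inv u) \<in> R.T n"
    using subgroup.m_inv_closed[OF D u] unfolding dim_subgroup_def by blast
  show ?thesis
    unfolding gc_gc_dim_subgroup_iff[OF R.T_ideal uG g h]
    using uG g h by (intro R.double_commutator_T[OF w u' n]) (auto simp: delta_inv)
qed

text \<open>
  The only form in which nilpotency of the action of \<open>G\<close> on \<open>G'\<close> is needed. If no element of \<open>L - M\<close> were
  central modulo \<open>M\<close>, repeated commutators would lead from \<open>L - M\<close> to elements of \<open>L - M\<close> in ever deeper
  dimension subgroups, but \<open>R\<^sup>[\<^sup>m\<^sup>] = 0\<close> makes the deep ones trivial.
\<close>

lemma central_element_exists:
  assumes M: "M \<lhd> G" and L: "L \<lhd> G" and sub: "M \<subset> L" and LN: "L \<subseteq> derived G (carrier G)"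
  obtains c where "c \<in> L" "c \<notin> M" "c \<in> centralizer_mod M" "c [^] p \<in> M"
proof -
  interpret M: normal M G by (rule M)
  interpret L: normal L G by (rule L)
  have "\<exists>c\<in>L - M. c \<in> centralizer_mod M"
  proof (rule ccontr)
    assume "\<not> (\<exists>c\<in>L - M. c \<in> centralizer_mod M)"
    then have step: "\<exists>g\<in>carrier G. gc u g \<in> L - M" if "u \<in> L - M" for u
      using that L.gc_mem_left by (auto simp: centralizer_mod_def)
    have "\<exists>u\<in>L - M. u \<in> dim_subgroup (R.T (n + 3))" for n
    proof (induction n)
      case 0
      obtain u where u: "u \<in> L - M" using sub by blast
      then obtain g where "g \<in> carrier G" "gc u g \<in> L - M" using step by blast
      then show ?case using derived_central_mod_T3 u LN by (auto simp: centralizer_mod_def)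
    next
      case (Suc n)
      then obtain u where u: "u \<in> L - M" "u \<in> dim_subgroup (R.T (n + 3))" by blast
      obtain g where g: "g \<in> carrier G" "gc u g \<in> L - M" using step u by blast
      obtain h where h: "h \<in> carrier G" "gc (gc u g) h \<in> L - M" using step g by blast
      then show ?case using double_commutator_dim_subgroup[OF u(2) _ g(1) h(1)] by auto
    qed
    then obtain u where u: "u \<in> L - M" "u \<in> dim_subgroup (R.T (m + 3))" by blast
    have "R.T (m + 3) \<subseteq> {\<zero>\<^bsub>R\<^esub>}" using R.T_antimono[OF m, of "m + 3"] T_m by auto
    then have "\<Delta> u = \<zero>\<^bsub>R\<^esub>" "u \<in> carrier G" using u(2) by (auto simp: dim_subgroup_def)
    then have "\<delta> u = \<delta> \<one>"
      unfolding delta_one by (intro R.eq_one_if_minus_one_eq_zero) auto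
    then have "u = \<one>" by (rule delta_inj)
    then show False using u(1) by simp
  qed
  then obtain c where c: "c \<in> L" "c \<notin> M" "c \<in> centralizer_mod M" by blast
  have cG: "c \<in> carrier G" using c(1) by (rule L.mem_carrier)
  define k where "k = (LEAST k. c [^] (p ^ k) \<in> M)"
  have "c [^] (p ^ Suc m) \<in> M" using derived_torsion[of c] c(1) LN by auto
  then have k: "c [^] (p ^ k) \<in> M" unfolding k_def by (rule LeastI)
  have "k \<noteq> 0" using k c(2) cG by (intro notI) simp
  then obtain j where j: "k = Suc j" by (cases k) auto
  have nj: "c [^] (p ^ j) \<notin> M" using not_less_Least[of j "\<lambda>k. c [^] (p ^ k) \<in> M"] j k_def by auto
  show thesis
  proof (rule that[of "c [^] (p ^ j)"])
    show "c [^] (p ^ j) \<in> L" using c(1) L.is_subgroup by (simp add: subgroup_nat_pow_closed)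
    show "c [^] (p ^ j) \<in> centralizer_mod M"
      using c(3) M.centralizer_mod_subgroup by (simp add: subgroup_nat_pow_closed)
    show "(c [^] (p ^ j)) [^] p \<in> M" using k j cG by (simp add: nat_pow_pow mult.commute)
  qed (rule nj)
qed

end

section \<open>The upper bound\<close>

lemma maximal_subset_exists:
  assumes fin: "finite S" and P: "P A" and sub: "\<And>H. P H \<Longrightarrow> H \<subseteq> S"
  obtains H where "P H" "\<And>H'. P H' \<Longrightarrow> H \<subseteq> H' \<Longrightarrow> H = H'"
proof -
  have "finite {H. P H}" by (rule finite_subset[of _ "Pow S"]) (use fin sub in auto)
  moreover have "{H. P H} \<noteq> {}" using P by auto
  ultimately have "\<exists>H\<in>{H. P H}. \<forall>H'\<in>{H. P H}. H \<subseteq> H' \<longrightarrow> H = H'" by (rule finite_has_maximal)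
  then show thesis using that by blast
qed

context lie_nilpotent_group_ring
begin

abbreviation N :: "'g set" where "N \<equiv> derived G (carrier G)"

lemma N_subgroup: "subgroup N G"
  by (rule derived_is_subgroup) simp

lemma N_carrier: "x \<in> N \<Longrightarrow> x \<in> carrier G"
  using subgroup.mem_carrier[OF N_subgroup] .

lemma p_pos: "p > 0" and p_ge_2: "p \<ge> 2"
  using prime prime_gt_0_nat prime_ge_2_nat by auto

lemma torsion_coprime:
  assumes "\<not> p dvd i" shows "coprime i (p ^ Suc m)"
  using assms prime by (metis coprime_commute coprime_power_right_iff prime_imp_coprime)

text \<open>
  One step of a chief series. Below a normal subgroup \<open>M\<close> a maximal one has an element that is central
  modulo it, and by maximality this element generates the whole of \<open>M\<close>.
\<close>

lemma maximal_normal_step: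
  assumes M: "M \<lhd> G" and MN: "M \<subseteq> N" and fin: "finite N" and nt: "M \<noteq> {\<one>}"
  obtains M' z where "M' \<lhd> G" "M' \<subset> M" "z \<in> M" "z \<in> centralizer_mod M'" "z [^] p \<in> M'" "adjoin z M' = M"
    "p * card M' \<le> card M"
proof -
  let ?P = "\<lambda>H. H \<lhd> G \<and> H \<subset> M"
  have finM: "finite M" using MN fin finite_subset by auto
  have "{\<one>} \<lhd> G" by (rule one_is_normal)
  moreover have "{\<one>} \<subset> M" using nt subgroup.one_closed[OF normal_imp_subgroup[OF M]] by auto
  ultimately have ne: "?P {\<one>}" by simp
  obtain M' where n: "M' \<lhd> G" "M' \<subset> M" and max: "\<And>H. ?P H \<Longrightarrow> M' \<subseteq> H \<Longrightarrow> M' = H"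
    by (rule maximal_subset_exists[of M ?P, OF finM ne]) blast+
  obtain z where z: "z \<in> M" "z \<notin> M'" "z \<in> centralizer_mod M'" "z [^] p \<in> M'"
    by (rule central_element_exists[OF n(1) M n(2) MN])
  have zG: "z \<in> carrier G" using z MN N_carrier by auto
  note A = normal.adjoin_normal[OF n(1) z(3,4) p_pos] normal.adjoin_subgroup[OF n(1) zG z(4) p_pos]
  have sub: "adjoin z M' \<subseteq> M"
    by (rule normal.adjoin_subset[OF n(1) normal_imp_subgroup[OF M] z(1)]) (use n in auto)
  have "adjoin z M' = M"
  proof (rule ccontr)
    assume "adjoin z M' \<noteq> M"
    then have "?P (adjoin z M')" using A(1) sub by auto
    then show False using max[of "adjoin z M'"] A(3,4) z(2) by auto
  qed
  moreover have "p * card M' \<le> card M"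
    by (rule normal.adjoin_card[OF n(1) zG z(2,4) prime sub finM])
  ultimately show thesis using that n z by blast
qed

lemma normal_carrier: "M \<lhd> G \<Longrightarrow> M \<subseteq> carrier G"
  by (rule normal_imp_subgroup[THEN subgroup.subset])

lemma delta_pow_p_aug:
  assumes "M \<lhd> G" "x \<in> carrier G" "x [^] p \<in> M"
  shows "(\<Delta> x) [^]\<^bsub>R\<^esub> p \<in> aug M"
  unfolding delta_minus_one_pow_p[OF assms(2)] by (rule aug_mem[OF normal_carrier[OF assms(1)] assms(3)])

lemma V_power_step_aug:
  assumes M: "M \<lhd> G" and z: "z \<in> centralizer_mod M" "z [^] p \<in> M"
    and V: "R.V s \<subseteq> R.lin (\<Delta> z) (R.V e) (aug M)" and e: "e \<le> s"
  shows "R.V (s + (p - 1) * (s - e)) \<subseteq> aug M"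
proof (rule R.V_power_step[OF _ _ _ V _ _ e])
  have zG: "z \<in> carrier G" using z by (simp add: centralizer_mod_def)
  then show "\<Delta> z \<in> carrier R" by simp
  show "(\<Delta> z) [^]\<^bsub>R\<^esub> p \<in> aug M" by (rule delta_pow_p_aug[OF M zG z(2)])
qed (use p_pos aug_ideal[OF normal_carrier[OF M]] central_mod_aug[OF normal_carrier[OF M] z(1)] in auto)

text \<open>
  Descend from \<open>M\<close> to the trivial subgroup along a chief series. In each step \<open>z - 1\<close> is central modulo the
  smaller ideal with vanishing \<open>p\<close>-th power, so the index grows by the factor \<open>p\<close> while the order of the
  subgroup drops at least by that factor.
\<close>

lemma V_vanishes:
  assumes fin: "finite N"
  shows "M \<lhd> G \<Longrightarrow> M \<subseteq> N \<Longrightarrow> R.V s \<subseteq> aug M \<Longrightarrow> R.V (s * card M) \<subseteq> {\<zero>\<^bsub>R\<^esub>}"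
proof (induction "card M" arbitrary: M s rule: less_induct)
  case less
  show ?case
  proof (cases "M = {\<one>}")
    case True
    then show ?thesis using less.prems(3) by (simp add: aug_one)
  next
    case False
    obtain M' z where M': "M' \<lhd> G" "M' \<subset> M" "z \<in> M" "z \<in> centralizer_mod M'" "z [^] p \<in> M'"
        "adjoin z M' = M" "p * card M' \<le> card M"
      by (rule maximal_normal_step[OF less.prems(1,2) fin False])
    have "R.V s \<subseteq> R.lin (\<Delta> z) (R.V 0) (aug M')"
      using less.prems(3) aug_adjoin[OF normal_carrier[OF M'(1)] M'(4)] M'(6) by simp
    then have "R.V (s + (p - 1) * (s - 0)) \<subseteq> aug M'" by (rule V_power_step_aug[OF M'(1,4,5)]) simp
    moreover have "s + (p - 1) * (s - 0) = p * s" using p_pos by (cases p) auto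
    ultimately have V: "R.V (p * s) \<subseteq> aug M'" by simp
    have "card M' < card M" using M'(2) less.prems(2) fin by (meson finite_subset psubset_card_mono)
    then have "R.V (p * s * card M') \<subseteq> {\<zero>\<^bsub>R\<^esub>}"
      using less.hyps[OF _ M'(1) _ V] M'(2) less.prems(2) by auto
    moreover have "p * s * card M' \<le> s * card M" using M'(7) by (simp add: mult.left_commute mult.assoc)
    ultimately show ?thesis using R.V_antimono by blast
  qed
qed

lemma V_card_N: "finite N \<Longrightarrow> R.V (card N) \<subseteq> {\<zero>\<^bsub>R\<^esub>}"
  using V_vanishes[OF _ derived_normal order_refl, of 1] V1_subset_aug_derived by simp

lemma delta_V1: "x \<in> N \<Longrightarrow> \<Delta> x \<in> R.V 1"
  using aug_mem[of N x] aug_derived_subset_V1 N_carrier by blast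

end

section \<open>The gain for noncyclic commutator subgroups\<close>

context lie_nilpotent_group_ring
begin

text \<open>Since \<open>N\<close> is a torsion group, this says for normal \<open>M \<subseteq> N\<close> that \<open>N / M\<close> is cyclic.\<close>

definition cyclic_mod :: "'g set \<Rightarrow> bool" where
  "cyclic_mod M \<longleftrightarrow> (\<exists>a\<in>N. N \<subseteq> adjoin a M)"

lemma mem_of_mem_adjoin_pow:
  assumes M: "M \<lhd> G" and a: "a \<in> N" "a \<in> adjoin (a [^] p) M"
  shows "a \<in> M"
proof -
  interpret M: normal M G by (rule M)
  have aG: "a \<in> carrier G" using a N_carrier by auto
  obtain k :: nat and t where t: "t \<in> M" "a = (a [^] p) [^] k \<otimes> t" using a(2) unfolding adjoin_def by blast
  have tG: "t \<in> carrier G" using t M.mem_carrier by auto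
  show "a \<in> M"
  proof (cases "k = 0")
    case True
    then show ?thesis using t tG by simp
  next
    case False
    then have pk: "Suc (p * k - 1) = p * k" using p_pos by simp
    have "a \<otimes> \<one> = a [^] Suc (p * k - 1) \<otimes> t" using t(2) aG tG by (simp only: pk nat_pow_pow r_one)
    also have "\<dots> = a \<otimes> (a [^] (p * k - 1) \<otimes> t)" using aG tG by (simp only: nat_pow_Suc2 m_assoc nat_pow_closed)
    finally have "\<one> = a [^] (p * k - 1) \<otimes> t" using aG tG left_cancel by simp
    then have "a [^] (p * k - 1) = inv t" using aG tG by (metis inv_equality inv_inv nat_pow_closed inv_closed)
    then have 1: "a [^] (p * k - 1) \<in> M" using t(1) by simp
    have "\<not> p dvd p * k - 1"
    proof
      assume "p dvd p * k - 1"
      then have "p dvd p * k - (p * k - 1)" by (rule dvd_diff_nat[OF dvd_triv_left])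
      moreover have "p * k - (p * k - 1) = 1" using pk by arith
      ultimately show False using p_ge_2 by simp
    qed
    from pow_coprime_mem[OF M.is_subgroup aG 1 _ torsion_coprime[OF this]]
    show ?thesis using derived_torsion[OF a(1)] M.one_closed by simp
  qed
qed

text \<open>
  Among the normal subgroups \<open>M \<subseteq> N\<close> of \<open>G\<close> with noncyclic \<open>N / M\<close> take a maximal one. Then \<open>N / M\<close> is
  elementary abelian of rank \<open>2\<close>: by maximality its quotient by a central subgroup \<open>\<langle>c\<rangle>\<close> of order \<open>p\<close> is
  cyclic, generated by \<open>a\<close> say, and if \<open>a\<^sup>p\<close> were not in \<open>M\<close>, then \<open>\<langle>a\<^sup>p\<rangle> M\<close> would be a larger normal subgroup with noncyclic quotient.
\<close>

lemma elementary_section: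
  assumes fin: "finite N" and nc: "\<not> cyclic_mod {\<one>}"
  obtains M c a where "M \<lhd> G" "M \<subseteq> N" "c \<in> N" "a \<in> N" "c \<notin> M" "c \<in> centralizer_mod M" "c [^] p \<in> M"
    "adjoin c M \<lhd> G" "adjoin c M \<subseteq> N" "a \<in> centralizer_mod (adjoin c M)" "a [^] p \<in> M" "a \<notin> adjoin c M"
    "N = adjoin a (adjoin c M)"
proof -
  let ?P = "\<lambda>M. M \<lhd> G \<and> M \<subseteq> N \<and> \<not> cyclic_mod M"
  have ne: "?P {\<one>}" using nc one_is_normal subgroup.one_closed[OF N_subgroup] by auto
  obtain M where M: "M \<lhd> G" "M \<subseteq> N" "\<not> cyclic_mod M" and max: "\<And>H. ?P H \<Longrightarrow> M \<subseteq> H \<Longrightarrow> M = H"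
    by (rule maximal_subset_exists[of N ?P, OF fin ne]) blast+
  interpret M: normal M G by (rule M)
  have maxD: "cyclic_mod H" if "H \<lhd> G" "H \<subseteq> N" "M \<subset> H" for H using max[of H] that by blast
  have "M \<noteq> N"
    using M(3) subgroup.one_closed[OF N_subgroup] M.adjoin_subgroup(2)[of \<one> 1] by (auto simp: cyclic_mod_def)
  then have MN: "M \<subset> N" using M by auto
  obtain c where c: "c \<in> N" "c \<notin> M" "c \<in> centralizer_mod M" "c [^] p \<in> M"
    by (rule central_element_exists[OF M(1) derived_normal MN order_refl])
  have cG: "c \<in> carrier G" using c N_carrier by auto
  let ?L = "adjoin c M"
  have L: "?L \<lhd> G" "subgroup ?L G" "M \<subseteq> ?L" "c \<in> ?L"
    using M.adjoin_normal[OF c(3,4) p_pos] M.adjoin_subgroup[OF cG c(4) p_pos] by auto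
  interpret L: normal ?L G by (rule L)
  have LN: "?L \<subseteq> N" by (rule M.adjoin_subset[OF N_subgroup c(1) M(2)])
  have "cyclic_mod ?L" by (rule maxD[OF L(1) LN]) (use L c in auto)
  then obtain a where a: "a \<in> N" "N \<subseteq> adjoin a ?L" by (auto simp: cyclic_mod_def)
  have aG: "a \<in> carrier G" using a N_carrier by auto
  have "?L \<noteq> N" using M(3) c(1) by (auto simp: cyclic_mod_def)
  then have LsN: "?L \<subset> N" using LN by auto
  have aL: "a \<notin> ?L"
    using L.adjoin_subset[OF L(2), of a] a(2) LsN by auto
  have Neq: "N = adjoin a ?L" using L.adjoin_subset[OF N_subgroup a(1) LN] a(2) by auto
  have a_tors: "a [^] (p ^ Suc m) \<in> M" using derived_torsion[OF a(1)] M.one_closed by simp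
  have pw: "x [^] p \<in> adjoin (a [^] p) M" if "x \<in> N" for x
  proof -
    have "x \<in> adjoin a ?L" using that a(2) by auto
    then obtain i :: nat and l where l: "l \<in> ?L" "x = a [^] i \<otimes> l" unfolding adjoin_def[of a] by blast
    then obtain j :: nat and t where t: "t \<in> M" "l = c [^] j \<otimes> t" unfolding adjoin_def by blast
    show ?thesis unfolding l(2) t(2) by (rule pow_product_central_mod[OF M(1) c(3) aG c(4) t(1)])
  qed
  have ap: "a [^] p \<in> M"
  proof (rule ccontr)
    assume d: "a [^] p \<notin> M"
    let ?P = "adjoin (a [^] p) M"
    have dG: "a [^] p \<in> carrier G" using aG by simp
    have "(a [^] p) [^] (p ^ Suc m) = (a [^] (p ^ Suc m)) [^] p" using aG by (simp add: nat_pow_pow mult.commute)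
    then have dk: "(a [^] p) [^] (p ^ Suc m) \<in> M" using subgroup_nat_pow_closed[OF M.is_subgroup a_tors] by simp
    have pk: "p ^ Suc m > 0" using p_pos by simp
    note P = M.adjoin_subgroup[OF dG dk pk]
    \<comment> \<open>all \<open>p\<close>-th powers of \<open>N\<close> lie in \<open>?P\<close>, in particular those of the conjugates of \<open>a\<close>\<close>
    have "?P \<lhd> G"
    proof (rule M.adjoin_normalI[OF dG dk pk])
      fix g assume g: "g \<in> carrier G"
      have "g \<otimes> a [^] p \<otimes> inv g = (g \<otimes> a \<otimes> inv g) [^] p" by (rule conj_pow_nat[OF aG g])
      moreover have "g \<otimes> a \<otimes> inv g \<in> N" by (rule normal.inv_op_closed2[OF derived_normal g a(1)])
      ultimately show "g \<otimes> a [^] p \<otimes> inv g \<in> ?P" using pw by simp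
    qed
    moreover have "?P \<subseteq> N"
      by (rule M.adjoin_subset[OF N_subgroup subgroup_nat_pow_closed[OF N_subgroup a(1)] M(2)])
    moreover have "M \<subset> ?P" using P(2,3) d by auto
    ultimately have "cyclic_mod ?P" by (rule maxD)
    then obtain b where b: "b \<in> N" "N \<subseteq> adjoin b ?P" by (auto simp: cyclic_mod_def)
    have bG: "b \<in> carrier G" using b N_carrier by auto
    have aP: "a \<notin> ?P" using mem_of_mem_adjoin_pow[OF M(1) a(1)] aL L(3) by auto
    note A0 = M.adjoin_subgroup[OF aG a_tors pk]
    have PA0: "?P \<subseteq> adjoin a M"
      by (rule M.adjoin_subset[OF A0(1) subgroup_nat_pow_closed[OF A0(1,3)] A0(2)])
    have "a \<in> adjoin b ?P" using a(1) b(2) by auto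
    then obtain k :: nat and y where y: "y \<in> ?P" "a = b [^] k \<otimes> y" unfolding adjoin_def[of b] by blast
    have yG: "y \<in> carrier G" using y P(1) subgroup.mem_carrier by metis
    \<comment> \<open>modulo \<open>?P\<close> the generator \<open>b\<close> has order \<open>p\<close>, so \<open>a\<close> generates the quotient as well\<close>
    have nd: "\<not> p dvd k"
    proof
      assume "p dvd k"
      then obtain k' where "k = p * k'" by auto
      then have "b [^] k = (b [^] p) [^] k'" using bG by (simp add: nat_pow_pow)
      then have "b [^] k \<in> ?P" using subgroup_nat_pow_closed[OF P(1) pw[OF b(1)]] by simp
      then show False using aP y subgroup.m_closed[OF P(1)] by metis
    qed
    have "b [^] k = a \<otimes> inv y" using y(2) yG bG aG by (simp add: inv_solve_right)
    then have 1: "b [^] k \<in> adjoin a M"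
      using A0(1,3) PA0 y(1) by (metis subgroup.m_closed subgroup.m_inv_closed subsetD)
    have 2: "b [^] (p ^ Suc m) \<in> adjoin a M" using derived_torsion[OF b(1)] subgroup.one_closed[OF A0(1)] by simp
    have "b \<in> adjoin a M" by (rule pow_coprime_mem[OF A0(1) bG 1 2 torsion_coprime[OF nd]])
    then have "adjoin b ?P \<subseteq> adjoin a M"
      using PA0 A0(1) by (auto simp: adjoin_def[of b] intro!: subgroup.m_closed[OF A0(1)] subgroup_nat_pow_closed[OF A0(1)])
    then show False using M(3) a(1) b(2) by (auto simp: cyclic_mod_def)
  qed
  \<comment> \<open>some element of \<open>N - ?L\<close> is central modulo \<open>?L\<close>; as \<open>N / ?L\<close> has order \<open>p\<close>, so is \<open>a\<close>\<close>
  obtain a1 where a1: "a1 \<in> N" "a1 \<notin> ?L" "a1 \<in> centralizer_mod ?L" "a1 [^] p \<in> ?L"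
    by (rule central_element_exists[OF L(1) derived_normal LsN order_refl])
  have "a \<in> centralizer_mod ?L"
  proof -
    note Z = L.centralizer_mod_subgroup and LZ = L.subset_centralizer_mod
    have "a1 \<in> adjoin a ?L" using a1 a(2) by auto
    then obtain i :: nat and l where l: "l \<in> ?L" "a1 = a [^] i \<otimes> l" unfolding adjoin_def[of a] by blast
    have lG: "l \<in> carrier G" using l L.mem_carrier by auto
    have "\<not> p dvd i"
    proof
      assume "p dvd i"
      then obtain k where "i = p * k" by auto
      then have "a [^] i = (a [^] p) [^] k" using aG by (simp add: nat_pow_pow)
      then have "a [^] i \<in> ?L" using subgroup_nat_pow_closed[OF L(2)] ap L(3) by auto
      then show False using a1(2) l L.m_closed by simp
    qed
    moreover have "a [^] i = a1 \<otimes> inv l" using l(2) lG aG N_carrier[OF a1(1)] by (simp add: inv_solve_right)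
    then have "a [^] i \<in> centralizer_mod ?L"
      using a1(3) l(1) LZ Z by (metis subgroup.m_closed subgroup.m_inv_closed subsetD)
    moreover have "a [^] p \<in> centralizer_mod ?L" using ap L(3) LZ by auto
    ultimately show ?thesis using pow_prime_mem[OF Z aG _ _ prime] by blast
  qed
  with M c a L LN ap aL Neq show thesis by (intro that[of M c a]) auto
qed

text \<open>
  With \<open>x = a - 1\<close> and \<open>y = c - 1\<close> from the section above, the general bound would give \<open>V (p\<^sup>2) \<subseteq> aug M\<close>; the
  gain lowers the index below \<open>p\<^sup>2\<close>. For \<open>p = 2\<close> and \<open>a\<close> not central modulo \<open>M\<close> the section itself attains
  the bound, and the gain appears only one chief factor further down, at a section of order \<open>8\<close>. This
  factor is missing exactly in the exceptional case, where \<open>M\<close> is trivial.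
\<close>

lemma gain:
  assumes fin: "finite N" and nc: "\<not> cyclic_mod {\<one>}"
    and ns: "\<not> (p = 2 \<and> card N = 4 \<and> lower_central G 3 \<noteq> {\<one>})"
  obtains M s where "M \<lhd> G" "M \<subseteq> N" "R.V s \<subseteq> aug M" "s * card M < card N"
proof -
  obtain M c a where M: "M \<lhd> G" "M \<subseteq> N" and c: "c \<in> N" "c \<notin> M" "c \<in> centralizer_mod M" "c [^] p \<in> M"
    and L: "adjoin c M \<lhd> G" "adjoin c M \<subseteq> N"
    and a: "a \<in> N" "a \<in> centralizer_mod (adjoin c M)" "a [^] p \<in> M" "a \<notin> adjoin c M"
    and Neq: "N = adjoin a (adjoin c M)"
    by (rule elementary_section[OF fin nc])
  let ?L = "adjoin c M"
  interpret M: normal M G by (rule M)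
  interpret L: normal ?L G by (rule L)
  have cG: "c \<in> carrier G" and aG: "a \<in> carrier G" using c a N_carrier by auto
  have M_sub_L: "M \<subseteq> ?L" by (rule M.adjoin_subgroup(2)[OF cG c(4) p_pos])
  have finL: "finite ?L" and finM: "finite M" using L(2) M_sub_L fin by (auto intro: finite_subset)
  have card: "p * (p * card M) \<le> card N"
  proof -
    have "p * card M \<le> card ?L" by (rule M.adjoin_card[OF cG c(2,4) prime order_refl finL])
    moreover have "p * card ?L \<le> card N"
      by (rule L.adjoin_card[OF aG a(4) _ prime _ fin]) (use a(3) M_sub_L Neq in auto)
    ultimately show ?thesis by (meson mult_le_mono2 le_trans)
  qed
  have cardM: "card M > 0" using finM M.one_closed card_gt_0_iff by blast
  let ?x = "\<Delta> a" and ?y = "\<Delta> c"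
  have x1: "?x \<in> R.V 1" and y1: "?y \<in> R.V 1" using delta_V1 a c by auto
  have yc: "?y \<in> carrier R" using cG by simp
  have I: "ideal (aug M) R" by (rule aug_ideal[OF M.subset])
  have cy: "R.central_mod ?y (aug M)" by (rule central_mod_aug[OF M.subset c(3)])
  have augL: "aug ?L \<subseteq> R.lin ?y (carrier R) (aug M)" by (rule aug_adjoin[OF M.subset c(3)])
  have cx: "R.central_mod ?x (R.lin ?y (carrier R) (aug M))"
    by (rule R.central_mod_mono[OF central_mod_aug[OF L.subset a(2)] augL])
  have V1: "R.V 1 \<subseteq> R.lin ?x (carrier R) (R.lin ?y (carrier R) (aug M))"
  proof -
    have "R.V 1 \<subseteq> aug (adjoin a ?L)" using V1_subset_aug_derived Neq by simp
    also have "\<dots> \<subseteq> R.lin ?x (carrier R) (aug ?L)" by (rule aug_adjoin[OF L.subset a(2)])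
    also have "\<dots> \<subseteq> R.lin ?x (carrier R) (R.lin ?y (carrier R) (aug M))" by (rule R.lin_mono[OF order_refl augL])
    finally show ?thesis .
  qed
  have xp: "?x [^]\<^bsub>R\<^esub> p \<in> aug M" by (rule delta_pow_p_aug[OF M(1) aG a(3)])
  show thesis
  proof (cases "p \<ge> 3")
    case True
    have "R.V p \<subseteq> R.lin ?y (R.V 1) (aug M)"
      by (rule R.V_gain_two_generators[OF I yc x1 cy cx V1 xp True])
    then have "R.V (p + (p - 1) * (p - 1)) \<subseteq> aug M"
      using p_ge_2 by (intro V_power_step_aug[OF M(1) c(3,4)]) auto
    moreover have "(p + (p - 1) * (p - 1)) * card M < card N"
    proof -
      obtain k where k: "p = Suc (Suc k)" using p_ge_2 by (metis add_2_eq_Suc le_Suc_ex)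
      have "p + (p - 1) * (p - 1) < p * p" unfolding k by simp
      then have "(p + (p - 1) * (p - 1)) * card M < p * p * card M"
        by (rule mult_strict_right_mono[OF _ cardM])
      also have "\<dots> \<le> card N" using card by (simp only: mult.assoc)
      finally show ?thesis .
    qed
    ultimately show ?thesis by (rule that[OF M])
  next
    case False
    then have p2: "p = 2" using p_ge_2 by simp
    show ?thesis
    proof (cases "a \<in> centralizer_mod M")
      case True
      have "R.V 2 \<subseteq> R.lin ?y (R.V 1) (aug M)"
        by (rule R.V_gain_two_central[OF I yc x1 cy central_mod_aug[OF M.subset True] V1]) (use xp p2 in simp)
      then have "R.V (2 + (p - 1) * (2 - 1)) \<subseteq> aug M"
        by (rule V_power_step_aug[OF M(1) c(3,4)]) simp
      then show ?thesis using card cardM p2 by (intro that[OF M, of 3]) auto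
    next
      case False
      then obtain h where h: "h \<in> carrier G" "gc a h \<notin> M" using aG by (auto simp: centralizer_mod_def)
      have ahL: "gc a h \<in> ?L" using a(2) h(1) by (auto simp: centralizer_mod_def)
      have c2: "c [^] (2::nat) \<in> M" and a2: "a [^] (2::nat) \<in> M" using c(4) a(3) p2 by auto
      show ?thesis
      proof (cases "M = {\<one>}")
        case True
        have "N \<subseteq> (\<lambda>(i, j). a [^] i \<otimes> c [^] j) ` ({0, 1::nat} \<times> {0, 1::nat})"
        proof
          fix x assume "x \<in> N"
          then have "x \<in> adjoin a ?L" using Neq by blast
          then obtain i :: nat and l where l: "l \<in> ?L" "x = a [^] i \<otimes> l" unfolding adjoin_def[of a] by blast
          then obtain j :: nat and t where t: "t \<in> M" "l = c [^] j \<otimes> t" unfolding adjoin_def by blast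
          have x: "x = a [^] i \<otimes> c [^] j" using l(2) t True cG by simp
          have red: "g [^] i = g [^] (i mod 2)" if "g \<in> carrier G" "g [^] (2::nat) = \<one>" for g and i :: nat
          proof -
            have "g [^] i = (g [^] (2::nat)) [^] (i div 2) \<otimes> g [^] (i mod 2)"
              using that(1) by (simp add: nat_pow_pow nat_pow_mult)
            then show ?thesis using that by simp
          qed
          have "x = a [^] (i mod 2) \<otimes> c [^] (j mod 2)"
            using x red[OF aG, of i] red[OF cG, of j] a2 c2 True by simp
          then show "x \<in> (\<lambda>(i, j). a [^] i \<otimes> c [^] j) ` ({0, 1::nat} \<times> {0, 1::nat})"
            by (intro image_eqI[of _ _ "(i mod 2, j mod 2)"]) auto
        qed
        then have "card N \<le> card ((\<lambda>(i, j). a [^] i \<otimes> c [^] j) ` ({0, 1::nat} \<times> {0, 1::nat}))"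
          by (intro card_mono) auto
        also have "\<dots> \<le> card ({0, 1::nat} \<times> {0, 1::nat})" by (rule card_image_le) auto
        also have "\<dots> = 4" by (simp add: card_cartesian_product)
        finally have "card N = 4" using card p2 True by simp
        moreover have "gc a h \<in> lower_central G 3"
        proof -
          have "a \<in> lower_central G (Suc (Suc 0))" using a(1) lower_central_2 by (simp only: numeral_2_eq_2)
          then show ?thesis unfolding numeral_3_eq_3 using h(1)
            by (subst lower_central.simps(3)) (auto intro!: generate.incl)
        qed
        ultimately show ?thesis using ns p2 h(2) True by auto
      next
        case False
        obtain M' z where M': "M' \<lhd> G" "M' \<subset> M" "z \<in> M" "z \<in> centralizer_mod M'" "z [^] p \<in> M'"
            "adjoin z M' = M" "p * card M' \<le> card M"
          by (rule maximal_normal_step[OF M fin False])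
        interpret M': normal M' G by (rule M')
        have zG: "z \<in> carrier G" using M'(3) M.mem_carrier by auto
        have z2: "z [^] (2::nat) \<in> M'" using M'(5) p2 by simp
        have MZ: "M \<subseteq> centralizer_mod M'"
          using M'.adjoin_subset[OF M'.centralizer_mod_subgroup M'(4) M'.subset_centralizer_mod] M'(6) by simp
        have cc: "c \<otimes> c \<in> M" and aa: "a \<otimes> a \<in> M" using c2 a2 cG aG by (simp_all add: numeral_2_eq_2)
        \<comment> \<open>otherwise \<open>\<langle>c\<rangle> M' / M'\<close> would be cyclic of order \<open>4\<close>, centralised by \<open>a \<in> G'\<close>, and
          \<open>a\<^sup>h = a c v\<close> would contradict \<open>(a\<^sup>2)\<^sup>h = a\<^sup>2\<close> modulo \<open>M'\<close>\<close>
        have c2M': "c \<otimes> c \<in> M'"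
        proof (rule ccontr)
          assume n: "c \<otimes> c \<notin> M'"
          have "gc c g \<in> M' \<or> gc c g \<otimes> (c \<otimes> c) \<in> M'" if g: "g \<in> carrier G" for g
          proof -
            have "gc c g \<in> M" using c(3) g by (auto simp: centralizer_mod_def)
            then show ?thesis using index_two_product[OF M'(1) zG z2, of "gc c g" "c \<otimes> c"] n cc M'(6) by auto
          qed
          then have ca: "gc c a \<in> M'" using a(1) by (intro M'.derived_centralizes_inverted[OF cG]) auto
          obtain i :: nat and t where t: "t \<in> M" "gc a h = c [^] i \<otimes> t" using ahL by (auto simp: adjoin_def)
          have ev: "c [^] (2 * k) \<in> M" for k :: nat
            using subgroup_nat_pow_closed[OF M.is_subgroup c2, of k] cG by (simp add: nat_pow_pow)
          have "odd i"
          proof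
            assume "even i"
            then have "c [^] i \<in> M" using ev by (auto elim: evenE)
            then show False using t h(2) by simp
          qed
          then obtain k where k: "i = Suc (2 * k)" by (auto elim: oddE)
          define v where "v = c [^] (2 * k) \<otimes> t"
          have v: "v \<in> M" unfolding v_def using ev t by simp
          have vG: "v \<in> carrier G" using v M.mem_carrier by auto
          have tG: "t \<in> carrier G" using t M.mem_carrier by auto
          have gv: "gc a h = c \<otimes> v" unfolding t(2) k v_def using cG tG by (simp only: nat_pow_Suc2 m_assoc nat_pow_closed)
          obtain Q :: "'g set monoid" and q where "quotient_hom G Q q M'" by (rule M'.quotient_hom_exists)
          then interpret q: quotient_hom G Q q M' .
          have cen: "q u \<otimes>\<^bsub>Q\<^esub> q g = q g \<otimes>\<^bsub>Q\<^esub> q u" if "u \<in> M" "g \<in> carrier G" for u g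
          proof -
            have "gc u g \<in> M'" using MZ that by (auto simp: centralizer_mod_def)
            then show ?thesis using q.gc_mem_iff[of u g] that M.mem_carrier by simp
          qed
          have "q c \<otimes>\<^bsub>Q\<^esub> q c = \<one>\<^bsub>Q\<^esub>"
          proof (rule q.H.square_commuting[of "q a" "q c" "q h" "q v"])
            have "inv h \<otimes> a \<otimes> h = a \<otimes> c \<otimes> v" using conj_eq_mult_gc[OF aG h(1)] gv aG cG vG by (simp add: m_assoc)
            then have "q (inv h \<otimes> a \<otimes> h) = q (a \<otimes> c \<otimes> v)" by simp
            then show "inv\<^bsub>Q\<^esub> q h \<otimes>\<^bsub>Q\<^esub> q a \<otimes>\<^bsub>Q\<^esub> q h = q a \<otimes>\<^bsub>Q\<^esub> q c \<otimes>\<^bsub>Q\<^esub> q v" using aG cG vG h(1) by simp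
            show "q a \<otimes>\<^bsub>Q\<^esub> q c = q c \<otimes>\<^bsub>Q\<^esub> q a" using ca q.gc_mem_iff[OF cG aG] by simp
            show "q a \<otimes>\<^bsub>Q\<^esub> q v = q v \<otimes>\<^bsub>Q\<^esub> q a" "q c \<otimes>\<^bsub>Q\<^esub> q v = q v \<otimes>\<^bsub>Q\<^esub> q c" using cen[OF v] aG cG by auto
            show "q h \<otimes>\<^bsub>Q\<^esub> (q a \<otimes>\<^bsub>Q\<^esub> q a) = q a \<otimes>\<^bsub>Q\<^esub> q a \<otimes>\<^bsub>Q\<^esub> q h" using cen[OF aa h(1)] aG by simp
            have "v \<otimes> v \<in> M'"
            proof (cases "v \<in> M'")
              case False
              then show ?thesis using index_two_product[OF M'(1) zG z2, of v v] v M'(6) by auto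
            qed simp
            then show "q v \<otimes>\<^bsub>Q\<^esub> q v = \<one>\<^bsub>Q\<^esub>" using q.ker[of "v \<otimes> v"] vG by simp
          qed (use aG cG h(1) vG in auto)
          then show False using n q.ker[of "c \<otimes> c"] cG by simp
        qed
        let ?w = "\<Delta> z"
        have wc: "?w \<in> carrier R" using zG by simp
        have I': "ideal (aug M') R" by (rule aug_ideal[OF M'.subset])
        have augM: "aug M \<subseteq> R.lin ?w (carrier R) (aug M')"
          using aug_adjoin[OF M'.subset M'(4)] M'(6) by simp
        have mono: "R.lin ?y (carrier R) (aug M) \<subseteq> R.lin ?y (carrier R) (R.lin ?w (carrier R) (aug M'))"
          by (rule R.lin_mono[OF order_refl augM])
        have sq: "(\<Delta> g) \<odot> (\<Delta> g) = \<Delta> (g \<otimes> g)" if "g \<in> carrier G" for g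
          using delta_minus_one_pow_p[OF that] that p2 by (simp add: numeral_2_eq_2)
        \<comment> \<open>for this section of order \<open>8\<close> the general bound is \<open>V 8 \<subseteq> aug M'\<close>; the gain makes it \<open>V 7\<close>\<close>
        have "R.V 4 \<subseteq> R.lin ?w (R.V 1) (aug M')"
        proof (rule R.V_gain_three_generators[OF I' _ y1 x1])
          show "?w \<in> R.V 1" using delta_V1 M'(3) M(2) by auto
          show "R.central_mod ?w (aug M')" by (rule central_mod_aug[OF M'.subset M'(4)])
          show "R.central_mod ?y (R.lin ?w (carrier R) (aug M'))" by (rule R.central_mod_mono[OF cy augM])
          show "R.central_mod ?x (R.lin ?y (carrier R) (R.lin ?w (carrier R) (aug M')))"
            by (rule R.central_mod_mono[OF cx mono])
          show "R.V 1 \<subseteq> R.lin ?x (carrier R) (R.lin ?y (carrier R) (R.lin ?w (carrier R) (aug M')))"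
            using V1 R.lin_mono[OF order_refl mono, of ?x "carrier R"] by blast
          show "?y \<odot> ?y \<in> aug M'" unfolding sq[OF cG] by (rule aug_mem[OF M'.subset c2M'])
          show "?x \<odot> ?x \<in> R.lin ?w (carrier R) (aug M')" unfolding sq[OF aG] using aug_mem[OF M.subset aa] augM by blast
        qed
        then have "R.V (4 + (p - 1) * (4 - 1)) \<subseteq> aug M'"
          by (rule V_power_step_aug[OF M'(1,4,5)]) simp
        then have V7: "R.V 7 \<subseteq> aug M'" using p2 by simp
        have "card M' > 0" using finM M'(2) M'.one_closed card_gt_0_iff by (metis finite_subset empty_iff psubset_imp_subset)
        then have "7 * card M' < card N" using card M'(7) p2 by simp
        with V7 show ?thesis by (intro that[OF M'(1) _ _]) (use M'(2) M(2) in auto)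
      qed
    qed
  qed
qed

end

section \<open>Sums of geometric progressions modulo prime powers\<close>

text \<open>The sum \<open>1 + j + \<dots> + j\<^sup>i\<^sup>-\<^sup>1\<close>.\<close>

fun geometric :: "nat \<Rightarrow> nat \<Rightarrow> nat" where
  "geometric j 0 = 0"
| "geometric j (Suc i) = 1 + j * geometric j i"

lemma geometric_mult: "geometric j (m * n) = geometric j m * geometric (j ^ m) n"
proof -
  have add: "geometric j (a + b) = geometric j a + j ^ a * geometric j b" for a b
    by (induction a) (simp_all add: algebra_simps)
  show ?thesis by (induction n) (simp_all add: add algebra_simps)
qed

lemma power_one_plus_mult: "\<exists>t'. (1 + r * t) ^ n = 1 + r * (t' :: nat)"
proof (induction n)
  case 0 then show ?case by (intro exI[of _ 0]) simp
next
  case (Suc n)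
  then obtain t' where "(1 + r * t) ^ n = 1 + r * t'" by blast
  then have "(1 + r * t) ^ Suc n = 1 + r * (t + t' + r * t * t')" by (simp add: algebra_simps)
  then show ?case by blast
qed

lemma geometric_expansion: "\<exists>v. geometric (1 + p * t) i = i + p * t * (i choose 2) + p * p * v"
proof (induction i)
  case 0 then show ?case by simp
next
  case (Suc i)
  then obtain v where v: "geometric (1 + p * t) i = i + p * t * (i choose 2) + p * p * v" by blast
  have "Suc i choose 2 = i + (i choose 2)" by (simp add: numeral_2_eq_2)
  then have "geometric (1 + p * t) (Suc i) = Suc i + p * t * (Suc i choose 2) + p * p * (v + t * t * (i choose 2) + p * t * v)"
    unfolding geometric.simps v by (simp add: algebra_simps)
  then show ?case by blast
qed

text \<open>
  For \<open>p = 2\<close> the base has to be \<open>1\<close> modulo \<open>4\<close>: the sum \<open>1 + 3 = 4\<close> is divisible by too high a power.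
\<close>

lemma geometric_prime:
  assumes "prime p" shows "\<exists>v. geometric (1 + (if p = 2 then 4 else p) * t) p = p * (1 + p * v)"
proof (cases "p = 2")
  case True
  then show ?thesis by (intro exI[of _ t]) (simp add: numeral_2_eq_2)
next
  case False
  then have "2 < p" using assms prime_ge_2_nat[of p] by simp
  then have "p dvd (p choose 2)" using assms by (intro dvd_choose_prime) auto
  then obtain w where w: "p choose 2 = p * w" by auto
  obtain v where "geometric (1 + p * t) p = p + p * t * (p choose 2) + p * p * v" using geometric_expansion by blast
  then have "geometric (1 + p * t) p = p * (1 + p * (t * w + v))" unfolding w by (simp add: algebra_simps)
  then show ?thesis using False by auto
qed

text \<open>
  Write \<open>i = p i'\<close> and split the sum into \<open>i'\<close> blocks of length \<open>p\<close>. A block has exactly one factor \<open>p\<close>, and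
  the block sums form a geometric progression with base \<open>j\<^sup>p\<close> of the same kind.
\<close>

lemma prime_power_dvd_geometric:
  assumes p: "prime p"
  shows "p ^ k dvd geometric (1 + (if p = 2 then 4 else p) * t) i \<Longrightarrow> p ^ k dvd i"
proof (induction k arbitrary: i t)
  case (Suc k)
  let ?r = "if p = 2 then 4 else p"
  obtain r' where r': "?r = p * r'" by (metis dvd_refl dvd_triv_left mult_2_right numeral_Bit0 dvdE mult.right_neutral)
  obtain v where "geometric (1 + p * (r' * t)) i = i + p * (r' * t) * (i choose 2) + p * p * v"
    using geometric_expansion by blast
  then have i: "geometric (1 + ?r * t) i = i + p * (r' * t * (i choose 2) + p * v)"
    unfolding r' by (simp add: algebra_simps)
  have "p dvd geometric (1 + ?r * t) i" using Suc.prems by (metis dvd_mult_left power_Suc)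
  then have "p dvd i" unfolding i by (simp add: dvd_add_left_iff)
  then obtain i' where i': "i = p * i'" by auto
  obtain t' where t': "(1 + ?r * t) ^ p = 1 + ?r * t'" using power_one_plus_mult by blast
  obtain w where w: "geometric (1 + ?r * t) p = p * (1 + p * w)" using geometric_prime[OF p] by blast
  have "p * p ^ k dvd p * ((1 + p * w) * geometric (1 + ?r * t') i')"
    using Suc.prems unfolding i' geometric_mult w t' power_Suc mult.assoc .
  then have "p ^ k dvd (1 + p * w) * geometric (1 + ?r * t') i'"
    using nat_mult_dvd_cancel1[OF prime_gt_0_nat[OF p]] by blast
  moreover have "coprime (p ^ k) (1 + p * w)"
  proof -
    have "\<not> p dvd 1 + p * w" using p by (metis dvd_add_left_iff dvd_triv_left not_prime_unit)
    then show ?thesis using prime_imp_coprime[OF p] by (simp add: coprime_power_left_iff)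
  qed
  ultimately have "p ^ k dvd geometric (1 + ?r * t') i'" using coprime_dvd_mult_right_iff by blast
  then have "p ^ k dvd i'" by (rule Suc.IH)
  then show ?case unfolding i' by simp
qed simp

section \<open>The lower bound\<close>

context group
begin

lemma conj_by_power:
  assumes a: "a \<in> carrier G" and b: "b \<in> carrier G" and e: "e = gc a b" and j: "inv b \<otimes> e \<otimes> b = e [^] (j::nat)"
  shows "a \<otimes> b [^] i = b [^] i \<otimes> (a \<otimes> e [^] geometric j i)"
proof (induction i)
  case 0 then show ?case using a b by simp
next
  case (Suc i)
  have eG: "e \<in> carrier G" using a b e by simp
  have ab: "a \<otimes> b = b \<otimes> (a \<otimes> e)" using mult_gc[OF a b] a b e by (simp add: m_assoc)
  have eb: "e [^] k \<otimes> b = b \<otimes> e [^] (j * k)" for k :: nat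
  proof -
    have "inv b \<otimes> e [^] k \<otimes> b = (e [^] j) [^] k"
      using conj_pow_nat[OF eG inv_closed[OF b], of k] b j by simp
    then have "b \<otimes> (inv b \<otimes> e [^] k \<otimes> b) = b \<otimes> e [^] (j * k)" using eG by (simp add: nat_pow_pow)
    then show ?thesis using b eG by (simp add: m_assoc mult_inv_cancel)
  qed
  have "a \<otimes> b [^] Suc i = b [^] i \<otimes> (a \<otimes> e [^] geometric j i) \<otimes> b"
    using Suc a b by (simp add: m_assoc[symmetric])
  also have "\<dots> = b [^] i \<otimes> (a \<otimes> (e [^] geometric j i \<otimes> b))" using a b eG by (simp add: m_assoc)
  also have "\<dots> = b [^] i \<otimes> ((a \<otimes> b) \<otimes> e [^] (j * geometric j i))" unfolding eb using a b eG by (simp add: m_assoc)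
  also have "\<dots> = b [^] i \<otimes> (b \<otimes> (a \<otimes> (e \<otimes> e [^] (j * geometric j i))))" unfolding ab using a b eG by (simp add: m_assoc)
  also have "e \<otimes> e [^] (j * geometric j i) = e [^] geometric j (Suc i)"
    using nat_pow_Suc2[OF eG, of "j * geometric j i"] by (simp only: geometric.simps plus_1_eq_Suc)
  also have "b [^] i \<otimes> (b \<otimes> (a \<otimes> e [^] geometric j (Suc i))) = b [^] Suc i \<otimes> (a \<otimes> e [^] geometric j (Suc i))"
    using a b eG by (simp add: m_assoc)
  finally show ?case .
qed

end

context group_ring
begin

lemma R_uminus_apply: assumes "a \<in> carrier R" shows "(\<ominus>\<^bsub>R\<^esub> a) x = \<ominus>\<^bsub>K\<^esub> a x"
proof -
  have c: "\<ominus>\<^bsub>R\<^esub> a \<in> carrier R" using assms by simp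
  have "(\<ominus>\<^bsub>R\<^esub> a) x \<oplus>\<^bsub>K\<^esub> a x = (\<ominus>\<^bsub>R\<^esub> a \<oplus>\<^bsub>R\<^esub> a) x" by (simp add: R_simps(5))
  also have "\<dots> = \<zero>\<^bsub>K\<^esub>" using assms by (simp add: R.l_neg) (simp add: R_simps(4))
  finally show ?thesis using R_carrierD[OF assms] R_carrierD[OF c] by (intro K.minus_equality[symmetric]) auto
qed

lemma mult_delta:
  assumes f: "f \<in> carrier R" and b: "b \<in> carrier G" and x: "x \<in> carrier G"
  shows "(f \<odot> \<delta> b) x = f (x \<otimes> inv b)"
  using f
proof (induction f rule: R_induct)
  case zero
  show ?case using b by (simp add: R_simps(4)[symmetric]) (simp add: R_simps(4))
next
  case (monomial k g)
  have "x = g \<otimes> b \<longleftrightarrow> x \<otimes> inv b = g" using x b monomial by (metis inv_solve_right)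
  then show ?case using b monomial by (simp add: monomial_mult_monomial) (simp add: monomial_def)
next
  case (add f h)
  then show ?case using b by (simp add: R.l_distr) (simp add: R_simps(5))
qed

lemma bracket_delta_apply:
  assumes f: "f \<in> carrier R" and b: "b \<in> carrier G" and x: "x \<in> carrier G"
  shows "lie_bracket R f (\<delta> b) x = f (x \<otimes> inv b) \<ominus>\<^bsub>K\<^esub> f (inv b \<otimes> x)"
proof -
  have "lie_bracket R f (\<delta> b) x = (f \<odot> \<delta> b) x \<oplus>\<^bsub>K\<^esub> (\<ominus>\<^bsub>R\<^esub> (\<delta> b \<odot> f)) x"
    by (simp add: lie_bracket_def R.minus_eq) (simp add: R_simps(5))
  also have "\<dots> = f (x \<otimes> inv b) \<oplus>\<^bsub>K\<^esub> \<ominus>\<^bsub>K\<^esub> f (inv b \<otimes> x)"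
    using mult_delta[OF assms] monomial_mult[OF K.one_closed b f x] R_uminus_apply[of "\<delta> b \<odot> f" x] f b
      R_carrierD[OF f] by simp
  finally show ?thesis by (simp add: K.minus_eq)
qed

text \<open>
  The witness is \<open>[a, b, \<dots>, b]\<close> with \<open>n - 1\<close> entries \<open>b\<close>, a combination of the group elements
  \<open>b\<^sup>i a b\<^sup>n\<^sup>-\<^sup>1\<^sup>-\<^sup>i\<close>. The one for \<open>i = 0\<close> differs from all others and has coefficient \<open>1\<close>.
\<close>

lemma T_nonzero:
  assumes a: "a \<in> carrier G" and b: "b \<in> carrier G" and n: "n \<ge> 1"
    and nc: "\<And>i. 0 < i \<Longrightarrow> i < n \<Longrightarrow> a \<otimes> b [^] (i::nat) \<noteq> b [^] i \<otimes> a"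
  shows "R.T n \<noteq> {\<zero>\<^bsub>R\<^esub>}"
proof -
  have "\<exists>f\<in>R.commutators (Suc k). f (a \<otimes> b [^] k) = \<one>\<^bsub>K\<^esub> \<and>
      (\<forall>x\<in>carrier G. f x \<noteq> \<zero>\<^bsub>K\<^esub> \<longrightarrow> (\<exists>i\<le>k. x = b [^] i \<otimes> a \<otimes> b [^] (k - i)))" if "k < n" for k
    using that
  proof (induction k)
    case 0
    show ?case
    proof (intro bexI[of _ "\<delta> a"] conjI ballI impI)
      show "\<delta> a \<in> R.commutators (Suc 0)" using a by (simp add: R.commutators_1)
    qed (use a in \<open>auto simp: monomial_def split: if_splits\<close>)
  next
    case (Suc k)
    then obtain f where f: "f \<in> R.commutators (Suc k)" "f (a \<otimes> b [^] k) = \<one>\<^bsub>K\<^esub>"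
      and supp: "\<And>x. x \<in> carrier G \<Longrightarrow> f x \<noteq> \<zero>\<^bsub>K\<^esub> \<Longrightarrow> \<exists>i\<le>k. x = b [^] i \<otimes> a \<otimes> b [^] (k - i)" by auto
    have fR: "f \<in> carrier R" using f(1) R.commutators_carrier by auto
    note fK = R_carrierD(1)[OF fR]
    show ?case
    proof (intro bexI[of _ "lie_bracket R f (\<delta> b)"] conjI ballI impI)
      show "lie_bracket R f (\<delta> b) \<in> R.commutators (Suc (Suc k))"
        using f(1) b by (intro R.commutators_SucI) auto
      have "f (inv b \<otimes> (a \<otimes> b [^] Suc k)) = \<zero>\<^bsub>K\<^esub>"
      proof (rule ccontr)
        assume "f (inv b \<otimes> (a \<otimes> b [^] Suc k)) \<noteq> \<zero>\<^bsub>K\<^esub>"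
        then obtain i where i: "i \<le> k" "inv b \<otimes> (a \<otimes> b [^] Suc k) = b [^] i \<otimes> a \<otimes> b [^] (k - i)"
          using supp[of "inv b \<otimes> (a \<otimes> b [^] Suc k)"] a b by auto
        then have "b \<otimes> (inv b \<otimes> (a \<otimes> b [^] Suc k)) = b \<otimes> (b [^] i \<otimes> a \<otimes> b [^] (k - i))" by simp
        then have e: "a \<otimes> b [^] Suc k = b [^] Suc i \<otimes> a \<otimes> b [^] (k - i)"
          using a b by (simp only: mult_inv_cancel nat_pow_Suc2 m_assoc m_closed nat_pow_closed)
        have "b [^] Suc k = b [^] Suc i \<otimes> b [^] (k - i)" using i(1) nat_pow_mult[OF b, of "Suc i" "k - i"] by simp
        then have "(a \<otimes> b [^] Suc i) \<otimes> b [^] (k - i) = (b [^] Suc i \<otimes> a) \<otimes> b [^] (k - i)"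
          using e a b by (simp add: m_assoc del: nat_pow_Suc)
        then have "a \<otimes> b [^] Suc i = b [^] Suc i \<otimes> a" using a b by (simp add: del: nat_pow_Suc)
        then show False using nc[of "Suc i"] i(1) Suc.prems by simp
      qed
      moreover have "a \<otimes> b [^] Suc k \<otimes> inv b = a \<otimes> b [^] k" using a b by (simp add: m_assoc)
      ultimately show "lie_bracket R f (\<delta> b) (a \<otimes> b [^] Suc k) = \<one>\<^bsub>K\<^esub>"
        using bracket_delta_apply[OF fR b, of "a \<otimes> b [^] Suc k"] a b f(2) by (simp add: K.minus_eq del: nat_pow_Suc)
      fix x assume x: "x \<in> carrier G" and nz: "lie_bracket R f (\<delta> b) x \<noteq> \<zero>\<^bsub>K\<^esub>"
      have "f (x \<otimes> inv b) \<noteq> \<zero>\<^bsub>K\<^esub> \<or> f (inv b \<otimes> x) \<noteq> \<zero>\<^bsub>K\<^esub>"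
        using nz bracket_delta_apply[OF fR b x] by (auto simp: K.minus_eq)
      then show "\<exists>i\<le>Suc k. x = b [^] i \<otimes> a \<otimes> b [^] (Suc k - i)"
      proof
        assume "f (x \<otimes> inv b) \<noteq> \<zero>\<^bsub>K\<^esub>"
        then obtain i where i: "i \<le> k" "x \<otimes> inv b = b [^] i \<otimes> a \<otimes> b [^] (k - i)" using supp[of "x \<otimes> inv b"] x b by auto
        have "x = b [^] i \<otimes> a \<otimes> b [^] (k - i) \<otimes> b" using i(2) x a b by (metis inv_solve_right m_closed nat_pow_closed)
        also have "\<dots> = b [^] i \<otimes> a \<otimes> b [^] (Suc k - i)" using i(1) a b by (simp add: Suc_diff_le m_assoc)
        finally show ?thesis using i(1) by (intro exI[of _ i]) auto
      next
        assume "f (inv b \<otimes> x) \<noteq> \<zero>\<^bsub>K\<^esub>"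
        then obtain i where i: "i \<le> k" "inv b \<otimes> x = b [^] i \<otimes> a \<otimes> b [^] (k - i)" using supp[of "inv b \<otimes> x"] x b by auto
        then have "b \<otimes> (inv b \<otimes> x) = b \<otimes> (b [^] i \<otimes> a \<otimes> b [^] (k - i))" by simp
        then have "x = b [^] Suc i \<otimes> a \<otimes> b [^] (Suc k - Suc i)"
          using x a b by (simp only: mult_inv_cancel nat_pow_Suc2 m_assoc m_closed nat_pow_closed diff_Suc_Suc)
        then show ?thesis using i(1) by (intro exI[of _ "Suc i"]) auto
      qed
    qed
  qed
  from this[of "n - 1"] n obtain f where f: "f \<in> R.commutators n" "f (a \<otimes> b [^] (n - 1)) = \<one>\<^bsub>K\<^esub>" by auto
  then have "f \<noteq> \<zero>\<^bsub>R\<^esub>" by (auto simp: R_simps(4))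
  then show ?thesis using R.commutators_T[OF f(1)] by auto
qed

end

context lie_nilpotent_group_ring
begin

lemma adjoin_one_eq: "c \<in> carrier G \<Longrightarrow> adjoin c {\<one>} = {c [^] i | i::nat. True}"
  by (auto simp: adjoin_def)

lemma adjoin_one_pow: "c \<in> carrier G \<Longrightarrow> c [^] (i::nat) \<in> adjoin c {\<one>}"
  unfolding adjoin_one_eq by blast

lemma adjoin_one_subgroup:
  assumes "c \<in> N" shows "subgroup (adjoin c {\<one>}) G" "c \<in> adjoin c {\<one>}"
  using normal.adjoin_subgroup[OF one_is_normal N_carrier[OF assms], of "p ^ Suc m"] derived_torsion[OF assms] p_pos by auto

lemma cyclic_mod_one_iff: "cyclic_mod {\<one>} \<longleftrightarrow> cyclic_group (G\<lparr>carrier := N\<rparr>)"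
proof -
  interpret H: group "G\<lparr>carrier := N\<rparr>" by (rule subgroup_imp_group[OF N_subgroup])
  have ip: "x [^]\<^bsub>G\<lparr>carrier := N\<rparr>\<^esub> (k::int) = x [^] k" if "x \<in> N" for x k
    using int_pow_consistent[OF N_subgroup that] by simp
  have "cyclic_group (G\<lparr>carrier := N\<rparr>) \<longleftrightarrow> (\<exists>x\<in>N. N = range (\<lambda>n::int. x [^] n))"
    unfolding H.cyclic_group using ip by (auto simp: image_def)
  also have "\<dots> \<longleftrightarrow> (\<exists>x\<in>N. N \<subseteq> adjoin x {\<one>})"
  proof (intro bex_cong refl)
    fix x assume x: "x \<in> N"
    note xG = N_carrier[OF x]
    have A: "range (\<lambda>n::int. x [^] n) = adjoin x {\<one>}"
    proof
      show "range (\<lambda>n::int. x [^] n) \<subseteq> adjoin x {\<one>}"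
        using subgroup_int_pow_closed[OF adjoin_one_subgroup[OF x]] by auto
      show "adjoin x {\<one>} \<subseteq> range (\<lambda>n::int. x [^] n)"
        unfolding adjoin_one_eq[OF xG] by (auto simp flip: int_pow_int)
    qed
    have "adjoin x {\<one>} \<subseteq> N"
      by (rule normal.adjoin_subset[OF one_is_normal N_subgroup x]) (use subgroup.one_closed[OF N_subgroup] in auto)
    then show "N = range (\<lambda>n::int. x [^] n) \<longleftrightarrow> N \<subseteq> adjoin x {\<one>}" unfolding A by auto
  qed
  finally show ?thesis by (simp add: cyclic_mod_def)
qed

lemma adjoin_one_finite: "c \<in> N \<Longrightarrow> finite (adjoin c {\<one>}) \<and> card (adjoin c {\<one>}) \<le> ord c"
proof -
  assume c: "c \<in> N"
  have cG: "c \<in> carrier G" using N_carrier[OF c] .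
  have "ord c dvd p ^ Suc m" using pow_eq_id[OF cG] derived_torsion[OF c] by blast
  then have o: "ord c > 0" using p_pos by (metis dvd_pos_nat zero_less_power)
  have "adjoin c {\<one>} \<subseteq> (\<lambda>i. c [^] i) ` {..<ord c}"
  proof
    fix x assume "x \<in> adjoin c {\<one>}"
    then obtain i :: nat where x: "x = c [^] i" unfolding adjoin_one_eq[OF cG] by blast
    have "c [^] i = c [^] (ord c * (i div ord c)) \<otimes> c [^] (i mod ord c)" using cG by (simp add: nat_pow_mult)
    also have "c [^] (ord c * (i div ord c)) = \<one>" using pow_eq_id[OF cG] by simp
    finally show "x \<in> (\<lambda>i. c [^] i) ` {..<ord c}" using x o cG by auto
  qed
  then have "finite (adjoin c {\<one>})" "card (adjoin c {\<one>}) \<le> card ((\<lambda>i. c [^] i) ` {..<ord c})"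
    by (auto intro: finite_subset card_mono)
  then show ?thesis using card_image_le[of "{..<ord c}" "\<lambda>i. c [^] i"] by simp
qed

lemma cyclic_finite: "cyclic_mod {\<one>} \<Longrightarrow> finite N"
  using adjoin_one_finite finite_subset by (auto simp: cyclic_mod_def)

lemma power_adjoin_normal:
  assumes d: "d \<in> N" "N \<subseteq> adjoin d {\<one>}"
  shows "adjoin (d [^] (r::nat)) {\<one>} \<lhd> G"
proof (rule normal.adjoin_normalI[OF one_is_normal])
  have dG: "d \<in> carrier G" using d N_carrier by auto
  then show "d [^] r \<in> carrier G" by simp
  have "(d [^] r) [^] (p ^ Suc m) = (d [^] (p ^ Suc m)) [^] r" using dG by (simp only: nat_pow_pow mult.commute)
  then show "(d [^] r) [^] (p ^ Suc m) \<in> {\<one>}" using derived_torsion[OF d(1)] by simp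
  show "p ^ Suc m > 0" using p_pos by simp
  fix g assume g: "g \<in> carrier G"
  have "g \<otimes> d \<otimes> inv g \<in> N" by (rule normal.inv_op_closed2[OF derived_normal g d(1)])
  then obtain i :: nat where i: "g \<otimes> d \<otimes> inv g = d [^] i" using d(2) unfolding adjoin_one_eq[OF dG] by blast
  have "g \<otimes> d [^] r \<otimes> inv g = (d [^] r) [^] i"
    using conj_pow_nat[OF dG g, of r] i dG by (simp add: nat_pow_pow mult.commute)
  then show "g \<otimes> d [^] r \<otimes> inv g \<in> adjoin (d [^] r) {\<one>}" using dG by (auto simp: adjoin_one_eq)
qed

lemma generator_not_pth_power:
  assumes d: "d \<in> N" "d \<in> adjoin (d [^] p) {\<one>}" shows "d = \<one>"
  using mem_of_mem_adjoin_pow[OF one_is_normal d] by simp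

text \<open>
  A commutator outside the subgroup of \<open>p\<close>-th powers generates \<open>N\<close>, and \<open>G\<close> acts on \<open>N\<close> by exponents that are
  \<open>1\<close> modulo \<open>p\<close>. For \<open>p = 2\<close> the exponents are \<open>1\<close> or \<open>3\<close> modulo \<open>4\<close>. Since \<open>(a, b)\<close>, \<open>(b, a)\<close> and
  \<open>(a, a b)\<close> all generate \<open>N\<close>, and one of \<open>b\<close>, \<open>a\<close>, \<open>a b\<close> acts by an exponent that is \<open>1\<close> modulo \<open>4\<close>, the
  second entry can be chosen in this way.
\<close>

lemma cyclic_generating_commutator:
  assumes cyc: "cyclic_mod {\<one>}" and nt: "N \<noteq> {\<one>}"
  obtains a b where "a \<in> carrier G" "b \<in> carrier G" "N \<subseteq> adjoin (gc a b) {\<one>}"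
    "gc (gc a b) b \<in> adjoin (gc a b [^] (if p = 2 then 4 else p)) {\<one>}"
proof -
  obtain c where c: "c \<in> N" "N \<subseteq> adjoin c {\<one>}" using cyc by (auto simp: cyclic_mod_def)
  have cG: "c \<in> carrier G" using c N_carrier by auto
  have "c \<noteq> \<one>"
  proof
    assume "c = \<one>"
    then have "N \<subseteq> {\<one>}" using c(2) by (auto simp: adjoin_one_eq)
    then show False using nt subgroup.one_closed[OF N_subgroup] by auto
  qed
  then have cP: "c \<notin> adjoin (c [^] p) {\<one>}" using generator_not_pth_power[OF c(1)] by auto
  \<comment> \<open>the \<open>p\<close>-th powers form a proper subgroup, so some commutator avoids them and then generates \<open>N\<close>\<close>
  have "\<not> N \<subseteq> adjoin (c [^] p) {\<one>}" using cP c(1) by auto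
  then obtain a b where a: "a \<in> carrier G" and b: "b \<in> carrier G" and ab: "gc a b \<notin> adjoin (c [^] p) {\<one>}"
    using derived_minimal[OF normal_imp_subgroup[OF power_adjoin_normal[OF c, of p]]] by blast
  define d where "d = gc a b"
  have d: "d \<in> N" unfolding d_def using gc_derived[OF a b] .
  have dG: "d \<in> carrier G" using d N_carrier by auto
  have gen: "x \<in> S" if S: "subgroup S G" and x: "x \<in> N" and i: "x [^] (i::nat) \<in> S" "\<not> p dvd i" for x S i
    by (rule pow_coprime_mem[OF S N_carrier[OF x] i(1) _ torsion_coprime[OF i(2)]])
       (use derived_torsion[OF x] subgroup.one_closed[OF S] in auto)
  obtain i :: nat where i: "d = c [^] i" using d c(2) cG by (auto simp: adjoin_one_eq)
  have "\<not> p dvd i"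
  proof
    assume "p dvd i"
    then obtain k where "i = p * k" by auto
    then have "d = (c [^] p) [^] k" using i cG by (simp add: nat_pow_pow)
    then show False using ab adjoin_one_pow[of "c [^] p" k] cG by (simp add: d_def)
  qed
  then have "c \<in> adjoin d {\<one>}" using gen[OF adjoin_one_subgroup(1)[OF d] c(1), of i] adjoin_one_subgroup(2)[OF d] i by simp
  then have "adjoin c {\<one>} \<subseteq> adjoin d {\<one>}"
    by (intro normal.adjoin_subset[OF one_is_normal adjoin_one_subgroup(1)[OF d]])
       (use subgroup.one_closed[OF adjoin_one_subgroup(1)[OF d]] in auto)
  then have Nd: "N \<subseteq> adjoin d {\<one>}" using c(2) by auto
  have "d \<noteq> \<one>" using Nd nt subgroup.one_closed[OF N_subgroup] by (auto simp: adjoin_one_eq)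
  then have dP: "d \<notin> adjoin (d [^] p) {\<one>}" using generator_not_pth_power[OF d] by auto
  let ?P = "adjoin (d [^] p) {\<one>}"
  have P: "?P \<lhd> G" by (rule power_adjoin_normal[OF d Nd])
  interpret P: normal ?P G by (rule P)
  have dpN: "d [^] k \<in> N" for k :: nat using subgroup_nat_pow_closed[OF N_subgroup d] .
  \<comment> \<open>nilpotency enters here: a nontrivial central element of \<open>N / ?P\<close> generates this group of order \<open>p\<close>\<close>
  have "?P \<subset> N"
    using normal.adjoin_subset[OF one_is_normal N_subgroup dpN, of p] subgroup.one_closed[OF N_subgroup] dP d by auto
  then obtain u where u: "u \<in> N" "u \<notin> ?P" "u \<in> centralizer_mod ?P"
    by (rule central_element_exists[OF P derived_normal _ order_refl])
  obtain k :: nat where k: "u = d [^] k" using subsetD[OF Nd u(1)] unfolding adjoin_one_eq[OF dG] by blast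
  have "\<not> p dvd k"
  proof
    assume "p dvd k"
    then obtain l where "k = p * l" by auto
    then have "u = (d [^] p) [^] l" using k dG by (simp add: nat_pow_pow)
    then show False using u(2) adjoin_one_pow[of "d [^] p" l] dG by simp
  qed
  then have dZ: "d \<in> centralizer_mod ?P" using gen[OF P.centralizer_mod_subgroup d, of k] u(3) k by simp
  have dg: "gc d g \<in> ?P" if "g \<in> carrier G" for g using that dZ unfolding centralizer_mod_def by blast
  show thesis
  proof (cases "p = 2")
    case False
    show ?thesis by (rule that[OF a b Nd[unfolded d_def]]) (use False dg[OF b] in \<open>simp only: d_def if_False\<close>)
  next
    case True
    let ?F = "adjoin (d [^] (4::nat)) {\<one>}"
    have F: "?F \<lhd> G" by (rule power_adjoin_normal[OF d Nd])
    interpret F: normal ?F G by (rule F)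
    \<comment> \<open>modulo fourth powers every \<open>g\<close> fixes or inverts \<open>d\<close>, so the product of two inverting elements fixes it\<close>
    have inv: "gc d g \<in> ?F \<or> gc d g \<otimes> (d \<otimes> d) \<in> ?F" if g: "g \<in> carrier G" for g
    proof -
      obtain k :: nat where k: "gc d g = (d [^] p) [^] k" using dg[OF g] adjoin_one_eq[of "d [^] p"] dG by blast
      then have k: "gc d g = d [^] (2 * k)" using dG True by (simp add: nat_pow_pow)
      have F_mem: "d [^] (4 * l) \<in> ?F" for l :: nat using adjoin_one_pow[of "d [^] (4::nat)" l] dG by (simp add: nat_pow_pow)
      show ?thesis
      proof (cases "even k")
        case True
        then obtain l where "k = 2 * l" by (auto elim: evenE)
        then have "gc d g = d [^] (4 * l)" using k by simp
        then show ?thesis using F_mem by simp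
      next
        case False
        then obtain l where l: "k = 2 * l + 1" by (auto elim: oddE)
        have "gc d g \<otimes> (d \<otimes> d) = d [^] (2 * k + 2)" using k dG by (simp add: numeral_2_eq_2 m_assoc)
        also have "2 * k + 2 = 4 * (l + 1)" using l by simp
        finally have "gc d g \<otimes> (d \<otimes> d) = d [^] (4 * (l + 1))" .
        then show ?thesis using F_mem[of "l + 1"] by argo
      qed
    qed
    consider "gc d b \<in> ?F" | "gc d a \<in> ?F" | "gc d b \<notin> ?F" "gc d a \<notin> ?F" by blast
    then show ?thesis
    proof cases
      case 1
      then have "gc (gc a b) b \<in> adjoin (gc a b [^] (if p = 2 then 4 else p)) {\<one>}"
        unfolding d_def[symmetric] True by auto
      then show ?thesis by (rule that[OF a b Nd[unfolded d_def]])
    next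
      case 2
      have e: "gc b a = inv d" unfolding d_def by (rule gc_swap[OF a b])
      have eN: "inv d \<in> N" by (rule subgroup.m_inv_closed[OF N_subgroup d])
      have "inv (inv d) \<in> adjoin (inv d) {\<one>}"
        by (rule subgroup.m_inv_closed[OF adjoin_one_subgroup[OF eN]])
      then have "adjoin d {\<one>} \<subseteq> adjoin (inv d) {\<one>}"
        using dG subgroup.one_closed[OF adjoin_one_subgroup(1)[OF eN]]
        by (intro normal.adjoin_subset[OF one_is_normal adjoin_one_subgroup(1)[OF eN]]) auto
      then have 1: "N \<subseteq> adjoin (gc b a) {\<one>}" using Nd e by auto
      have e4N: "inv d [^] (4::nat) \<in> N" by (rule subgroup_nat_pow_closed[OF N_subgroup eN])
      have "inv (inv d [^] (4::nat)) \<in> adjoin (inv d [^] (4::nat)) {\<one>}"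
        by (rule subgroup.m_inv_closed[OF adjoin_one_subgroup[OF e4N]])
      then have "d [^] (4::nat) \<in> adjoin (inv d [^] (4::nat)) {\<one>}"
        using dG by (simp add: nat_pow_inv)
      then have 2: "?F \<subseteq> adjoin (inv d [^] (4::nat)) {\<one>}"
        using subgroup.one_closed[OF adjoin_one_subgroup(1)[OF e4N]]
        by (intro normal.adjoin_subset[OF one_is_normal adjoin_one_subgroup(1)[OF e4N]]) auto
      have "subgroup {x \<in> carrier G. \<forall>g\<in>{a}. gc x g \<in> ?F} G"
        by (rule F.commuting_mod_subgroup) (use a in auto)
      then have "inv d \<in> {x \<in> carrier G. \<forall>g\<in>{a}. gc x g \<in> ?F}"
        by (rule subgroup.m_inv_closed) (use dG \<open>gc d a \<in> ?F\<close> in auto)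
      then have "gc (gc b a) a \<in> adjoin (gc b a [^] (if p = 2 then 4 else p)) {\<one>}"
        using 2 unfolding e True by auto
      then show ?thesis by (rule that[OF b a 1])
    next
      case 3
      have ab: "a \<otimes> b \<in> carrier G" using a b by simp
      have e: "gc a (a \<otimes> b) = d"
        unfolding d_def group_commutator_def using a b by (simp add: inv_mult_group m_assoc mult_inv_cancel)
      have "gc d (a \<otimes> b) \<in> ?F" by (rule F.inversion_parity[OF dG inv a 3(2) b 3(1)])
      then have 1: "gc (gc a (a \<otimes> b)) (a \<otimes> b) \<in> adjoin (gc a (a \<otimes> b) [^] (if p = 2 then 4 else p)) {\<one>}"
        unfolding e True by auto
      have 2: "N \<subseteq> adjoin (gc a (a \<otimes> b)) {\<one>}" unfolding e by (rule Nd)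
      show ?thesis by (rule that[OF a ab 2 1])
    qed
  qed
qed

text \<open>
  If \<open>e = (a, b)\<close> and \<open>b\<^sup>-\<^sup>1 e b = e\<^sup>j\<close>, then \<open>b\<^sup>-\<^sup>i a b\<^sup>i = a e\<^sup>s\<close> where \<open>s\<close> is the sum \<open>geometric j i\<close>; so
  \<open>a\<close> commutes with \<open>b\<^sup>i\<close> only if the order of \<open>e\<close> divides \<open>i\<close>.
\<close>

lemma cyclic_lower_bound:
  assumes cyc: "cyclic_mod {\<one>}"
  shows "R.T (card N) \<noteq> {\<zero>\<^bsub>R\<^esub>}"
proof (cases "N = {\<one>}")
  case True
  then show ?thesis using T_nonzero[of \<one> \<one> 1] by simp
next
  case False
  let ?r = "if p = 2 then 4 else p"
  obtain a b where a: "a \<in> carrier G" and b: "b \<in> carrier G" and gen: "N \<subseteq> adjoin (gc a b) {\<one>}"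
    and act: "gc (gc a b) b \<in> adjoin (gc a b [^] ?r) {\<one>}"
    by (rule cyclic_generating_commutator[OF cyc False])
  define e where "e = gc a b"
  have eN: "e \<in> N" unfolding e_def using gc_derived[OF a b] .
  have eG: "e \<in> carrier G" using eN N_carrier by auto
  obtain t :: nat where t: "gc e b = (e [^] ?r) [^] t" using act eG by (auto simp: e_def adjoin_one_eq)
  have j: "inv b \<otimes> e \<otimes> b = e [^] (1 + ?r * t)"
  proof -
    have "inv b \<otimes> e \<otimes> b = e \<otimes> e [^] (?r * t)" using conj_eq_mult_gc[OF eG b] t eG by (simp only: nat_pow_pow)
    then show ?thesis using eG by (simp only: nat_pow_Suc2[symmetric] plus_1_eq_Suc)
  qed
  have "card N \<le> card (adjoin e {\<one>})" using adjoin_one_finite[OF eN] gen by (intro card_mono) (auto simp: e_def)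
  then have cardN: "card N \<le> ord e" using adjoin_one_finite[OF eN] by simp
  have "ord e dvd p ^ Suc m" using pow_eq_id[OF eG] derived_torsion[OF eN] by blast
  then obtain k where k: "ord e = p ^ k" using prime divides_primepow_nat by blast
  show ?thesis
  proof (rule T_nonzero[OF a b])
    show "card N \<ge> 1" using cyclic_finite[OF cyc] eN card_gt_0_iff[of N] by (auto simp: Suc_le_eq)
    fix i assume i: "0 < i" "i < card N"
    show "a \<otimes> b [^] i \<noteq> b [^] i \<otimes> a"
    proof
      assume c: "a \<otimes> b [^] i = b [^] i \<otimes> a"
      have "b [^] i \<otimes> (a \<otimes> e [^] geometric (1 + ?r * t) i) = b [^] i \<otimes> (a \<otimes> \<one>)"
        using conj_by_power[OF a b e_def j, of i] c a by simp
      then have "e [^] geometric (1 + ?r * t) i = \<one>" using a b eG left_cancel by simp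
      then have "p ^ k dvd geometric (1 + ?r * t) i" using pow_eq_id[OF eG] k by simp
      then have "p ^ k dvd i" by (rule prime_power_dvd_geometric[OF prime])
      then show False using i cardN k by (auto dest: dvd_imp_le)
    qed
  qed
qed

text \<open>
  Let \<open>c\<close> be the central involution in \<open>N\<close> and \<open>L = {1, c}\<close>. It suffices to find \<open>x, y\<close> such that
  \<open>d = (y, x)\<close> does not commute with \<open>x\<close>, for then \<open>x\<^sup>-\<^sup>i y x\<^sup>i\<close> is \<open>y d\<close>, \<open>y c\<close>, \<open>y d c\<close> for \<open>i = 1, 2, 3\<close>. If
  there were none, every commutator with an entry moving \<open>a\<close> would lie in \<open>L\<close>; but each element of \<open>G\<close> is a
  product of elements that move \<open>a\<close>, which gives \<open>N \<subseteq> L\<close>.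
\<close>

lemma klein_lower_bound:
  assumes p2: "p = 2" and c4: "card N = 4" and nc: "\<not> cyclic_mod {\<one>}" and g3: "lower_central G 3 \<noteq> {\<one>}"
  shows "R.T 4 \<noteq> {\<zero>\<^bsub>R\<^esub>}"
proof -
  have fin: "finite N" using c4 card.infinite by force
  obtain M c a where M: "M \<lhd> G" "M \<subseteq> N" and c: "c \<in> N" "c \<notin> M" "c \<in> centralizer_mod M" "c [^] p \<in> M"
    and L: "adjoin c M \<lhd> G" "adjoin c M \<subseteq> N"
    and a: "a \<in> N" "a \<in> centralizer_mod (adjoin c M)" "a [^] p \<in> M" "a \<notin> adjoin c M"
    and Neq: "N = adjoin a (adjoin c M)"
    by (rule elementary_section[OF fin nc])
  interpret M: normal M G by (rule M)
  interpret L: normal "adjoin c M" G by (rule L)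
  have cG: "c \<in> carrier G" and aG: "a \<in> carrier G" using c a N_carrier by auto
  have finL: "finite (adjoin c M)" using L(2) fin by (auto intro: finite_subset)
  have "p * card M \<le> card (adjoin c M)"
    by (rule M.adjoin_card[OF cG c(2,4) prime order_refl finL])
  moreover have "p * card (adjoin c M) \<le> card N"
    by (rule L.adjoin_card[OF aG a(4) _ prime _ fin]) (use a(3) M.adjoin_subgroup(2)[OF cG c(4) p_pos] Neq in auto)
  ultimately have "card M \<le> 1" using p2 c4 by simp
  moreover have "finite M" using M fin finite_subset by auto
  ultimately have M1: "M = {\<one>}" using M.one_closed by (metis card_le_Suc0_iff_eq One_nat_def singletonI subsetI subset_antisym insert_subset empty_subsetI singleton_iff)
  define L where "L = adjoin c {\<one>}"
  have Ln: "L \<lhd> G" using L(1) by (simp add: L_def M1)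
  interpret Ln: normal L G by (rule Ln)
  interpret One: normal "{\<one>}" G by (rule one_is_normal)
  have cc: "c [^] (2::nat) = \<one>" and aa: "a [^] (2::nat) = \<one>" using c(4) a(3) p2 M1 by auto
  have c_central: "c \<otimes> g = g \<otimes> c" if "g \<in> carrier G" for g
    using c(3) that cG gc_eq_one_iff[of c g] by (auto simp: M1 centralizer_mod_def)
  have L_elems: "x = \<one> \<or> x = c" if "x \<in> L" for x
  proof -
    obtain i :: nat where i: "x = c [^] i" using \<open>x \<in> L\<close> unfolding L_def adjoin_one_eq[OF cG] by blast
    have "c [^] i = (c [^] (2::nat)) [^] (i div 2) \<otimes> c [^] (i mod 2)" using cG by (simp add: nat_pow_pow nat_pow_mult)
    then have x: "x = c [^] (i mod 2)" using i cc cG by simp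
    have "i mod 2 = 0 \<or> i mod 2 = Suc 0" by auto
    then show ?thesis using x cG by (elim disjE) simp_all
  qed
  have NZ: "N \<subseteq> centralizer_mod L"
  proof -
    have "adjoin a L \<subseteq> centralizer_mod L"
      by (rule Ln.adjoin_subset[OF Ln.centralizer_mod_subgroup _ Ln.subset_centralizer_mod]) (use a(2) in \<open>simp add: L_def M1\<close>)
    then show ?thesis using Neq by (simp add: L_def M1)
  qed
  have L_comm: "x \<otimes> g = g \<otimes> x" if "x \<in> L" "g \<in> carrier G" for x g
    using L_elems[OF that(1)] c_central that(2) by auto
  obtain h where h: "h \<in> carrier G" "gc a h \<noteq> \<one>"
  proof -
    have "\<exists>h\<in>carrier G. gc a h \<noteq> \<one>"
    proof (rule ccontr)
      assume "\<not> (\<exists>h\<in>carrier G. gc a h \<noteq> \<one>)"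
      then have "a \<in> centralizer_mod {\<one>}" using aG by (auto simp: centralizer_mod_def)
      moreover have "c \<in> centralizer_mod {\<one>}" using c(3) M1 by simp
      ultimately have "adjoin a (adjoin c {\<one>}) \<subseteq> centralizer_mod {\<one>}"
        using One.subset_centralizer_mod
        by (intro One.adjoin_subset[OF One.centralizer_mod_subgroup] normal.adjoin_subset[OF Ln One.centralizer_mod_subgroup, unfolded L_def]) auto
      then have NZ1: "N \<subseteq> centralizer_mod {\<one>}" using Neq M1 by simp
      have "{gc g h |g h. g \<in> lower_central G (Suc (Suc 0)) \<and> h \<in> carrier G} \<subseteq> {\<one>}"
        using NZ1 lower_central_2 by (auto simp: centralizer_mod_def numeral_2_eq_2 simp del: lower_central.simps)
      then have "lower_central G 3 \<subseteq> {\<one>}"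
        unfolding numeral_3_eq_3 lower_central.simps(3) by (intro generate_subgroup_incl) (auto simp: One.is_subgroup)
      moreover have "\<one> \<in> lower_central G 3" unfolding numeral_3_eq_3 lower_central.simps(3) by (rule generate.one)
      ultimately show False using g3 by auto
    qed
    then show thesis using that by auto
  qed
  have noncommuting: "gc d x \<noteq> \<one>" if d: "d \<in> N" "d \<notin> L" and x: "x \<in> carrier G" "gc a x \<noteq> \<one>" for d x
  proof
    assume *: "gc d x = \<one>"
    have S: "subgroup {y \<in> carrier G. \<forall>g\<in>{x}. gc y g \<in> {\<one>}} G" (is "subgroup ?S G")
      by (rule One.commuting_mod_subgroup) (use x in auto)
    have LS: "L \<subseteq> ?S" using L_comm x gc_eq_one_iff Ln.mem_carrier by auto
    have dS: "d \<in> ?S" using d(1) N_carrier * by auto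
    have "d \<in> adjoin a L" using d(1) Neq by (simp add: L_def M1)
    then obtain i :: nat and l where l: "l \<in> L" "d = a [^] i \<otimes> l" unfolding adjoin_def by blast
    have lG: "l \<in> carrier G" using l Ln.mem_carrier by auto
    have "a [^] i = d \<otimes> inv l" using l lG aG N_carrier[OF d(1)] by (simp add: inv_solve_right)
    then have ai: "a [^] i \<in> ?S"
      using subgroup.m_closed[OF S dS subgroup.m_inv_closed[OF S subsetD[OF LS l(1)]]] by simp
    have ev: "a [^] (2 * k) = \<one>" for k :: nat using nat_pow_pow[OF aG, of 2 k] aa by simp
    have "odd i"
    proof
      assume "even i"
      then obtain k where "i = 2 * k" by (rule evenE)
      then show False using l d(2) lG ev[of k] by simp
    qed
    then obtain k where "i = Suc (2 * k)" by (auto elim: oddE)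
    then have "a [^] i = a" using ev[of k] aG by simp
    then show False using ai x(2) by simp
  qed
  obtain x y where x: "x \<in> carrier G" and y: "y \<in> carrier G" and xy: "gc (gc y x) x \<noteq> \<one>"
  proof -
    \<comment> \<open>an element of \<open>N - L\<close> commutes with \<open>x\<close> only if \<open>a\<close> does, by \<open>noncommuting\<close>\<close>
    have "\<exists>x\<in>carrier G. \<exists>y\<in>carrier G. gc (gc y x) x \<noteq> \<one>"
    proof (rule ccontr)
      assume engel: "\<not> (\<exists>x\<in>carrier G. \<exists>y\<in>carrier G. gc (gc y x) x \<noteq> \<one>)"
      have *: "gc y x \<in> L" if "x \<in> carrier G" "y \<in> carrier G" "gc a x \<noteq> \<one>" for x y
        using engel noncommuting[OF gc_derived[OF that(2,1)] _ that(1,3)] that by blast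
      have "gc y x \<in> L" if x: "x \<in> carrier G" and y: "y \<in> carrier G" for x y
      proof (cases "gc a x = \<one>")
        case True
        have S: "subgroup {g \<in> carrier G. \<forall>z\<in>{y}. gc g z \<in> L} G" (is "subgroup ?S G")
          by (rule Ln.commuting_mod_subgroup) (use y in auto)
        have "gc a (x \<otimes> h) \<noteq> \<one>"
        proof
          assume "gc a (x \<otimes> h) = \<one>"
          then have "a \<otimes> (x \<otimes> h) = x \<otimes> h \<otimes> a" using gc_eq_one_iff aG x h(1) by simp
          moreover have "a \<otimes> x = x \<otimes> a" using True gc_eq_one_iff aG x by simp
          then have "a \<otimes> (x \<otimes> h) = x \<otimes> (a \<otimes> h)" using aG x h(1) by (simp add: m_assoc[symmetric])
          ultimately have "x \<otimes> (a \<otimes> h) = x \<otimes> (h \<otimes> a)" using aG x h(1) by (simp add: m_assoc)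
          then have "a \<otimes> h = h \<otimes> a" using aG x h(1) left_cancel by simp
          then show False using h gc_eq_one_iff aG by simp
        qed
        then have "gc y (x \<otimes> h) \<in> L" using * x y h(1) by simp
        then have 1: "x \<otimes> h \<in> ?S" using Ln.gc_mem_swap[of y "x \<otimes> h"] x y h(1) by simp
        have "gc y h \<in> L" using * h y by simp
        then have 2: "h \<in> ?S" using Ln.gc_mem_swap[of y h] y h(1) by simp
        have "x = x \<otimes> h \<otimes> inv h" using x h(1) by (simp add: m_assoc)
        then have "x \<in> ?S" using subgroup.m_closed[OF S 1 subgroup.m_inv_closed[OF S 2]] by simp
        then show ?thesis using Ln.gc_mem_swap[of x y] x y by simp
      next
        case False
        then show ?thesis using * that by blast
      qed
      then have "N \<subseteq> L" by (intro derived_minimal[OF Ln.is_subgroup]) auto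
      then show False using a(1,4) by (auto simp: L_def M1)
    qed
    then show thesis using that by blast
  qed
  define d where "d = gc y x"
  have dN: "d \<in> N" unfolding d_def by (rule gc_derived[OF y x])
  have dG: "d \<in> carrier G" using dN N_carrier by auto
  have "gc d x \<in> L" using NZ dN x by (auto simp: centralizer_mod_def)
  then have dx: "gc d x = c" using L_elems xy by (auto simp: d_def)
  have dd: "d \<otimes> d = \<one>"
  proof -
    have "d \<in> adjoin a (adjoin c {\<one>})" using dN Neq M1 by simp
    then obtain i :: nat and l where l: "l \<in> adjoin c {\<one>}" "d = a [^] i \<otimes> l" unfolding adjoin_def[of a] by blast
    then obtain j :: nat and t where t: "t \<in> {\<one>}" "l = c [^] j \<otimes> t" unfolding adjoin_def by blast
    have "d [^] p \<in> adjoin (a [^] p) {\<one>}"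
      unfolding l(2) t(2) by (rule pow_product_central_mod[OF one_is_normal _ aG _ t(1)]) (use c M1 in auto)
    then have "d [^] p = \<one>" using aa p2 by (auto simp: adjoin_def)
    then show ?thesis using p2 dG by (simp add: numeral_2_eq_2)
  qed
  have d1: "d \<noteq> \<one>"
  proof
    assume "d = \<one>"
    then have "gc d x = \<one>" using x by (simp add: gc_eq_one_iff)
    then show False using xy by (simp add: d_def)
  qed
  have c1: "c \<noteq> \<one>" using xy dx by (simp add: d_def)
  have dc: "d \<noteq> c"
  proof
    assume "d = c"
    then have "gc d x = \<one>" using x cG c_central by (simp add: gc_eq_one_iff)
    then show False using xy by (simp add: d_def)
  qed
  \<comment> \<open>conjugation by \<open>x\<close> sends \<open>y\<close> to \<open>y d\<close> and \<open>d\<close> to \<open>d c\<close>; iterate it three times using \<open>d\<^sup>2 = 1\<close>\<close>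
  have yx: "y \<otimes> x = x \<otimes> (y \<otimes> d)" using mult_gc[OF y x] x y dG by (simp add: d_def m_assoc)
  have dxx: "d \<otimes> x = x \<otimes> (d \<otimes> c)" using mult_gc[OF dG x] x dG cG by (simp add: dx m_assoc)
  have x2: "y \<otimes> (x \<otimes> x) = x \<otimes> x \<otimes> (y \<otimes> c)"
  proof -
    have "y \<otimes> (x \<otimes> x) = x \<otimes> (y \<otimes> (d \<otimes> x))" using yx x y dG by (simp add: m_assoc[symmetric])
    also have "\<dots> = x \<otimes> ((y \<otimes> x) \<otimes> (d \<otimes> c))" unfolding dxx using x y dG cG by (simp add: m_assoc)
    also have "\<dots> = x \<otimes> (x \<otimes> (y \<otimes> ((d \<otimes> d) \<otimes> c)))" unfolding yx using x y dG cG by (simp add: m_assoc)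
    finally show ?thesis using x y dG cG dd by (simp add: m_assoc)
  qed
  have x3: "y \<otimes> (x \<otimes> x \<otimes> x) = x \<otimes> x \<otimes> x \<otimes> (y \<otimes> (d \<otimes> c))"
  proof -
    have "y \<otimes> (x \<otimes> x \<otimes> x) = (y \<otimes> (x \<otimes> x)) \<otimes> x" using x y by (simp add: m_assoc)
    also have "\<dots> = x \<otimes> x \<otimes> (y \<otimes> (c \<otimes> x))" unfolding x2 using x y cG by (simp add: m_assoc)
    also have "\<dots> = x \<otimes> x \<otimes> ((y \<otimes> x) \<otimes> c)" using c_central[OF x] x y cG by (simp add: m_assoc)
    also have "\<dots> = x \<otimes> x \<otimes> x \<otimes> (y \<otimes> (d \<otimes> c))" unfolding yx using x y dG cG by (simp add: m_assoc)
    finally show ?thesis .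
  qed
  have noncommuting_y: "y \<otimes> w \<noteq> w \<otimes> y"
    if yw: "y \<otimes> w = w \<otimes> (y \<otimes> z)" and z: "z \<noteq> \<one>" and wG: "w \<in> carrier G" "z \<in> carrier G" for w z
  proof
    assume "y \<otimes> w = w \<otimes> y"
    then have "w \<otimes> (y \<otimes> z) = w \<otimes> (y \<otimes> \<one>)" using yw y by simp
    then have "z = \<one>" using left_cancel wG y by simp
    then show False using z by simp
  qed
  have dc1: "d \<otimes> c \<noteq> \<one>"
  proof
    assume "d \<otimes> c = \<one>"
    then have "d \<otimes> c = d \<otimes> d" using dd by simp
    then show False using dc left_cancel[of d c d] dG cG by blast
  qed
  show ?thesis
  proof (rule T_nonzero[OF y x])
    fix i :: nat assume "0 < i" "i < 4"
    then consider "i = 1" | "i = 2" | "i = 3" by linarith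
    then show "y \<otimes> x [^] i \<noteq> x [^] i \<otimes> y"
    proof cases
      case 1
      then have e: "x [^] i = x" using x by simp
      show ?thesis unfolding e by (rule noncommuting_y[OF yx d1 x dG])
    next
      case 2
      then have e: "x [^] i = x \<otimes> x" using x by (simp add: numeral_2_eq_2)
      show ?thesis unfolding e by (rule noncommuting_y[OF x2 c1 m_closed[OF x x] cG])
    next
      case 3
      then have e: "x [^] i = x \<otimes> x \<otimes> x" using x by (simp add: numeral_3_eq_3)
      show ?thesis unfolding e by (rule noncommuting_y[OF x3 dc1 m_closed[OF m_closed[OF x x] x] m_closed[OF dG cG]])
    qed
  qed simp
qed

end

section \<open>The nilpotency index\<close>

context lie_nilpotent_group_ring
begin

lemma index_eqI:
  assumes "finite N" and "R.T (card N) \<noteq> {\<zero>\<^bsub>R\<^esub>}"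
  shows "lie_nilpotency_index R = card N + 1"
  unfolding lie_nilpotency_index_def
proof (rule Least_equality)
  have "R.T (Suc (card N)) \<subseteq> {\<zero>\<^bsub>R\<^esub>}" using R.T_subset_V V_card_N[OF assms(1)] by blast
  then show "1 \<le> card N + 1 \<and> R.T (card N + 1) = {\<zero>\<^bsub>R\<^esub>}" using R.ideal_zero[OF R.T_ideal] by auto
  fix y assume y: "1 \<le> y \<and> R.T y = {\<zero>\<^bsub>R\<^esub>}"
  show "card N + 1 \<le> y"
  proof (rule ccontr)
    assume "\<not> card N + 1 \<le> y"
    then have "R.T (card N) \<subseteq> {\<zero>\<^bsub>R\<^esub>}" using R.T_antimono[of y "card N"] y by auto
    then show False using assms(2) R.ideal_zero[OF R.T_ideal] by auto
  qed
qed

lemma index_eq_iff: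
  "lie_nilpotency_index R = card N + 1 \<longleftrightarrow>
     cyclic_mod {\<one>} \<or> (p = 2 \<and> card N = 4 \<and> \<not> cyclic_mod {\<one>} \<and> lower_central G 3 \<noteq> {\<one>})"
proof
  assume "cyclic_mod {\<one>} \<or> (p = 2 \<and> card N = 4 \<and> \<not> cyclic_mod {\<one>} \<and> lower_central G 3 \<noteq> {\<one>})"
  then show "lie_nilpotency_index R = card N + 1"
  proof (elim disjE conjE)
    assume "cyclic_mod {\<one>}"
    then show ?thesis by (intro index_eqI cyclic_finite cyclic_lower_bound)
  next
    assume *: "p = 2" "card N = 4" "\<not> cyclic_mod {\<one>}" "lower_central G 3 \<noteq> {\<one>}"
    have "finite N" using *(2) card_ge_0_finite[of N] by linarith
    moreover have "R.T (card N) \<noteq> {\<zero>\<^bsub>R\<^esub>}" unfolding *(2) by (rule klein_lower_bound[OF *])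
    ultimately show ?thesis by (rule index_eqI)
  qed
next
  assume t: "lie_nilpotency_index R = card N + 1"
  have notT: "\<not> (1 \<le> y \<and> R.T y = {\<zero>\<^bsub>R\<^esub>})" if "y < card N + 1" for y
    using not_less_Least[of y "\<lambda>m. 1 \<le> m \<and> R.T m = {\<zero>\<^bsub>R\<^esub>}"] that t by (simp add: lie_nilpotency_index_def)
  have Tt: "R.T (card N + 1) = {\<zero>\<^bsub>R\<^esub>}"
    using LeastI[of "\<lambda>m. 1 \<le> m \<and> R.T m = {\<zero>\<^bsub>R\<^esub>}" m] m T_m t by (simp add: lie_nilpotency_index_def)
  have T1: "R.T 1 \<noteq> {\<zero>\<^bsub>R\<^esub>}" using T_nonzero[of \<one> \<one> 1] by simp
  have "card N \<noteq> 0" using Tt T1 by (metis add_0)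
  then have fin: "finite N" and n1: "card N \<ge> 1" using card_ge_0_finite[of N] by linarith+
  show "cyclic_mod {\<one>} \<or> (p = 2 \<and> card N = 4 \<and> \<not> cyclic_mod {\<one>} \<and> lower_central G 3 \<noteq> {\<one>})"
  proof (rule ccontr)
    assume neg: "\<not> ?thesis"
    have nc: "\<not> cyclic_mod {\<one>}" and ns: "\<not> (p = 2 \<and> card N = 4 \<and> lower_central G 3 \<noteq> {\<one>})" using neg by blast+
    obtain M s where M: "M \<lhd> G" "M \<subseteq> N" "R.V s \<subseteq> aug M" "s * card M < card N"
      by (rule gain[OF fin nc ns])
    have "R.T (card N) \<subseteq> R.V (card N - 1)" using R.T_subset_V[of "card N - 1"] n1 by simp
    also have "\<dots> \<subseteq> R.V (s * card M)" using M(4) by (intro R.V_antimono) simp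
    also have "\<dots> \<subseteq> {\<zero>\<^bsub>R\<^esub>}" by (rule V_vanishes[OF fin M(1-3)])
    finally have "R.T (card N) = {\<zero>\<^bsub>R\<^esub>}" using R.ideal_zero[OF R.T_ideal] by auto
    then show False using notT[of "card N"] n1 by simp
  qed
qed

end

lemma (in field) ring_char_prime:
  assumes "ring_char R > 0"
  shows "prime (ring_char R)" "[ring_char R] \<cdot> \<one> = \<zero>"
proof -
  define p where "p = ring_char R"
  let ?P = "\<lambda>n::nat. 0 < n \<and> [n] \<cdot> \<one> = \<zero>"
  have ex: "\<exists>n. ?P n" using assms by (auto simp: ring_char_def split: if_splits)
  then have p: "p = (LEAST n. ?P n)" by (simp add: p_def ring_char_def)
  have P: "?P p" unfolding p by (rule LeastI_ex[OF ex])
  have least: "p \<le> n" if "?P n" for n unfolding p by (rule Least_le[of ?P, OF that])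
  show "[ring_char R] \<cdot> \<one> = \<zero>" using P by (simp add: p_def)
  have "p \<noteq> 1"
  proof
    assume "p = 1"
    then show False using P by simp
  qed
  moreover have "n = 1 \<or> n = p" if "n dvd p" for n
  proof -
    obtain k where k: "p = n * k" using \<open>n dvd p\<close> by auto
    then have nk: "n > 0" "k > 0" using P by auto
    have "[n] \<cdot> \<one> \<otimes> [k] \<cdot> \<one> = [p] \<cdot> \<one>"
      unfolding k by (simp add: add_pow_ldistr add.nat_pow_pow mult.commute)
    then have "[n] \<cdot> \<one> = \<zero> \<or> [k] \<cdot> \<one> = \<zero>" using P integral by simp
    then have "p \<le> n \<or> p \<le> k" using least nk by blast
    then show ?thesis
    proof
      assume "p \<le> n"
      then show ?thesis using that P by (auto dest: dvd_imp_le)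
    next
      assume "p \<le> k"
      then have "n * k \<le> 1 * k" using k by simp
      then have "n \<le> 1" using nk by (simp only: mult_le_cancel2)
      then show ?thesis using nk by simp
    qed
  qed
  ultimately show "prime (ring_char R)"
    using P unfolding p_def[symmetric] prime_nat_iff by auto
qed

theorem theorem1:
  fixes K :: "('k, 'm) ring_scheme" and G :: "('g, 'n) monoid_scheme" and p :: nat
  assumes "field K" and "ring_char K = p" and "p > 0"
    and "group G"
    and "lie_nilpotent (group_algebra K G)"
  shows "lie_nilpotency_index (group_algebra K G) = card (derived G (carrier G)) + 1 \<longleftrightarrow>
      cyclic_group (G\<lparr>carrier := derived G (carrier G)\<rparr>)
      \<or> (p = 2
          \<and> card (derived G (carrier G)) = 4
          \<and> \<not> cyclic_group (G\<lparr>carrier := derived G (carrier G)\<rparr>)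
          \<and> lower_central G 3 \<noteq> {\<one>\<^bsub>G\<^esub>})"
proof -
  obtain m where m: "m \<ge> 1" "lower_lie_power (group_algebra K G) m = {\<zero>\<^bsub>group_algebra K G\<^esub>}"
    using assms(5) by (auto simp: lie_nilpotent_def)
  interpret K: field K by (rule assms(1))
  have char: "prime p" "[p] \<cdot>\<^bsub>K\<^esub> \<one>\<^bsub>K\<^esub> = \<zero>\<^bsub>K\<^esub>" using K.ring_char_prime assms(2,3) by auto
  interpret lie_nilpotent_group_ring G K p m
    by (intro lie_nilpotent_group_ring.intro modular_group_ring.intro group_ring.intro
        modular_group_ring_axioms.intro lie_nilpotent_group_ring_axioms.intro assms char m)
  show ?thesis using index_eq_iff unfolding cyclic_mod_one_iff .
qed

end
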